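(* Let $n\ge 2$ and let $H$ be a graph with vertex set $[n]$. The following are equivalent: (1) $H$ is Laman; (2) $H$ is Henneberg; (3) there exist rooted binary trees $T_1,T_2$ on leaf set $[n]$ such that the restricted clade graph $G^H_{T_1,T_2}$ is a tree; (4) $H$ is generically minimally rigid in the plane $\mathbb{R}^2$.
   Context: A graph $H$ on $n$ vertices is Laman if it has $2n-3$ edges and every subgraph of $H$ with $v\ge 2$ vertices has at most $2v-3$ edges. A graph is Henneberg if it is the complete graph $K_2$, or it can be obtained from a smaller Henneberg graph by one of the two Henneberg moves: (i) adding a new vertex adjacent to two existing vertices; (ii) removing an existing edge $ij$ and adding a new vertex adjacent to $i$, $j$ and one other existing vertex. A rooted tree on leaf set $[n]$ has leaves labeled bijectively by $[n]$ and each internal vertex has at least two children; it is binary if each internal vertex has exactly two children. A clade of $T$ is the set of leaves below an internal vertex; $\mathrm{clade}(T)$ is the set of clades. For $S\subseteq[n]$, $c_T(S)$ is the smallest clade of $T$ containing $S$. The restricted clade graph $G^H_{T_1,T_2}$ is the bipartite multigraph whose vertex set is the disjoint union of $\mathrm{clade}(T_1)$ and $\mathrm{clade}(T_2)$ and which has, for each edge $ij$ of $H$, one edge $e_{ij}$ joining $c_{T_1}(\{i,j\})$ to $c_{T_2}(\{i,j\})$. A bar-and-joint framework $(V,E,\mathbf p)$ with $\mathbf p:V\to\mathbb{R}^d$ injective is rigid if there is $\varepsilon>0$ such that every injective $\mathbf q:V\to\mathbb{R}^d$ with $\sum_{u\in V}\|\mathbf p(u)-\mathbf q(u)\|^2\le\varepsilon$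 and $\|\mathbf q(u)-\mathbf q(v)\|=\|\mathbf p(u)-\mathbf p(v)\|$ for all $uv\in E$ has image related to the image of $\mathbf p$ by a Euclidean isometry. A graph $(V,E)$ is generically rigid in $\mathbb{R}^d$ if $(V,E,\mathbf p)$ is rigid for generic $\mathbf p$; it is generically minimally rigid if it is generically rigid and deleting any edge yields a graph that is not generically rigid. *)

theory Defs
  imports "HOL-Analysis.Analysis"
begin

definition simple_graph :: "'a set \<Rightarrow> 'a set set \<Rightarrow> bool" where
  "simple_graph V E \<longleftrightarrow> (\<forall>e\<in>E. \<exists>i j. e = {i, j} \<and> i \<noteq> j \<and> i \<in> V \<and> j \<in> V)"

definition laman :: "'a set \<Rightarrow> 'a set set \<Rightarrow> bool" where
  "laman V E \<longleftrightarrow> finite V \<and> card E = 2 * card V - 3 \<and>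
     (\<forall>S F. S \<subseteq> V \<and> F \<subseteq> E \<and> (\<forall>e\<in>F. e \<subseteq> S) \<and> card S \<ge> 2
        \<longrightarrow> card F \<le> 2 * card S - 3)"

inductive henneberg :: "'a set \<Rightarrow> 'a set set \<Rightarrow> bool" where
  K2: "a \<noteq> b \<Longrightarrow> henneberg {a, b} {{a, b}}"
| move1: "\<lbrakk>henneberg V E; v \<notin> V; a \<in> V; b \<in> V; a \<noteq> b\<rbrakk>
           \<Longrightarrow> henneberg (insert v V) (E \<union> {{v, a}, {v, b}})"
| move2: "\<lbrakk>henneberg V E; {i, j} \<in> E; i \<noteq> j; k \<in> V; k \<noteq> i; k \<noteq> j; v \<notin> V\<rbrakk>
           \<Longrightarrow> henneberg (insert v V) ((E - {{i, j}}) \<union> {{v, i}, {v, j}, {v, k}})"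

datatype btree = Leaf nat | Node btree btree

fun leaf_list :: "btree \<Rightarrow> nat list" where
  "leaf_list (Leaf i) = [i]"
| "leaf_list (Node l r) = leaf_list l @ leaf_list r"

definition binary_tree_on :: "btree \<Rightarrow> nat set \<Rightarrow> bool" where
  "binary_tree_on T L \<longleftrightarrow> distinct (leaf_list T) \<and> set (leaf_list T) = L"

fun clades :: "btree \<Rightarrow> nat set set" where
  "clades (Leaf i) = {}"
| "clades (Node l r) = insert (set (leaf_list l) \<union> set (leaf_list r)) (clades l \<union> clades r)"

definition clade_of :: "btree \<Rightarrow> nat set \<Rightarrow> nat set" where
  "clade_of T S = (THE C. C \<in> clades T \<and> S \<subseteq> C \<and> (\<forall>C'\<in>clades T. S \<subseteq> C' \<longrightarrow> C \<subseteq> C'))"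

text \<open>A multigraph: vertex set W, edge index set Ed, and endpoint map ends (edge to set of endpoints).\<close>

definition mg_adj :: "'e set \<Rightarrow> ('e \<Rightarrow> 'w set) \<Rightarrow> 'w \<Rightarrow> 'w \<Rightarrow> bool" where
  "mg_adj Ed ends u w \<longleftrightarrow> (\<exists>e\<in>Ed. ends e = {u, w})"

definition mg_connected :: "'w set \<Rightarrow> 'e set \<Rightarrow> ('e \<Rightarrow> 'w set) \<Rightarrow> bool" where
  "mg_connected W Ed ends \<longleftrightarrow> W \<noteq> {} \<and> (\<forall>u\<in>W. \<forall>w\<in>W. (mg_adj Ed ends)\<^sup>*\<^sup>* u w)"

text \<open>A cycle: distinct vertices vs and distinct edges es, edge i joining vs!i and vs!(i+1 mod len).
  (Length 1 = loop, length 2 = pair of parallel edges.)\<close>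
definition mg_cycle :: "'w set \<Rightarrow> 'e set \<Rightarrow> ('e \<Rightarrow> 'w set) \<Rightarrow> 'w list \<Rightarrow> 'e list \<Rightarrow> bool" where
  "mg_cycle W Ed ends vs es \<longleftrightarrow> length vs \<ge> 1 \<and> length es = length vs \<and>
     distinct vs \<and> distinct es \<and> set vs \<subseteq> W \<and> set es \<subseteq> Ed \<and>
     (\<forall>i < length es. ends (es ! i) = {vs ! i, vs ! ((i + 1) mod length vs)})"

definition mg_tree :: "'w set \<Rightarrow> 'e set \<Rightarrow> ('e \<Rightarrow> 'w set) \<Rightarrow> bool" where
  "mg_tree W Ed ends \<longleftrightarrow> finite W \<and> finite Ed \<and> (\<forall>e\<in>Ed. ends e \<subseteq> W) \<and>
     mg_connected W Ed ends \<and> (\<nexists>vs es. mg_cycle W Ed ends vs es)"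

definition clade_graph_vertices :: "btree \<Rightarrow> btree \<Rightarrow> (nat set + nat set) set" where
  "clade_graph_vertices T1 T2 = Inl ` clades T1 \<union> Inr ` clades T2"

definition clade_graph_ends :: "btree \<Rightarrow> btree \<Rightarrow> nat set \<Rightarrow> (nat set + nat set) set" where
  "clade_graph_ends T1 T2 e = {Inl (clade_of T1 e), Inr (clade_of T2 e)}"

definition restricted_clade_graph_is_tree :: "nat set set \<Rightarrow> btree \<Rightarrow> btree \<Rightarrow> bool" where
  "restricted_clade_graph_is_tree E T1 T2 \<longleftrightarrow>
     mg_tree (clade_graph_vertices T1 T2) E (clade_graph_ends T1 T2)"

datatype 'v pexpr = PConst rat | PVar 'v | PAdd "'v pexpr" "'v pexpr" | PMul "'v pexpr" "'v pexpr"
  | PNeg "'v pexpr"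

fun peval :: "('v \<Rightarrow> real) \<Rightarrow> 'v pexpr \<Rightarrow> real" where
  "peval x (PConst c) = of_rat c"
| "peval x (PVar v) = x v"
| "peval x (PAdd a b) = peval x a + peval x b"
| "peval x (PMul a b) = peval x a * peval x b"
| "peval x (PNeg a) = - peval x a"

fun pvars :: "'v pexpr \<Rightarrow> 'v set" where
  "pvars (PConst c) = {}"
| "pvars (PVar v) = {v}"
| "pvars (PAdd a b) = pvars a \<union> pvars b"
| "pvars (PMul a b) = pvars a \<union> pvars b"
| "pvars (PNeg a) = pvars a"

text \<open>p is generic: the coordinates of p on V are algebraically independent over Q, i.e.
  every rational polynomial in them vanishing at p is the zero polynomial (vanishes everywhere).\<close>
definition generic :: "'a set \<Rightarrow> ('a \<Rightarrow> real^2) \<Rightarrow> bool" where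
  "generic V p \<longleftrightarrow> (\<forall>e :: ('a \<times> 2) pexpr. pvars e \<subseteq> V \<times> UNIV \<longrightarrow>
      peval (\<lambda>(u, i). p u $ i) e = 0 \<longrightarrow> (\<forall>x. peval x e = 0))"

definition rigid_framework :: "'a set \<Rightarrow> 'a set set \<Rightarrow> ('a \<Rightarrow> real^2) \<Rightarrow> bool" where
  "rigid_framework V E p \<longleftrightarrow>
     (\<exists>\<epsilon>>0. \<forall>q. inj_on q V \<and> (\<Sum>u\<in>V. (norm (p u - q u))\<^sup>2) \<le> \<epsilon> \<and>
        (\<forall>u v. {u, v} \<in> E \<longrightarrow> dist (q u) (q v) = dist (p u) (p v))
        \<longrightarrow> (\<exists>f :: real^2 \<Rightarrow> real^2. (\<forall>x y. dist (f x) (f y) = dist x y) \<and> f ` (p ` V) = q ` V))"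

definition generically_rigid_2 :: "'a set \<Rightarrow> 'a set set \<Rightarrow> bool" where
  "generically_rigid_2 V E \<longleftrightarrow> (\<forall>p. generic V p \<and> inj_on p V \<longrightarrow> rigid_framework V E p)"

definition generically_minimally_rigid_2 :: "'a set \<Rightarrow> 'a set set \<Rightarrow> bool" where
  "generically_minimally_rigid_2 V E \<longleftrightarrow> generically_rigid_2 V E \<and>
     (\<forall>e\<in>E. \<not> generically_rigid_2 V (E - {e}))"

end

theory Submission
  imports Defs "HOL-Computational_Algebra.Polynomial"
begin

text \<open>
  Laman graphs are reduced to smaller ones by deleting a vertex of degree two or three.
  A Henneberg move is realised on a pair of trees by attaching the new leaf as a cherry at two
  different leaves; for the second move the two leaves are chosen according to how the clade graph
  falls apart when \<open>e\<^sub>i\<^sub>j\<close> is deleted. Conversely the clades \<open>c\<^sub>T({i, j})\<close> with \<open>i, j \<in> S\<close>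
  number at most \<open>|S| - 1\<close>, and a forest has fewer edges than vertices.

  On the geometric side, a Henneberg graph is infinitesimally rigid at a special position, and
  fraction-free elimination turns independence at one point into the nonvanishing of a rational
  polynomial, hence into independence at and near every generic point. If \<open>p\<close> and \<open>q\<close> have equal edge
  lengths then \<open>q - p\<close> is an infinitesimal motion of \<open>(p + q) / 2\<close>; this gives rigidity without any
  differential calculus. The same identity, read backwards, yields flexes when the generic rank is
  too small, so a generically rigid graph contains a Laman graph given by a basis of rows of its
  rigidity matrix.
\<close>

section \<open>Linear independence over finite index sets\<close>

text \<open>Genericity means algebraic independence over the rationals, so every statement about
  ranks has to be witnessed by a polynomial with rational coefficients. Matrix entries are therefore
  kept as syntactic expressions; these have no division, which is why elimination cross-multiplies
  throughout. Two features of the definition of rigidity cause work. Generic rigidity quantifies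
  over all generic placements, so using it requires that one exists, which is a counting argument.
  And rigidity only provides an isometry carrying the point set of \<open>p\<close> onto that of
  \<open>q\<close>, not vertex to vertex; this is repaired by taking \<open>q\<close> so close to
  \<open>p\<close> that no distance can jump to another of the finitely many values. The two leaves
  receiving the new leaf must differ: at a common leaf \<open>x\<close> the edge \<open>vx\<close>
  would join the two new cherry clades to each other and to nothing else, leaving them a separate
  component. Sparsity of Henneberg graphs is never shown directly. It comes through the trees, and
  the resulting edge count yields minimality in the plane.\<close>

definition indep_rows :: "'r set \<Rightarrow> 'c set \<Rightarrow> ('r \<Rightarrow> 'c \<Rightarrow> real) \<Rightarrow> bool" where
  "indep_rows R C M \<longleftrightarrow> (\<forall>l. (\<forall>c\<in>C. (\<Sum>r\<in>R. l r * M r c) = 0) \<longrightarrow> (\<forall>r\<in>R. l r = 0))"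

text \<open>Gaussian elimination of column \<open>c0\<close> by row \<open>r0\<close>, multiplied
  through by the pivot entry. Column \<open>c0\<close> and row \<open>r0\<close> become zero without
  any division.\<close>

definition pivot :: "('r \<Rightarrow> 'c \<Rightarrow> real) \<Rightarrow> 'r \<Rightarrow> 'c \<Rightarrow> 'r \<Rightarrow> 'c \<Rightarrow> real" where
  "pivot M r0 c0 r c = M r0 c0 * M r c - M r c0 * M r0 c"

lemma indep_rowsD:
  assumes "indep_rows R C M" "\<And>c. c \<in> C \<Longrightarrow> (\<Sum>r\<in>R. l r * M r c) = 0" "r \<in> R"
  shows "l r = 0"
  using assms unfolding indep_rows_def by blast

lemma indep_rows_nonzero_entry:
  assumes "finite R" "r0 \<in> R" "indep_rows R C M"
  shows "\<exists>c\<in>C. M r0 c \<noteq> 0"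
proof (rule ccontr)
  assume "\<not> ?thesis"
  then have z: "M r0 c = 0" if "c \<in> C" for c using that by blast
  have "(\<Sum>r\<in>R. (if r = r0 then 1 else 0) * M r c) = 0" if "c \<in> C" for c
    using z[OF that] by (intro sum.neutral) auto
  from indep_rowsD[OF assms(3) this assms(2)] show False by simp
qed

lemma indep_rows_subset:
  assumes "finite R" "R' \<subseteq> R" "indep_rows R C M"
  shows "indep_rows R' C M"
  unfolding indep_rows_def
proof (intro allI impI ballI)
  fix l r assume l: "\<forall>c\<in>C. (\<Sum>r\<in>R'. l r * M r c) = 0" and r: "r \<in> R'"
  have "(\<Sum>r\<in>R. (if r \<in> R' then l r else 0) * M r c) = 0" if "c \<in> C" for c
  proof -
    have "(\<Sum>r\<in>R. (if r \<in> R' then l r else 0) * M r c) = (\<Sum>r\<in>R'. (if r \<in> R' then l r else 0) * M r c)"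
      using assms by (intro sum.mono_neutral_right) auto
    then show ?thesis using l that by simp
  qed
  from indep_rowsD[OF assms(3) this, of r] r assms(2) show "l r = 0" by auto
qed

text \<open>A dependency of \<open>insert r0 R\<close> is determined by its part on
  \<open>R\<close>: column \<open>c0\<close> forces the coefficient of \<open>r0\<close>, and
  eliminating that coefficient leaves a dependency of the pivoted rows on the remaining
  columns.\<close>

lemma indep_rows_pivot:
  assumes R: "finite R" "r0 \<notin> R" and c0: "c0 \<in> C" "M r0 c0 \<noteq> 0"
  shows "indep_rows (insert r0 R) C M \<longleftrightarrow> indep_rows R (C - {c0}) (pivot M r0 c0)"
proof
  assume ind: "indep_rows (insert r0 R) C M"
  show "indep_rows R (C - {c0}) (pivot M r0 c0)"
    unfolding indep_rows_def
  proof (intro allI impI ballI)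
    fix l r assume l: "\<forall>c\<in>C - {c0}. (\<Sum>r\<in>R. l r * pivot M r0 c0 r c) = 0" and r: "r \<in> R"
    \<comment> \<open>The coefficient of \<open>r0\<close> is dictated by column \<open>c0\<close>;
      the others carry the factor \<open>M r0 c0\<close> that would otherwise be a
      denominator.\<close>
    define l' where "l' r = (if r = r0 then - (\<Sum>s\<in>R. l s * M s c0) else M r0 c0 * l r)" for r
    have "(\<Sum>r\<in>insert r0 R. l' r * M r c) = 0" if "c \<in> C" for c
    proof -
      have "(\<Sum>r\<in>insert r0 R. l' r * M r c) =
          l' r0 * M r0 c + (\<Sum>r\<in>R. l' r * M r c)" using R by simp
      also have "(\<Sum>r\<in>R. l' r * M r c) = (\<Sum>r\<in>R. M r0 c0 * l r * M r c)"
        using R by (intro sum.cong) (auto simp: l'_def)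
      also have "l' r0 * M r0 c + (\<Sum>r\<in>R. M r0 c0 * l r * M r c) = (\<Sum>r\<in>R. l r * pivot M r0 c0 r c)"
        by (simp add: l'_def pivot_def algebra_simps sum_subtractf sum_distrib_left)
      also have "\<dots> = 0" using l that by (cases "c = c0") (auto simp: pivot_def)
      finally show ?thesis .
    qed
    from indep_rowsD[OF ind this, of r] r have "l' r = 0" by auto
    then show "l r = 0" using r R c0 by (auto simp: l'_def split: if_splits)
  qed
next
  assume ind: "indep_rows R (C - {c0}) (pivot M r0 c0)"
  show "indep_rows (insert r0 R) C M"
    unfolding indep_rows_def
  proof (intro allI impI)
    fix l assume l: "\<forall>c\<in>C. (\<Sum>r\<in>insert r0 R. l r * M r c) = 0"
    have e: "(\<Sum>r\<in>R. l r * M r c) = - l r0 * M r0 c" if "c \<in> C" for c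
      using l that R by (simp add: eq_neg_iff_add_eq_0 add.commute)
    have "(\<Sum>r\<in>R. l r * pivot M r0 c0 r c) = 0" if "c \<in> C - {c0}" for c
    proof -
      have "(\<Sum>r\<in>R. l r * pivot M r0 c0 r c) =
        M r0 c0 * (\<Sum>r\<in>R. l r * M r c) - (\<Sum>r\<in>R. l r * M r c0) * M r0 c"
        by (simp add: pivot_def algebra_simps sum_subtractf sum_distrib_left)
      then show ?thesis using e[of c] e[of c0] that c0 by simp
    qed
    from indep_rowsD[OF ind this] have z: "l r = 0" if "r \<in> R" for r using that by blast
    then have "l r0 * M r0 c0 = 0" using e[OF c0(1)] by simp
    then show "\<forall>r\<in>insert r0 R. l r = 0" using z c0 by auto
  qed
qed

lemma indep_rows_card_le:
  assumes "finite R" "finite C" "indep_rows R C M"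
  shows "card R \<le> card C"
  using assms
proof (induction R arbitrary: C M rule: finite_induct)
  case (insert r0 R)
  from indep_rows_nonzero_entry[OF _ _ insert.prems(2), of r0] insert.hyps
  obtain c0 where c0: "c0 \<in> C" "M r0 c0 \<noteq> 0" by auto
  have "card R \<le> card (C - {c0})"
    using insert.IH[of "C - {c0}"] insert.prems indep_rows_pivot[of R r0 c0 C M] insert.hyps c0 by auto
  then show ?case using insert.hyps c0 insert.prems card_gt_0_iff[of C] by (auto simp: card_Diff_singleton)
qed auto

section \<open>Polynomial expressions\<close>

abbreviation PSub :: "'v pexpr \<Rightarrow> 'v pexpr \<Rightarrow> 'v pexpr" where
  "PSub a b \<equiv> PAdd a (PNeg b)"

abbreviation (input) eval_matrix :: "('v \<Rightarrow> real) \<Rightarrow> ('r \<Rightarrow> 'c \<Rightarrow> 'v pexpr) \<Rightarrow> 'r \<Rightarrow> 'c \<Rightarrow> real" where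
  "eval_matrix x A \<equiv> (\<lambda>r c. peval x (A r c))"

definition pexpr_pivot :: "('r \<Rightarrow> 'c \<Rightarrow> 'v pexpr) \<Rightarrow> 'r \<Rightarrow> 'c \<Rightarrow> 'r \<Rightarrow> 'c \<Rightarrow> 'v pexpr" where
  "pexpr_pivot A r0 c0 r c = PSub (PMul (A r0 c0) (A r c)) (PMul (A r c0) (A r0 c))"

lemma eval_matrix_pexpr_pivot:
  "eval_matrix x (pexpr_pivot A r0 c0) = pivot (eval_matrix x A) r0 c0"
  by (simp add: fun_eq_iff pexpr_pivot_def pivot_def)

lemma pexpr_sum_exists:
  assumes "finite C"
  shows "\<exists>s. \<forall>x. peval x s = (\<Sum>c\<in>C. peval x (f c))"
  using assms
proof (induction C rule: finite_induct)
  case empty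
  show ?case by (intro exI[of _ "PConst 0"]) simp
next
  case (insert c C)
  then obtain s where "\<forall>x. peval x s = (\<Sum>c\<in>C. peval x (f c))" by blast
  then show ?case using insert.hyps by (intro exI[of _ "PAdd (f c) s"]) simp
qed

text \<open>\<open>D\<close> is the product of the pivot entries met during elimination. They are
  chosen nonzero at \<open>x0\<close>, but the elimination is symbolic, so the same run succeeds
  wherever \<open>D\<close> does not vanish.\<close>

lemma indep_rows_certificate:
  assumes "finite R" "indep_rows R C (eval_matrix x0 A)"
    and "\<And>r c. r \<in> R \<Longrightarrow> c \<in> C \<Longrightarrow> pvars (A r c) \<subseteq> W"
  shows "\<exists>D. pvars D \<subseteq> W \<and> peval x0 D \<noteq> 0 \<and>
             (\<forall>x. peval x D \<noteq> 0 \<longrightarrow> indep_rows R C (eval_matrix x A))"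
  using assms
proof (induction R arbitrary: C A rule: finite_induct)
  case empty
  show ?case by (intro exI[of _ "PConst 1"]) (auto simp: indep_rows_def)
next
  case (insert r0 R)
  from indep_rows_nonzero_entry[OF _ _ insert.prems(1), of r0] insert.hyps
  obtain c0 where c0: "c0 \<in> C" "peval x0 (A r0 c0) \<noteq> 0" by auto
  have "indep_rows R (C - {c0}) (eval_matrix x0 (pexpr_pivot A r0 c0))"
    using insert.prems(1) indep_rows_pivot[OF insert.hyps c0(1), of "eval_matrix x0 A"] c0(2)
    unfolding eval_matrix_pexpr_pivot by simp
  moreover have "pvars (pexpr_pivot A r0 c0 r c) \<subseteq> W" if "r \<in> R" "c \<in> C - {c0}" for r c
    using insert.prems(2)[of r0 c0] insert.prems(2)[of r0 c] insert.prems(2)[of r c0] insert.prems(2)[of r c] that c0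
    by (auto simp: pexpr_pivot_def)
  ultimately obtain D where D: "pvars D \<subseteq> W" "peval x0 D \<noteq> 0"
    "\<And>x. peval x D \<noteq> 0 \<Longrightarrow> indep_rows R (C - {c0}) (eval_matrix x (pexpr_pivot A r0 c0))"
    using insert.IH[of "C - {c0}" "pexpr_pivot A r0 c0"] by auto
  show ?case
  proof (intro exI[of _ "PMul (A r0 c0) D"] conjI allI impI)
    show "pvars (PMul (A r0 c0) D) \<subseteq> W" using D(1) insert.prems(2)[of r0 c0] c0 by auto
    show "peval x0 (PMul (A r0 c0) D) \<noteq> 0" using D(2) c0 by simp
    fix x assume "peval x (PMul (A r0 c0) D) \<noteq> 0"
    then have x: "peval x (A r0 c0) \<noteq> 0" "peval x D \<noteq> 0" by auto
    show "indep_rows (insert r0 R) C (eval_matrix x A)"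
      using D(3)[OF x(2)] indep_rows_pivot[OF insert.hyps c0(1), of "eval_matrix x A"] x(1)
      unfolding eval_matrix_pexpr_pivot by simp
  qed
qed

text \<open>Back-substitution with cleared denominators; a surplus column leaves a free entry.
  Orthogonality to the rows is an identity valid at every \<open>x\<close>, and only the
  nonvanishing refers to \<open>x0\<close>.\<close>

lemma polynomial_kernel_vector:
  assumes "finite R" "finite C" "card R < card C" "indep_rows R C (eval_matrix x0 A)"
  shows "\<exists>K. (\<forall>x. \<forall>r\<in>R. (\<Sum>c\<in>C. peval x (A r c) * peval x (K c)) = 0) \<and>
             (\<exists>c\<in>C. peval x0 (K c) \<noteq> 0)"
  using assms
proof (induction R arbitrary: C A rule: finite_induct)
  case empty
  then have "C \<noteq> {}" by auto
  then show ?case by (intro exI[of _ "\<lambda>_. PConst 1"]) auto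
next
  case (insert r0 R)
  from indep_rows_nonzero_entry[OF _ _ insert.prems(3), of r0] insert.hyps
  obtain c0 where c0: "c0 \<in> C" "peval x0 (A r0 c0) \<noteq> 0" by auto
  have "indep_rows R (C - {c0}) (eval_matrix x0 (pexpr_pivot A r0 c0))"
    using insert.prems(3) indep_rows_pivot[OF insert.hyps c0(1), of "eval_matrix x0 A"] c0(2)
    unfolding eval_matrix_pexpr_pivot by simp
  moreover have "card R < card (C - {c0})"
    using insert.prems insert.hyps c0 by (simp add: card_Diff_singleton)
  ultimately obtain K where K: "\<And>x r. r \<in> R \<Longrightarrow> (\<Sum>c\<in>C-{c0}. peval x (pexpr_pivot A r0 c0 r c) * peval x (K c)) = 0"
      and K0: "\<exists>c\<in>C-{c0}. peval x0 (K c) \<noteq> 0"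
    using insert.IH[of "C - {c0}" "pexpr_pivot A r0 c0"] insert.prems by auto
  obtain s where s: "\<And>x. peval x s = (\<Sum>c\<in>C-{c0}. peval x (PMul (A r0 c) (K c)))"
    using pexpr_sum_exists[of "C-{c0}" "\<lambda>c. PMul (A r0 c) (K c)"] insert.prems by auto
  \<comment> \<open>Row \<open>r0\<close> determines the entry at \<open>c0\<close>; the other
    entries are scaled by \<open>A r0 c0\<close> instead of dividing by it.\<close>
  define K' where "K' c = (if c = c0 then PNeg s else PMul (A r0 c0) (K c))" for c
  have row: "(\<Sum>c\<in>C. peval x (A r c) * peval x (K' c)) =
      (\<Sum>c\<in>C-{c0}. peval x (pexpr_pivot A r0 c0 r c) * peval x (K c))" for x r
  proof -
    have "(\<Sum>c\<in>C. peval x (A r c) * peval x (K' c)) = peval x (A r c0) * peval x (K' c0) +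
       (\<Sum>c\<in>C-{c0}. peval x (A r c) * peval x (K' c))"
      using insert.prems c0 by (simp add: sum.remove)
    also have "(\<Sum>c\<in>C-{c0}. peval x (A r c) * peval x (K' c)) =
       (\<Sum>c\<in>C-{c0}. peval x (A r c) * (peval x (A r0 c0) * peval x (K c)))"
      by (intro sum.cong) (auto simp: K'_def)
    also have "peval x (A r c0) * peval x (K' c0) + \<dots> =
        (\<Sum>c\<in>C-{c0}. peval x (pexpr_pivot A r0 c0 r c) * peval x (K c))"
      by (simp add: K'_def s pexpr_pivot_def algebra_simps sum_distrib_left sum_subtractf sum.distrib sum_negf)
    finally show ?thesis .
  qed
  show ?case
  proof (intro exI[of _ K'] conjI allI ballI)
    fix x r assume r: "r \<in> insert r0 R"
    show "(\<Sum>c\<in>C. peval x (A r c) * peval x (K' c)) = 0"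
    proof (cases "r = r0")
      case True
      show ?thesis unfolding row True by (intro sum.neutral) (auto simp: pexpr_pivot_def)
    next
      case False
      then show ?thesis using row K r by auto
    qed
  next
    show "\<exists>c\<in>C. peval x0 (K' c) \<noteq> 0"
      using K0 c0 by (auto simp: K'_def)
  qed
qed

text \<open>A bound and a Lipschitz constant on the box of radius 1 around \<open>x0\<close> are
  proved together because the product case needs both. A single \<open>L\<close> serves for both,
  hence the factor 2 in that case.\<close>

lemma peval_Lipschitz:
  fixes e :: "'v pexpr"
  shows "\<exists>L\<ge>0. \<forall>x y d. (\<forall>v. \<bar>x v - x0 v\<bar> \<le> 1) \<longrightarrow> (\<forall>v. \<bar>y v - x0 v\<bar> \<le> 1) \<longrightarrow> (\<forall>v. \<bar>x v - y v\<bar> \<le> d) \<longrightarrow>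
     \<bar>peval x e\<bar> \<le> L \<and> \<bar>peval x e - peval y e\<bar> \<le> L * d"
proof (induction e)
  case (PConst c)
  show ?case 
  proof (intro exI[of _ "\<bar>of_rat c\<bar>"] conjI allI impI)
    fix x y :: "'v \<Rightarrow> real" and d assume "\<forall>v. \<bar>x v - y v\<bar> \<le> d"
    then have "d \<ge> 0" by (meson abs_ge_zero order_trans)
    then show "\<bar>peval x (PConst c) - peval y (PConst c)\<bar> \<le> \<bar>real_of_rat c\<bar> * d" by simp
  qed auto
next
  case (PVar v)
  show ?case
  proof (intro exI[of _ "\<bar>x0 v\<bar> + 1"] conjI allI impI)
    fix x y :: "'v \<Rightarrow> real" and d assume a: "\<forall>v. \<bar>x v - x0 v\<bar> \<le> 1" "\<forall>v. \<bar>x v - y v\<bar> \<le> d"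
    then have "d \<ge> 0" by (meson abs_ge_zero order_trans)
    then have "d \<le> (\<bar>x0 v\<bar> + 1) * d" by (simp add: algebra_simps)
    then show "\<bar>peval x (PVar v) - peval y (PVar v)\<bar> \<le> (\<bar>x0 v\<bar> + 1) * d"
      using a(2)[rule_format, of v] by simp
    show "\<bar>peval x (PVar v)\<bar> \<le> \<bar>x0 v\<bar> + 1" using a(1)[rule_format, of v] by simp
  qed auto
next
  case (PAdd a b)
  then obtain L L' where L: "L \<ge> 0" "L' \<ge> 0" 
    "\<And>x y d. (\<forall>v. \<bar>x v - x0 v\<bar> \<le> 1) \<Longrightarrow> (\<forall>v. \<bar>y v - x0 v\<bar> \<le> 1) \<Longrightarrow> (\<forall>v. \<bar>x v - y v\<bar> \<le> d) \<Longrightarrow>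
     \<bar>peval x a\<bar> \<le> L \<and> \<bar>peval x a - peval y a\<bar> \<le> L * d"
    "\<And>x y d. (\<forall>v. \<bar>x v - x0 v\<bar> \<le> 1) \<Longrightarrow> (\<forall>v. \<bar>y v - x0 v\<bar> \<le> 1) \<Longrightarrow> (\<forall>v. \<bar>x v - y v\<bar> \<le> d) \<Longrightarrow>
     \<bar>peval x b\<bar> \<le> L' \<and> \<bar>peval x b - peval y b\<bar> \<le> L' * d" by blast
  show ?case
  proof (intro exI[of _ "L + L'"] allI impI, intro conjI allI impI)
    fix x y :: "'v \<Rightarrow> real" and d 
    assume "\<forall>v. \<bar>x v - x0 v\<bar> \<le> 1" "\<forall>v. \<bar>y v - x0 v\<bar> \<le> 1" "\<forall>v. \<bar>x v - y v\<bar> \<le> d"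
    note l = L(3)[OF this] L(4)[OF this]
    show "\<bar>peval x (PAdd a b)\<bar> \<le> L + L'" using l by (simp, linarith)
    show "\<bar>peval x (PAdd a b) - peval y (PAdd a b)\<bar> \<le> (L + L') * d"
      unfolding peval.simps distrib_right using l by linarith
  qed (use L(1,2) in simp)
next
  case (PMul a b)
  then obtain L L' where L: "L \<ge> 0" "L' \<ge> 0" 
    "\<And>x y d. (\<forall>v. \<bar>x v - x0 v\<bar> \<le> 1) \<Longrightarrow> (\<forall>v. \<bar>y v - x0 v\<bar> \<le> 1) \<Longrightarrow> (\<forall>v. \<bar>x v - y v\<bar> \<le> d) \<Longrightarrow>
     \<bar>peval x a\<bar> \<le> L \<and> \<bar>peval x a - peval y a\<bar> \<le> L * d"
    "\<And>x y d. (\<forall>v. \<bar>x v - x0 v\<bar> \<le> 1) \<Longrightarrow> (\<forall>v. \<bar>y v - x0 v\<bar> \<le> 1) \<Longrightarrow> (\<forall>v. \<bar>x v - y v\<bar> \<le> d) \<Longrightarrow>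
     \<bar>peval x b\<bar> \<le> L' \<and> \<bar>peval x b - peval y b\<bar> \<le> L' * d" by blast
  show ?case
  proof (intro exI[of _ "2 * L * L'"] allI impI, intro conjI allI impI)
    fix x y :: "'v \<Rightarrow> real" and d 
    assume a: "\<forall>v. \<bar>x v - x0 v\<bar> \<le> 1" "\<forall>v. \<bar>y v - x0 v\<bar> \<le> 1" "\<forall>v. \<bar>x v - y v\<bar> \<le> d"
    have d: "d \<ge> 0" using a(3) by (meson abs_ge_zero order_trans)
    have ya: "\<bar>peval y a\<bar> \<le> L" using L(3)[of y y 0] a(2) by simp
    note l = L(3)[OF a] L(4)[OF a]
    have "\<bar>peval x a * peval x b\<bar> \<le> L * L'"
      unfolding abs_mult using l L by (intro mult_mono) auto
    moreover have "0 \<le> L * L'" using L by simp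
    ultimately show "\<bar>peval x (PMul a b)\<bar> \<le> 2 * L * L'" by simp
    have "peval x (PMul a b) - peval y (PMul a b) =
        (peval x a - peval y a) * peval x b + peval y a * (peval x b - peval y b)"
      by (simp add: algebra_simps)
    also have "\<bar>\<dots>\<bar> \<le> \<bar>peval x a - peval y a\<bar> * \<bar>peval x b\<bar> + \<bar>peval y a\<bar> * \<bar>peval x b - peval y b\<bar>"
      by (metis abs_mult abs_triangle_ineq)
    also have "\<dots> \<le> (L * d) * L' + L * (L' * d)"
      using l L ya d by (intro add_mono mult_mono) auto
    finally show "\<bar>peval x (PMul a b) - peval y (PMul a b)\<bar> \<le> 2 * L * L' * d"
      by (simp add: algebra_simps)
  qed (use L(1,2) in simp)
next
  case (PNeg a)
  then show ?case by (simp add: abs_minus_commute)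
qed

lemma peval_nonzero_near:
  assumes "peval x0 e \<noteq> 0"
  shows "\<exists>\<delta>>0. \<forall>x. (\<forall>v. \<bar>x v - x0 v\<bar> \<le> \<delta>) \<longrightarrow> peval x e \<noteq> 0"
proof -
  obtain L where L: "L \<ge> 0" "\<And>x y d. (\<forall>v. \<bar>x v - x0 v\<bar> \<le> 1) \<Longrightarrow> (\<forall>v. \<bar>y v - x0 v\<bar> \<le> 1) \<Longrightarrow> (\<forall>v. \<bar>x v - y v\<bar> \<le> d) \<Longrightarrow>
     \<bar>peval x e - peval y e\<bar> \<le> L * d" using peval_Lipschitz[of x0 e] by blast
  \<comment> \<open>Within this radius the value moves by at most half of its size at
    \<open>x0\<close>; \<open>L + 1\<close> keeps the denominator positive.\<close>
  define \<delta> where "\<delta> = min 1 (\<bar>peval x0 e\<bar> / (2 * (L + 1)))"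
  have pos: "\<delta> > 0" using assms L(1) by (simp add: \<delta>_def)
  have "peval x e \<noteq> 0" if "\<forall>v. \<bar>x v - x0 v\<bar> \<le> \<delta>" for x
  proof -
    have "\<bar>peval x e - peval x0 e\<bar> \<le> L * \<delta>"
      using that by (intro L(2)) (auto simp: \<delta>_def)
    also have "\<dots> \<le> (L + 1) * (\<bar>peval x0 e\<bar> / (2 * (L + 1)))"
      using L(1) pos by (intro mult_mono) (auto simp: \<delta>_def)
    also have "\<dots> = \<bar>peval x0 e\<bar> / 2" using L(1) by (simp add: field_simps)
    finally show ?thesis using assms by auto
  qed
  then show ?thesis using pos by blast
qed

lemma pevals_nonzero_near:
  assumes "finite S" "\<And>e. e \<in> S \<Longrightarrow> peval x0 e \<noteq> 0"
  shows "\<exists>\<delta>>0. \<forall>x. (\<forall>v. \<bar>x v - x0 v\<bar> \<le> \<delta>) \<longrightarrow> (\<forall>e\<in>S. peval x e \<noteq> 0)"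
  using assms
proof (induction S rule: finite_induct)
  case empty
  show ?case by (intro exI[of _ 1]) auto
next
  case (insert e S)
  then obtain a where "a > 0" "\<forall>x. (\<forall>v. \<bar>x v - x0 v\<bar> \<le> a) \<longrightarrow> (\<forall>e\<in>S. peval x e \<noteq> 0)" by auto
  moreover obtain b where "b > 0" "\<forall>x. (\<forall>v. \<bar>x v - x0 v\<bar> \<le> b) \<longrightarrow> peval x e \<noteq> 0"
    using peval_nonzero_near[of x0 e] insert.prems by auto
  ultimately show ?case by (intro exI[of _ "min a b"]) auto
qed

section \<open>Existence of generic points\<close>

instance pexpr :: (countable) countable
  by countable_datatype

text \<open>The type of variables need not be countable, so the variables in \<open>W\<close> are
  renamed to natural numbers and back; the expressions over \<open>nat\<close> form a countable
  type.\<close>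

lemma countable_pexprs_on:
  assumes "countable W"
  shows "countable {e. pvars e \<subseteq> W}"
proof -
  have set: "set_pexpr e = pvars e" for e :: "'v pexpr" by (induction e) auto
  have "e = map_pexpr (from_nat_into W) (map_pexpr (to_nat_on W) e)" if "pvars e \<subseteq> W" for e
  proof -
    have "map_pexpr (from_nat_into W \<circ> to_nat_on W) e = map_pexpr id e"
      using that assms by (intro pexpr.map_cong0) (auto simp: set subset_iff)
    then show ?thesis by (simp add: pexpr.map_comp pexpr.map_id)
  qed
  then have "{e. pvars e \<subseteq> W} \<subseteq> range (map_pexpr (from_nat_into W))" by blast
  then show ?thesis by (rule countable_subset) (intro countable_image, simp)
qed

fun psubst :: "'v \<Rightarrow> rat \<Rightarrow> 'v pexpr \<Rightarrow> 'v pexpr" where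
  "psubst v c (PConst d) = PConst d"
| "psubst v c (PVar u) = (if u = v then PConst c else PVar u)"
| "psubst v c (PAdd a b) = PAdd (psubst v c a) (psubst v c b)"
| "psubst v c (PMul a b) = PMul (psubst v c a) (psubst v c b)"
| "psubst v c (PNeg a) = PNeg (psubst v c a)"

lemma peval_psubst: "peval x (psubst v c e) = peval (x(v := of_rat c)) e"
  by (induction e) auto

lemma pvars_psubst: "pvars (psubst v c e) \<subseteq> pvars e - {v}"
  by (induction e) auto

lemma peval_update_poly: "\<exists>P. \<forall>t. peval (x(v := t)) e = poly P t"
proof (induction e)
  case (PConst c)
  show ?case by (intro exI[of _ "[:of_rat c:]"]) simp
next
  case (PVar u)
  show ?case by (cases "u = v") (auto intro: exI[of _ "[:0,1:]"] exI[of _ "[:x u:]"])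
next
  case (PAdd a b)
  then obtain P Q where "\<forall>t. peval (x(v := t)) a = poly P t" "\<forall>t. peval (x(v := t)) b = poly Q t" by blast
  then show ?case by (metis peval.simps(3) poly_add)
next
  case (PMul a b)
  then obtain P Q where "\<forall>t. peval (x(v := t)) a = poly P t" "\<forall>t. peval (x(v := t)) b = poly Q t" by blast
  then show ?case by (metis peval.simps(4) poly_mult)
next
  case (PNeg a)
  then obtain P where "\<forall>t. peval (x(v := t)) a = poly P t" by blast
  then show ?case by (metis peval.simps(5) poly_minus)
qed

lemma poly_zero_on_rats:
  fixes P :: "real poly"
  assumes "\<And>c. poly P (of_rat c) = 0"
  shows "P = 0"
proof (rule ccontr)
  assume "P \<noteq> 0"
  then have "finite {t. poly P t = 0}" by (rule poly_roots_finite)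
  moreover have "range (of_rat :: rat \<Rightarrow> real) \<subseteq> {t. poly P t = 0}" using assms by auto
  moreover have "infinite (range (of_rat :: rat \<Rightarrow> real))"
    using finite_imageD[of "of_rat :: rat \<Rightarrow> real" UNIV] infinite_UNIV_char_0[where 'a=rat]
    by (auto simp: inj_on_def)
  ultimately show False using finite_subset by blast
qed

definition alg_independent_on :: "'v set \<Rightarrow> ('v \<Rightarrow> real) \<Rightarrow> bool" where
  "alg_independent_on W x \<longleftrightarrow> (\<forall>e. pvars e \<subseteq> W \<longrightarrow> peval x e = 0 \<longrightarrow> (\<forall>y. peval y e = 0))"

text \<open>One coordinate is added at a time. Each expression that is not identically zero excludes
  finitely many values \<open>t\<close> for it, there are countably many expressions, and the reals
  are uncountable.\<close>

lemma alg_independent_on_exists: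
  fixes W :: "'v set"
  assumes "finite W"
  shows "\<exists>x. alg_independent_on W x"
  using assms
proof (induction W rule: finite_induct)
  case empty
  have "peval y e = peval x e" if "pvars e = {}" for e :: "'v pexpr" and x y
    using that by (induction e) auto
  then show ?case unfolding alg_independent_on_def by (metis subset_empty)
next
  case (insert v W)
  then obtain x where x: "alg_independent_on W x" by blast
  define Bad where "Bad = {e :: 'v pexpr. pvars e \<subseteq> insert v W \<and> (\<exists>y. peval y e \<noteq> 0)}"
  have fin: "finite {t. peval (x(v := t)) e = 0}" if "e \<in> Bad" for e
  proof -
    obtain P where P: "\<And>t. peval (x(v := t)) e = poly P t"
      using peval_update_poly[of x v e] by auto
    \<comment> \<open>If \<open>P\<close> were zero, every rational substitution for
      \<open>v\<close> would give an expression over \<open>W\<close> vanishing at \<open>x\<close>,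
      hence everywhere. Rational values are the ones the syntax can express, and they are numerous
      enough to make \<open>e\<close> vanish identically.\<close>
    have "P \<noteq> 0"
    proof
      assume "P = 0"
      then have "peval x (psubst v c e) = 0" for c using P by (simp add: peval_psubst)
      moreover have "pvars (psubst v c e) \<subseteq> W" for c
        using pvars_psubst[of v c e] that by (auto simp: Bad_def)
      ultimately have z: "peval y (psubst v c e) = 0" for c y
        using x unfolding alg_independent_on_def by blast
      have "peval y e = 0" for y
      proof -
        obtain Q where Q: "\<And>t. peval (y(v := t)) e = poly Q t"
          using peval_update_poly[of y v e] by auto
        have "Q = 0" using z[of y] Q by (intro poly_zero_on_rats) (simp add: peval_psubst)
        then show ?thesis using Q[of "y v"] by simp
      qed
      then show False using that by (auto simp: Bad_def)
    qed
    then show ?thesis using P poly_roots_finite[of P] by simp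
  qed
  have "countable Bad"
    using insert.hyps by (intro countable_subset[OF _ countable_pexprs_on[of "insert v W"]])
      (auto simp: Bad_def countable_finite)
  then have "countable (\<Union>e\<in>Bad. {t. peval (x(v := t)) e = 0})"
    using fin by (intro countable_UN) (auto intro: countable_finite)
  then have "(\<Union>e\<in>Bad. {t. peval (x(v := t)) e = 0}) \<noteq> UNIV"
    using uncountable_UNIV_real by metis
  then obtain t where "t \<notin> (\<Union>e\<in>Bad. {t. peval (x(v := t)) e = 0})" by blast
  then have "alg_independent_on (insert v W) (x(v := t))"
    unfolding alg_independent_on_def Bad_def by blast
  then show ?case by blast
qed

text \<open>Without such a point, generic rigidity would hold vacuously and nothing could be
  extracted from it.\<close>

lemma generic_exists:
  assumes "finite V"
  shows "\<exists>p. generic V p"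
proof -
  have "finite (V \<times> (UNIV :: 2 set))" using assms by simp
  then obtain x where x: "alg_independent_on (V \<times> (UNIV :: 2 set)) x"
    using alg_independent_on_exists by blast
  have "(\<lambda>(u, i). (\<chi> i. x (u, i)) $ i) = x" by (simp add: fun_eq_iff)
  then have "generic V (\<lambda>u. \<chi> i. x (u, i))"
    using x unfolding generic_def alg_independent_on_def by metis
  then show ?thesis by blast
qed

section \<open>Infinitesimal rigidity in the plane\<close>

definition coords :: "('a \<Rightarrow> real^2) \<Rightarrow> 'a \<times> 2 \<Rightarrow> real" where
  "coords p = (\<lambda>(u, i). p u $ i)"

lemma coords_apply [simp]: "coords p (u, i) = p u $ i"
  by (simp add: coords_def)

lemma generic_iff_alg_independent_on: "generic V p \<longleftrightarrow> alg_independent_on (V \<times> UNIV) (coords p)"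
  by (simp add: generic_def alg_independent_on_def coords_def)

lemma dist_real2: "dist x y = sqrt ((x$1 - y$1)\<^sup>2 + (x$2 - y$2)\<^sup>2)" for x y :: "real^2"
  by (simp add: dist_norm norm_vec_def L2_set_def sum_2)

text \<open>Half the derivative at \<open>x\<close> of the squared length of \<open>ab\<close> along
  the velocity field \<open>w\<close>.\<close>

definition edge_form :: "('a \<times> 2 \<Rightarrow> real) \<Rightarrow> ('a \<times> 2 \<Rightarrow> real) \<Rightarrow> 'a \<Rightarrow> 'a \<Rightarrow> real" where
  "edge_form x w a b =
     (x (a, 1) - x (b, 1)) * (w (a, 1) - w (b, 1)) + (x (a, 2) - x (b, 2)) * (w (a, 2) - w (b, 2))"

definition inf_motion :: "'a set set \<Rightarrow> ('a \<times> 2 \<Rightarrow> real) \<Rightarrow> ('a \<times> 2 \<Rightarrow> real) \<Rightarrow> bool" where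
  "inf_motion E x w \<longleftrightarrow> (\<forall>a b. {a, b} \<in> E \<longrightarrow> edge_form x w a b = 0)"

text \<open>The velocity fields of planar isometries: translation by \<open>(s, t)\<close> plus
  rotation about the origin with angular velocity \<omega>.\<close>

definition trivial_motion :: "('a \<times> 2 \<Rightarrow> real) \<Rightarrow> real \<Rightarrow> real \<Rightarrow> real \<Rightarrow> 'a \<times> 2 \<Rightarrow> real" where
  "trivial_motion x s t \<omega> = (\<lambda>(u, i). if i = 1 then s - \<omega> * x (u, 2) else t + \<omega> * x (u, 1))"

lemma trivial_motion_simps [simp]:
  "trivial_motion x s t \<omega> (u, 1) = s - \<omega> * x (u, 2)"
  "trivial_motion x s t \<omega> (u, 2) = t + \<omega> * x (u, 1)"
  by (simp_all add: trivial_motion_def)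

definition inf_rigid :: "'a set \<Rightarrow> 'a set set \<Rightarrow> ('a \<times> 2 \<Rightarrow> real) \<Rightarrow> bool" where
  "inf_rigid V E x \<longleftrightarrow> (\<forall>w. inf_motion E x w \<longrightarrow>
      (\<exists>s t \<omega>. \<forall>c\<in>V \<times> UNIV. w c = trivial_motion x s t \<omega> c))"

lemma edge_form_trivial_motion: "edge_form x (trivial_motion x s t \<omega>) a b = 0"
  by (simp add: edge_form_def algebra_simps)

lemma edge_form_diff: "edge_form x (\<lambda>c. w c - w' c) a b = edge_form x w a b - edge_form x w' a b"
  by (simp add: edge_form_def algebra_simps)

text \<open>The entry at an endpoint \<open>u\<close> is \<open>u\<close> minus the other endpoint,
  which is \<open>the_elem (e - {u})\<close>; rows can thus be indexed by unordered edges without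
  choosing an orientation.\<close>

definition rigidity_matrix :: "'a set \<Rightarrow> 'a \<times> 2 \<Rightarrow> ('a \<times> 2) pexpr" where
  "rigidity_matrix e = (\<lambda>(u, i). if u \<in> e then PSub (PVar (u, i)) (PVar (the_elem (e - {u}), i)) else PConst 0)"

lemma rigidity_matrix_outside: "u \<notin> e \<Longrightarrow> rigidity_matrix e (u, i) = PConst 0"
  by (simp add: rigidity_matrix_def)

lemma rigidity_matrix_pair:
  assumes "a \<noteq> b"
  shows "rigidity_matrix {a, b} (a, i) = PSub (PVar (a, i)) (PVar (b, i))"
    "rigidity_matrix {a, b} (b, i) = PSub (PVar (b, i)) (PVar (a, i))"
proof -
  have "{a, b} - {a} = {b}" "{a, b} - {b} = {a}" using assms by auto
  then show "rigidity_matrix {a, b} (a, i) = PSub (PVar (a, i)) (PVar (b, i))"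
    "rigidity_matrix {a, b} (b, i) = PSub (PVar (b, i)) (PVar (a, i))"
    by (simp_all add: rigidity_matrix_def)
qed

lemma simple_graphE:
  assumes "simple_graph V E" "e \<in> E"
  obtains a b where "e = {a, b}" "a \<noteq> b" "a \<in> V" "b \<in> V"
  using assms unfolding simple_graph_def by blast

lemma simple_graph_endpoints:
  assumes "simple_graph V E" "{a, b} \<in> E"
  shows "a \<in> V" "b \<in> V" "a \<noteq> b"
  using simple_graphE[OF assms] by (metis doubleton_eq_iff)+

lemma simple_graph_finite:
  assumes "simple_graph V E" "finite V"
  shows "finite E"
proof -
  have "E \<subseteq> Pow V" using assms(1) by (auto elim!: simple_graphE)
  then show ?thesis using assms(2) by (meson finite_Pow_iff finite_subset)
qed

lemma pvars_rigidity_matrix: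
  assumes "simple_graph V E" "e \<in> E"
  shows "pvars (rigidity_matrix e c) \<subseteq> V \<times> UNIV"
proof -
  obtain a b where "e = {a, b}" "a \<noteq> b" "a \<in> V" "b \<in> V" using assms by (rule simple_graphE)
  moreover from this have "{a, b} - {a} = {b}" "{a, b} - {b} = {a}" by auto
  ultimately show ?thesis by (auto simp: rigidity_matrix_def split: prod.splits if_splits)
qed

lemma sum_coords: "finite S \<Longrightarrow> (\<Sum>c\<in>S \<times> UNIV. f c) = (\<Sum>u\<in>S. f (u, 1) + f (u, 2 :: 2))"
proof -
  assume "finite S"
  then have "(\<Sum>c\<in>S \<times> UNIV. f c) = (\<Sum>u\<in>S. \<Sum>i\<in>(UNIV :: 2 set). f (u, i))"
    by (simp add: sum.cartesian_product)
  then show ?thesis by (simp add: sum_2)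
qed

lemma rigidity_matrix_apply:
  assumes "finite S" "a \<in> S" "b \<in> S" "a \<noteq> b"
  shows "(\<Sum>c\<in>S \<times> UNIV. peval x (rigidity_matrix {a, b} c) * w c) = edge_form x w a b"
proof -
  have "(\<Sum>c\<in>S \<times> UNIV. peval x (rigidity_matrix {a, b} c) * w c) =
      (\<Sum>u\<in>S. peval x (rigidity_matrix {a, b} (u, 1)) * w (u, 1) + peval x (rigidity_matrix {a, b} (u, 2)) * w (u, 2))"
    using assms(1) by (rule sum_coords)
  also have "\<dots> = (\<Sum>u\<in>{a, b}. peval x (rigidity_matrix {a, b} (u, 1)) * w (u, 1) + peval x (rigidity_matrix {a, b} (u, 2)) * w (u, 2))"
    using assms by (intro sum.mono_neutral_right) (auto simp: rigidity_matrix_outside)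
  also have "\<dots> = edge_form x w a b"
    using assms by (simp add: rigidity_matrix_pair edge_form_def algebra_simps)
  finally show ?thesis .
qed

text \<open>Fixing both coordinates of \<open>a\<close> and the first coordinate of \<open>b\<close> kills the trivial motions
  as soon as the second coordinates of \<open>a\<close> and \<open>b\<close> differ.\<close>

definition pins :: "'a \<Rightarrow> 'a \<Rightarrow> ('a \<times> 2) set" where
  "pins a b = {(a, 1), (a, 2), (b, 1)}"

lemma card_coords_minus_pins:
  assumes "finite S" "a \<in> S" "b \<in> S" "a \<noteq> b"
  shows "card (S \<times> UNIV - pins a b) = 2 * card S - 3"
proof -
  have "card (pins a b) = 3" using assms by (auto simp: pins_def card_insert_if)
  moreover have "pins a b \<subseteq> S \<times> UNIV" using assms by (auto simp: pins_def)
  ultimately show ?thesis using assms by (simp add: card_Diff_subset pins_def card_cartesian_product)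
qed

text \<open>Rows and columns trade places here: after pinning, infinitesimal rigidity says that the
  columns of the rigidity matrix outside the pins are independent, so the certificate is taken for
  the transposed matrix.\<close>

lemma inf_rigid_certificate:
  assumes V: "finite V" "simple_graph V E" and ab: "a \<in> V" "b \<in> V" "x0 (a, 2) \<noteq> x0 (b, 2)"
    and rigid: "inf_rigid V E x0"
  shows "\<exists>D. pvars D \<subseteq> V \<times> UNIV \<and> peval x0 D \<noteq> 0 \<and> (\<forall>x. peval x D \<noteq> 0 \<longrightarrow> inf_rigid V E x)"
proof -
  define P where "P = pins a b"
  define C where "C = V \<times> (UNIV :: 2 set) - P"
  have finC: "finite C" using V by (simp add: C_def)
  have extend: "(\<Sum>c\<in>C. l c * peval x (rigidity_matrix {u, v} c)) = edge_form x (\<lambda>c. if c \<in> C then l c else 0) u v"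
    if "{u, v} \<in> E" for x l u v
  proof -
    note uv = simple_graph_endpoints[OF V(2) that]
    have "(\<Sum>c\<in>C. l c * peval x (rigidity_matrix {u, v} c)) =
        (\<Sum>c\<in>V \<times> UNIV. peval x (rigidity_matrix {u, v} c) * (if c \<in> C then l c else 0))"
      using V by (intro sum.mono_neutral_cong_left) (auto simp: C_def)
    then show ?thesis using rigidity_matrix_apply[OF V(1) uv] by simp
  qed
  have "indep_rows C E (\<lambda>c e. peval x0 (rigidity_matrix e c))"
    unfolding indep_rows_def
  proof (intro allI impI)
    fix l assume l: "\<forall>e\<in>E. (\<Sum>c\<in>C. l c * peval x0 (rigidity_matrix e c)) = 0"
    let ?w = "\<lambda>c. if c \<in> C then l c else 0"
    have "inf_motion E x0 ?w" unfolding inf_motion_def using l extend by auto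
    then obtain s t \<omega> where w: "\<And>c. c \<in> V \<times> UNIV \<Longrightarrow> ?w c = trivial_motion x0 s t \<omega> c"
      using rigid unfolding inf_rigid_def by blast
    have "s - \<omega> * x0 (a, 2) = 0" "t + \<omega> * x0 (a, 1) = 0" "s - \<omega> * x0 (b, 2) = 0"
      using w[of "(a, 1)"] w[of "(a, 2)"] w[of "(b, 1)"] ab by (auto simp: C_def P_def pins_def)
    moreover from this have "\<omega> * (x0 (a, 2) - x0 (b, 2)) = 0" by (simp add: algebra_simps)
    ultimately have z: "\<omega> = 0" "s = 0" "t = 0" using ab(3) by auto
    show "\<forall>c\<in>C. l c = 0"
    proof
      fix c assume "c \<in> C"
      then show "l c = 0" using w[of c] z by (auto simp: C_def trivial_motion_def split: if_splits)
    qed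
  qed
  from indep_rows_certificate[OF finC this, of "V \<times> UNIV"] pvars_rigidity_matrix[OF V(2)]
  obtain D where D: "pvars D \<subseteq> V \<times> UNIV" "peval x0 D \<noteq> 0"
    "\<And>x. peval x D \<noteq> 0 \<Longrightarrow> indep_rows C E (\<lambda>c e. peval x (rigidity_matrix e c))" by blast
  show ?thesis
  \<comment> \<open>The second factor keeps the three pins effective at the new
    configuration.\<close>
  proof (intro exI[of _ "PMul D (PSub (PVar (a, 2)) (PVar (b, 2)))"] conjI allI impI)
    show "pvars (PMul D (PSub (PVar (a, 2)) (PVar (b, 2)))) \<subseteq> V \<times> UNIV" using D ab by auto
    show "peval x0 (PMul D (PSub (PVar (a, 2)) (PVar (b, 2)))) \<noteq> 0" using D ab by auto
    fix x assume "peval x (PMul D (PSub (PVar (a, 2)) (PVar (b, 2)))) \<noteq> 0"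
    then have x: "peval x D \<noteq> 0" "x (a, 2) \<noteq> x (b, 2)" by auto
    show "inf_rigid V E x" unfolding inf_rigid_def
    proof (intro allI impI)
      fix w assume w: "inf_motion E x w"
      \<comment> \<open>With these parameters the trivial motion agrees with \<open>w\<close> at the
        three pins, so that the difference \<open>w'\<close> vanishes there.\<close>
      define \<omega> where "\<omega> = (w (a, 1) - w (b, 1)) / (x (b, 2) - x (a, 2))"
      define s where "s = w (a, 1) + \<omega> * x (a, 2)"
      define t where "t = w (a, 2) - \<omega> * x (a, 1)"
      define w' where "w' c = w c - trivial_motion x s t \<omega> c" for c
      have om: "\<omega> * (x (b, 2) - x (a, 2)) = w (a, 1) - w (b, 1)" using x by (simp add: \<omega>_def)
      have pinned: "w' c = 0" if "c \<in> P" for c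
        using that om unfolding P_def pins_def by (auto simp: w'_def s_def t_def algebra_simps)
      have "(\<Sum>c\<in>C. w' c * peval x (rigidity_matrix e c)) = 0" if eE: "e \<in> E" for e
      proof -
        obtain u v where e: "e = {u, v}" using simple_graphE[OF V(2) eE] by metis
        have "(\<Sum>c\<in>C. w' c * peval x (rigidity_matrix e c)) = edge_form x (\<lambda>c. if c \<in> C then w' c else 0) u v"
          using extend eE e by simp
        also have "\<dots> = edge_form x w' u v"
          using pinned simple_graph_endpoints[of V E u v] V eE e by (auto simp: edge_form_def C_def)
        also have "\<dots> = 0"
          using w eE e unfolding w'_def edge_form_diff by (simp add: edge_form_trivial_motion inf_motion_def)
        finally show ?thesis .
      qed
      from indep_rowsD[OF D(3)[OF x(1)] this] have "w' c = 0" if "c \<in> C" for c using that by blast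
      then have "w c = trivial_motion x s t \<omega> c" if "c \<in> V \<times> UNIV" for c
        using that pinned unfolding C_def w'_def by force
      then show "\<exists>s t \<omega>. \<forall>c\<in>V \<times> UNIV. w c = trivial_motion x s t \<omega> c" by blast
    qed
  qed
qed

lemma alg_independent_onD:
  assumes "alg_independent_on W x" "pvars e \<subseteq> W" "peval y e \<noteq> 0"
  shows "peval x e \<noteq> 0"
  using assms unfolding alg_independent_on_def by blast

text \<open>One convenient, possibly degenerate, position is enough: the polynomial witnessing
  rigidity there cannot vanish at an algebraically independent point.\<close>

lemma inf_rigid_alg_independent:
  assumes "finite V" "simple_graph V E" "a \<in> V" "b \<in> V" "x0 (a, 2) \<noteq> x0 (b, 2)" "inf_rigid V E x0"
    and x: "alg_independent_on (V \<times> UNIV) x"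
  shows "inf_rigid V E x"
  using inf_rigid_certificate[OF assms(1-6)] alg_independent_onD[OF x] by blast

lemma alg_independent_distinct_coord:
  assumes "alg_independent_on (V \<times> UNIV) x" "a \<in> V" "b \<in> V" "a \<noteq> b"
  shows "x (a, i :: 2) \<noteq> x (b, i)"
  using alg_independent_onD[OF assms(1), of "PSub (PVar (a, i)) (PVar (b, i))" "\<lambda>c. if c = (a, i) then 1 else 0"]
    assms(2-) by auto

text \<open>Twice the signed area of the triangle \<open>abc\<close>.\<close>

definition collinearity :: "'a \<Rightarrow> 'a \<Rightarrow> 'a \<Rightarrow> ('a \<times> 2) pexpr" where
  "collinearity a b c =
     PSub (PMul (PSub (PVar (b, 1)) (PVar (a, 1))) (PSub (PVar (c, 2)) (PVar (a, 2))))
          (PMul (PSub (PVar (b, 2)) (PVar (a, 2))) (PSub (PVar (c, 1)) (PVar (a, 1))))"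

lemma alg_independent_not_collinear:
  assumes "alg_independent_on (V \<times> UNIV) x" "{a, b, c} \<subseteq> V" "a \<noteq> b" "a \<noteq> c" "b \<noteq> c"
  shows "peval x (collinearity a b c) \<noteq> 0"
  using assms(2-)
  \<comment> \<open>The witness is the right triangle with \<open>a\<close> at the origin,
    \<open>b = (1, 0)\<close> and \<open>c = (0, 1)\<close>.\<close>
  by (intro alg_independent_onD[OF assms(1), of _ "\<lambda>d. if d = (b, 1) \<or> d = (c, 2) then 1 else 0"])
     (auto simp: collinearity_def)

lemma plane_orthogonal_zero:
  fixes d1 d2 e1 e2 z1 z2 :: real
  assumes "d1 * z1 + d2 * z2 = 0" "e1 * z1 + e2 * z2 = 0" "d1 * e2 - d2 * e1 \<noteq> 0"
  shows "z1 = 0" "z2 = 0"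
proof -
  have "(d1 * e2 - d2 * e1) * z1 = e2 * (d1 * z1 + d2 * z2) - d2 * (e1 * z1 + e2 * z2)"
    "(d1 * e2 - d2 * e1) * z2 = d1 * (e1 * z1 + e2 * z2) - e1 * (d1 * z1 + d2 * z2)"
    by (simp_all add: algebra_simps)
  then show "z1 = 0" "z2 = 0" using assms by auto
qed

text \<open>After subtracting the trivial motion, \<open>w\<close> vanishes at \<open>a\<close> and
  \<open>b\<close>, so its value at \<open>v\<close> is orthogonal to both \<open>v - a\<close> and
  \<open>v - b\<close>. These are linearly independent by \<open>det\<close>.\<close>

lemma trivial_motion_extend:
  fixes V :: "'a set"
  assumes "\<And>c. c \<in> V \<times> UNIV \<Longrightarrow> w c = trivial_motion x s t \<omega> c" "a \<in> V" "b \<in> V"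
    and "edge_form x w v a = 0" "edge_form x w v b = 0"
    and det: "(x (v, 1) - x (a, 1)) * (x (v, 2) - x (b, 2)) - (x (v, 2) - x (a, 2)) * (x (v, 1) - x (b, 1)) \<noteq> 0"
  shows "\<forall>c\<in>insert v V \<times> UNIV. w c = trivial_motion x s t \<omega> c"
proof -
  have a: "w (a, 1) = s - \<omega> * x (a, 2)" "w (a, 2) = t + \<omega> * x (a, 1)"
    and b: "w (b, 1) = s - \<omega> * x (b, 2)" "w (b, 2) = t + \<omega> * x (b, 1)"
    using assms(1)[of "(a, 1)"] assms(1)[of "(a, 2)"] assms(1)[of "(b, 1)"] assms(1)[of "(b, 2)"] assms(2,3)
    by auto
  let ?z1 = "w (v, 1) - (s - \<omega> * x (v, 2))" and ?z2 = "w (v, 2) - (t + \<omega> * x (v, 1))"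
  have "(x (v, 1) - x (a, 1)) * ?z1 + (x (v, 2) - x (a, 2)) * ?z2 = 0"
    using assms(4) unfolding edge_form_def a by (simp add: algebra_simps)
  moreover have "(x (v, 1) - x (b, 1)) * ?z1 + (x (v, 2) - x (b, 2)) * ?z2 = 0"
    using assms(5) unfolding edge_form_def b by (simp add: algebra_simps)
  ultimately have "?z1 = 0" "?z2 = 0" using plane_orthogonal_zero[OF _ _ det] by blast+
  then have "w (v, 1) = trivial_motion x s t \<omega> (v, 1)" "w (v, 2) = trivial_motion x s t \<omega> (v, 2)" by auto
  moreover have "c = (v, 1) \<or> c = (v, 2) \<or> c \<in> V \<times> UNIV" if "c \<in> insert v V \<times> UNIV" for c :: "'a \<times> 2"
    using that exhaust_2[of "snd c"] by (cases c) auto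
  ultimately show ?thesis using assms(1) by metis
qed

section \<open>Infinitesimal rigidity of Henneberg graphs\<close>

lemma henneberg_graph:
  assumes "henneberg V E"
  shows "finite V \<and> card V \<ge> 2 \<and> simple_graph V E"
  using assms
proof (induction rule: henneberg.induct)
  case (K2 a b)
  then show ?case by (auto simp: simple_graph_def)
next
  case (move1 V E v a b)
  then show ?case unfolding simple_graph_def by (auto; blast)
next
  case (move2 V E i j k v)
  then have "i \<in> V" "j \<in> V" using simple_graph_endpoints[of V E i j] by auto
  then show ?case using move2 unfolding simple_graph_def by (auto; blast)
qed

lemma henneberg_inf_rigid:
  assumes "henneberg V E" "alg_independent_on (V \<times> UNIV) x"
  shows "inf_rigid V E x"
  using assms
proof (induction arbitrary: x rule: henneberg.induct)
  case (K2 a b)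
  have ne: "x (b, 2) \<noteq> x (a, 2)" using alg_independent_distinct_coord[OF K2(2)] K2(1) by auto
  show ?case unfolding inf_rigid_def
  proof (intro allI impI)
    fix w assume "inf_motion {{a, b}} x w"
    then have w: "edge_form x w a b = 0" by (auto simp: inf_motion_def)
    define \<omega> where "\<omega> = (w (a, 1) - w (b, 1)) / (x (b, 2) - x (a, 2))"
    define s where "s = w (a, 1) + \<omega> * x (a, 2)"
    define t where "t = w (a, 2) - \<omega> * x (a, 1)"
    have om: "w (a, 1) - w (b, 1) = \<omega> * (x (b, 2) - x (a, 2))" using ne by (simp add: \<omega>_def)
    have "(x (a, 2) - x (b, 2)) * (w (a, 2) - w (b, 2) - \<omega> * (x (a, 1) - x (b, 1))) = 0"
      using w unfolding edge_form_def om by (simp add: algebra_simps)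
    then have "w (a, 2) - w (b, 2) - \<omega> * (x (a, 1) - x (b, 1)) = 0" using ne by auto
    then have "w (b, 2) = t + \<omega> * x (b, 1)" by (simp add: t_def algebra_simps)
    moreover have "w (b, 1) = s - \<omega> * x (b, 2)" using om by (simp add: s_def algebra_simps)
    ultimately have "w (u, i) = trivial_motion x s t \<omega> (u, i)" if "u \<in> {a, b}" for u i
      using that exhaust_2[of i] by (auto simp: s_def t_def)
    then show "\<exists>s t \<omega>. \<forall>c\<in>{a, b} \<times> UNIV. w c = trivial_motion x s t \<omega> c" by force
  qed
next
  case (move1 V E v a b)
  note G = henneberg_graph[OF move1(1)] henneberg_graph[OF henneberg.move1[OF move1(1-5)]]
  obtain y0 where y0: "alg_independent_on (V \<times> (UNIV :: 2 set)) y0"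
    using alg_independent_on_exists[of "V \<times> (UNIV :: 2 set)"] G by auto
  \<comment> \<open>The new vertex is \<open>a\<close> plus \<open>b - a\<close> turned by a right
    angle, so \<open>v\<close>, \<open>a\<close>, \<open>b\<close> are not collinear.\<close>
  define y where "y = y0((v, 1) := y0 (a, 1) - (y0 (b, 2) - y0 (a, 2)), (v, 2) := y0 (a, 2) + (y0 (b, 1) - y0 (a, 1)))"
  have yv: "y (v, 1) = y0 (a, 1) - (y0 (b, 2) - y0 (a, 2))" "y (v, 2) = y0 (a, 2) + (y0 (b, 1) - y0 (a, 1))"
    by (simp_all add: y_def)
  have yV: "y (u, i) = y0 (u, i)" if "u \<in> V" for u i using that move1(2) by (auto simp: y_def)
  have ne: "y0 (a, 2) \<noteq> y0 (b, 2)" using alg_independent_distinct_coord[OF y0] move1 by auto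
  have "inf_rigid (insert v V) (E \<union> {{v, a}, {v, b}}) y" unfolding inf_rigid_def
  proof (intro allI impI)
    fix w assume w: "inf_motion (E \<union> {{v, a}, {v, b}}) y w"
    then have ev: "edge_form y w v a = 0" "edge_form y w v b = 0" by (auto simp: inf_motion_def)
    have "edge_form y0 w c d = edge_form y w c d" if "{c, d} \<in> E" for c d
      using simple_graph_endpoints[of V E c d] G that yV by (simp add: edge_form_def)
    then have "inf_motion E y0 w" using w by (auto simp: inf_motion_def)
    then obtain s t \<omega> where tr: "\<And>c. c \<in> V \<times> UNIV \<Longrightarrow> w c = trivial_motion y0 s t \<omega> c"
      using move1.IH[OF y0] unfolding inf_rigid_def by blast
    have tr: "w c = trivial_motion y s t \<omega> c" if "c \<in> V \<times> UNIV" for c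
      using tr[OF that] that yV by (auto simp: trivial_motion_def split: prod.splits)
    have "(y (v, 1) - y (a, 1)) * (y (v, 2) - y (b, 2)) - (y (v, 2) - y (a, 2)) * (y (v, 1) - y (b, 1))
        = (y0 (b, 2) - y0 (a, 2))\<^sup>2 + (y0 (b, 1) - y0 (a, 1))\<^sup>2"
      using move1 by (simp add: yv yV power2_eq_square algebra_simps)
    also have "\<dots> \<noteq> 0" using ne by (simp add: sum_power2_eq_zero_iff)
    finally show "\<exists>s t \<omega>. \<forall>c\<in>insert v V \<times> UNIV. w c = trivial_motion y s t \<omega> c"
      using trivial_motion_extend[OF tr, where a = a and b = b and v = v] ev move1 by blast
  qed
  then show ?case
    using inf_rigid_alg_independent[of "insert v V" "E \<union> {{v, a}, {v, b}}" a b y x] G move1 ne yV by auto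
next
  case (move2 V E i j k v)
  let ?E = "E - {{i, j}} \<union> {{v, i}, {v, j}, {v, k}}"
  note G = henneberg_graph[OF move2(1)] henneberg_graph[OF henneberg.move2[OF move2(1-7)]]
  have ij: "i \<in> V" "j \<in> V" using simple_graph_endpoints[of V E i j] G move2 by auto
  obtain y0 where y0: "alg_independent_on (V \<times> (UNIV :: 2 set)) y0"
    using alg_independent_on_exists[of "V \<times> (UNIV :: 2 set)"] G by auto
  \<comment> \<open>The new vertex is the midpoint of \<open>i\<close> and \<open>j\<close>. There
    the constraints of \<open>vi\<close> and \<open>vj\<close> together imply that of the deleted
    edge \<open>ij\<close>, so the induction hypothesis applies to the old vertices.\<close>
  define y where "y = y0((v, 1) := (y0 (i, 1) + y0 (j, 1)) / 2, (v, 2) := (y0 (i, 2) + y0 (j, 2)) / 2)"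
  have yv: "y (v, 1) = (y0 (i, 1) + y0 (j, 1)) / 2" "y (v, 2) = (y0 (i, 2) + y0 (j, 2)) / 2"
    by (simp_all add: y_def)
  have yV: "y (u, i) = y0 (u, i)" if "u \<in> V" for u i using that move2(7) by (auto simp: y_def)
  have ne: "y0 (i, 2) \<noteq> y0 (j, 2)" using alg_independent_distinct_coord[OF y0] move2 ij by auto
  have nc: "peval y0 (collinearity i j k) \<noteq> 0"
    using alg_independent_not_collinear[OF y0] move2 ij by auto
  have "inf_rigid (insert v V) ?E y" unfolding inf_rigid_def
  proof (intro allI impI)
    fix w assume w: "inf_motion ?E y w"
    then have ev: "edge_form y w v i = 0" "edge_form y w v j = 0" "edge_form y w v k = 0"
      by (auto simp: inf_motion_def)
    have "edge_form y0 w i j = 2 * edge_form y w v j + 2 * edge_form y w v i"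
      using ij by (simp add: edge_form_def yv yV field_simps)
    then have eij: "edge_form y0 w i j = 0" using ev by simp
    have sym: "edge_form y0 w j i = edge_form y0 w i j" by (simp add: edge_form_def algebra_simps)
    have "edge_form y0 w c d = 0" if "{c, d} \<in> E" for c d
    proof (cases "{c, d} = {i, j}")
      case True
      then show ?thesis using eij sym by (auto simp: doubleton_eq_iff)
    next
      case False
      then have "edge_form y w c d = 0" using w that by (auto simp: inf_motion_def)
      then show ?thesis using simple_graph_endpoints[of V E c d] G that yV by (simp add: edge_form_def)
    qed
    then have "inf_motion E y0 w" by (auto simp: inf_motion_def)
    then obtain s t \<omega> where tr: "\<And>c. c \<in> V \<times> UNIV \<Longrightarrow> w c = trivial_motion y0 s t \<omega> c"
      using move2.IH[OF y0] unfolding inf_rigid_def by blast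
    have tr: "w c = trivial_motion y s t \<omega> c" if "c \<in> V \<times> UNIV" for c
      using tr[OF that] that yV by (auto simp: trivial_motion_def split: prod.splits)
    \<comment> \<open>Since \<open>v\<close> is collinear with \<open>i\<close> and
      \<open>j\<close>, the edge \<open>vk\<close> is needed to fix \<open>v\<close>; the triangle
      \<open>vik\<close> has half the area of \<open>ijk\<close>.\<close>
    have "(y (v, 1) - y (i, 1)) * (y (v, 2) - y (k, 2)) - (y (v, 2) - y (i, 2)) * (y (v, 1) - y (k, 1))
        = - peval y0 (collinearity i j k) / 2"
      using ij move2 by (simp add: yv yV collinearity_def field_simps)
    also have "\<dots> \<noteq> 0" using nc by simp
    finally show "\<exists>s t \<omega>. \<forall>c\<in>insert v V \<times> UNIV. w c = trivial_motion y s t \<omega> c"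
      using trivial_motion_extend[OF tr, where a = i and b = k and v = v] ev move2 ij by blast
  qed
  then show ?case
    using inf_rigid_alg_independent[of "insert v V" ?E i j y x] G move2 ne yV ij by auto
qed

section \<open>Infinitesimal rigidity implies rigidity\<close>

text \<open>The averaging trick: if \<open>p\<close> and \<open>q\<close> have the same edge lengths then \<open>q - p\<close> is an
  infinitesimal motion of the midpoint configuration \<open>(p + q) / 2\<close>. If it is trivial there, then
  \<open>q\<close> is the image of \<open>p\<close> under a Cayley transform composed with a translation.\<close>

lemma edge_form_midpoint:
  assumes "\<And>i. m (a, i) = (p a $ i + q a $ i) / 2" "\<And>i. m (b, i) = (p b $ i + q b $ i) / 2"
    and "\<And>i. w (a, i) = q a $ i - p a $ i" "\<And>i. w (b, i) = q b $ i - p b $ i"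
  shows "edge_form m w a b = ((dist (q a) (q b))\<^sup>2 - (dist (p a) (p b))\<^sup>2) / 2"
proof -
  have "(dist x y)\<^sup>2 = (x$1 - y$1) * (x$1 - y$1) + (x$2 - y$2) * (x$2 - y$2)" for x y :: "real^2"
    by (simp add: dist_real2 power2_eq_square)
  note sq = this
  show ?thesis unfolding sq edge_form_def assms by (simp add: field_simps)
qed

text \<open>Infinitesimal rigidity is assumed on a whole neighbourhood because it is used at the
  midpoint of \<open>p\<close> and an arbitrary nearby \<open>q\<close>.\<close>

lemma rigid_if_inf_rigid_nearby:
  assumes V: "finite V" "simple_graph V E" and "\<delta> > 0"
    and near: "\<And>x. (\<And>c. \<bar>x c - coords p c\<bar> \<le> \<delta>) \<Longrightarrow> inf_rigid V E x"
  shows "rigid_framework V E p"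
  unfolding rigid_framework_def
proof (intro exI[of _ "\<delta>\<^sup>2"] conjI allI impI)
  show "\<delta>\<^sup>2 > 0" using assms by simp
  fix q assume q: "inj_on q V \<and> (\<Sum>u\<in>V. (norm (p u - q u))\<^sup>2) \<le> \<delta>\<^sup>2 \<and>
        (\<forall>u v. {u, v} \<in> E \<longrightarrow> dist (q u) (q v) = dist (p u) (p v))"
  \<comment> \<open>Outside \<open>V\<close> the value is \<open>p\<close>, since
    \<open>near\<close> asks for closeness in every coordinate.\<close>
  define m where "m = (\<lambda>(u, i). if u \<in> V then (p u $ i + q u $ i) / 2 else p u $ i)"
  define w where "w = (\<lambda>(u, i). q u $ i - p u $ i)"
  have mV: "m (u, i) = (p u $ i + q u $ i) / 2" if "u \<in> V" for u i using that by (simp add: m_def)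
  have "\<bar>m (u, i) - coords p (u, i)\<bar> \<le> \<delta>" for u i
  proof (cases "u \<in> V")
    case True
    have "(norm (p u - q u))\<^sup>2 \<le> (\<Sum>u\<in>V. (norm (p u - q u))\<^sup>2)"
      using V True by (intro member_le_sum) auto
    then have "norm (p u - q u) \<le> \<delta>" using q \<open>\<delta> > 0\<close> by (meson order_trans power2_le_imp_le less_imp_le)
    moreover have "\<bar>(p u - q u) $ i\<bar> \<le> norm (p u - q u)" by (rule component_le_norm_cart)
    ultimately show ?thesis using True by (simp add: m_def abs_if field_simps split: if_splits)
  qed (use \<open>\<delta> > 0\<close> in \<open>simp add: m_def\<close>)
  then have "inf_rigid V E m" by (intro near) auto
  moreover have "inf_motion E m w" unfolding inf_motion_def
  proof (intro allI impI)
    fix a b assume e: "{a, b} \<in> E"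
    note ab = simple_graph_endpoints[OF V(2) e]
    show "edge_form m w a b = 0"
      using edge_form_midpoint[of m a p q b w] mV ab q e by (simp add: w_def)
  qed
  ultimately obtain s t \<omega> where tr: "\<And>c. c \<in> V \<times> UNIV \<Longrightarrow> w c = trivial_motion m s t \<omega> c"
    unfolding inf_rigid_def by blast
  \<comment> \<open>With \<open>J\<close> the quarter turn, triviality at the midpoint reads
    \<open>q - p = (s, t) + h J (p + q)\<close>. Solving for \<open>q\<close> gives
    \<open>f\<close>: apply \<open>1 + h J\<close>, translate by \<open>(s, t)\<close>, then apply
    the inverse of \<open>1 - h J\<close>, which is \<open>(1 + h J) / (1 + h^2)\<close>.\<close>
  define h where "h = \<omega> / 2"
  define f :: "real^2 \<Rightarrow> real^2" where "f x = vector
    [((x$1 - h * x$2 + s) - h * (x$2 + h * x$1 + t)) / (1 + h\<^sup>2),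
     ((x$2 + h * x$1 + t) + h * (x$1 - h * x$2 + s)) / (1 + h\<^sup>2)]" for x
  have D: "1 + h\<^sup>2 > 0" by (simp add: add_pos_nonneg)
  have iso: "dist (f x) (f y) = dist x y" for x y
  proof -
    define a b where "a = x$1 - y$1" "b = x$2 - y$2"
    have f1: "f x $ 1 - f y $ 1 = ((1 - h\<^sup>2) * a - 2 * h * b) / (1 + h\<^sup>2)"
      unfolding f_def a_b_def by (simp add: diff_divide_distrib[symmetric] power2_eq_square algebra_simps)
    have f2: "f x $ 2 - f y $ 2 = ((1 - h\<^sup>2) * b + 2 * h * a) / (1 + h\<^sup>2)"
      unfolding f_def a_b_def by (simp add: diff_divide_distrib[symmetric] power2_eq_square algebra_simps)
    have "((1 - h\<^sup>2) * a - 2 * h * b)\<^sup>2 + ((1 - h\<^sup>2) * b + 2 * h * a)\<^sup>2 = (1 + h\<^sup>2)\<^sup>2 * (a\<^sup>2 + b\<^sup>2)"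
      by (simp add: power2_eq_square algebra_simps)
    then have "(((1 - h\<^sup>2) * a - 2 * h * b) / (1 + h\<^sup>2))\<^sup>2 + (((1 - h\<^sup>2) * b + 2 * h * a) / (1 + h\<^sup>2))\<^sup>2 = a\<^sup>2 + b\<^sup>2"
      using D unfolding power_divide add_divide_distrib[symmetric] by simp
    then show ?thesis unfolding dist_real2 f1 f2 by (simp add: a_b_def)
  qed
  have "f (p u) = q u" if "u \<in> V" for u
  proof -
    have "q u $ 1 - p u $ 1 = s - h * (p u $ 2 + q u $ 2)" "q u $ 2 - p u $ 2 = t + h * (p u $ 1 + q u $ 1)"
      using tr[of "(u, 1)"] tr[of "(u, 2)"] that mV by (auto simp: w_def h_def)
    then have e: "p u $ 1 - h * p u $ 2 + s = q u $ 1 + h * q u $ 2" "p u $ 2 + h * p u $ 1 + t = q u $ 2 - h * q u $ 1"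
      by (auto simp: algebra_simps)
    have "f (p u) $ 1 = (q u $ 1 * (1 + h\<^sup>2)) / (1 + h\<^sup>2)" "f (p u) $ 2 = (q u $ 2 * (1 + h\<^sup>2)) / (1 + h\<^sup>2)"
      unfolding f_def e by (simp_all add: power2_eq_square algebra_simps)
    then show ?thesis using D by (simp add: vec_eq_iff forall_2)
  qed
  then have "f ` (p ` V) = q ` V" by force
  then show "\<exists>f :: real^2 \<Rightarrow> real^2. (\<forall>x y. dist (f x) (f y) = dist x y) \<and> f ` (p ` V) = q ` V"
    using iso by blast
qed

lemma henneberg_imp_generically_rigid:
  assumes "henneberg V E"
  shows "generically_rigid_2 V E"
  unfolding generically_rigid_2_def
proof (intro allI impI)
  fix p assume "generic V p \<and> inj_on p V"
  then have p: "alg_independent_on (V \<times> UNIV) (coords p)" by (simp add: generic_iff_alg_independent_on)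
  note G = henneberg_graph[OF assms]
  then obtain S where "S \<subseteq> V" "card S = 2" by (meson obtain_subset_with_card_n)
  then obtain a b where ab: "a \<in> V" "b \<in> V" "a \<noteq> b" by (auto simp: card_2_iff)
  obtain D where D: "peval (coords p) D \<noteq> 0" "\<And>x. peval x D \<noteq> 0 \<Longrightarrow> inf_rigid V E x"
    using inf_rigid_certificate[OF _ _ ab(1,2) alg_independent_distinct_coord[OF p ab] henneberg_inf_rigid[OF assms p]] G
    by blast
  obtain \<delta> where "\<delta> > 0" "\<And>x. (\<forall>v. \<bar>x v - coords p v\<bar> \<le> \<delta>) \<Longrightarrow> peval x D \<noteq> 0"
    using peval_nonzero_near[OF D(1)] by blast
  then show "rigid_framework V E p"
    using D(2) G by (intro rigid_if_inf_rigid_nearby[of V E \<delta>]) auto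
qed

section \<open>Generically rigid graphs contain Laman graphs\<close>

text \<open>Any combination \<open>g\<close> of rows is orthogonal to all trivial motions. If
  \<open>g\<close> vanishes off the pins, this gives three equations that force its three pinned
  entries to vanish too, so dropping those columns loses nothing.\<close>

lemma indep_rows_unpin:
  assumes S: "finite S" "simple_graph S F" and ab: "a \<in> S" "b \<in> S" "a \<noteq> b" "x (a, 2) \<noteq> x (b, 2)"
    and ind: "indep_rows F (S \<times> UNIV) (eval_matrix x rigidity_matrix)"
  shows "indep_rows F (S \<times> UNIV - pins a b) (eval_matrix x rigidity_matrix)"
  unfolding indep_rows_def
proof (intro allI impI)
  fix l assume l: "\<forall>c\<in>S \<times> UNIV - pins a b. (\<Sum>e\<in>F. l e * peval x (rigidity_matrix e c)) = 0"
  define g where "g c = (\<Sum>e\<in>F. l e * peval x (rigidity_matrix e c))" for c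
  have orth: "(\<Sum>c\<in>S \<times> UNIV. g c * trivial_motion x s t \<omega> c) = 0" for s t \<omega>
  proof -
    have "(\<Sum>c\<in>S \<times> UNIV. g c * trivial_motion x s t \<omega> c) =
        (\<Sum>c\<in>S \<times> UNIV. \<Sum>e\<in>F. l e * (peval x (rigidity_matrix e c) * trivial_motion x s t \<omega> c))"
      by (simp add: g_def sum_distrib_right mult.assoc)
    also have "\<dots> = (\<Sum>e\<in>F. l e * (\<Sum>c\<in>S \<times> UNIV. peval x (rigidity_matrix e c) * trivial_motion x s t \<omega> c))"
      by (subst sum.swap) (simp add: sum_distrib_left)
    also have "\<dots> = 0"
    proof (intro sum.neutral ballI)
      fix e assume "e \<in> F"
      then obtain u v where "e = {u, v}" "u \<noteq> v" "u \<in> S" "v \<in> S" by (rule simple_graphE[OF S(2)])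
      then show "l e * (\<Sum>c\<in>S \<times> UNIV. peval x (rigidity_matrix e c) * trivial_motion x s t \<omega> c) = 0"
        using rigidity_matrix_apply[OF S(1)] by (simp add: edge_form_trivial_motion)
    qed
    finally show ?thesis .
  qed
  have "(\<Sum>c\<in>S \<times> UNIV. g c * trivial_motion x s t \<omega> c) = (\<Sum>c\<in>pins a b. g c * trivial_motion x s t \<omega> c)" for s t \<omega>
    using l S ab by (intro sum.mono_neutral_right) (auto simp: g_def pins_def)
  then have "g (a, 1) * (s - \<omega> * x (a, 2)) + (g (a, 2) * (t + \<omega> * x (a, 1)) + g (b, 1) * (s - \<omega> * x (b, 2))) = 0" for s t \<omega>
    using orth[of s t \<omega>] ab by (simp add: pins_def)
  \<comment> \<open>The two unit translations and the unit rotation.\<close>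
  from this[of 1 0 0] this[of 0 1 0] this[of 0 0 1]
  have g: "g (b, 1) = - g (a, 1)" "g (a, 2) = 0" "g (a, 1) * x (a, 2) + g (b, 1) * x (b, 2) = 0" by auto
  then have "g (a, 1) * (x (a, 2) - x (b, 2)) = 0" by (simp add: algebra_simps)
  then have "g (a, 1) = 0" using ab by simp
  then have "g c = 0" if "c \<in> S \<times> UNIV" for c using that l g by (cases "c \<in> pins a b") (auto simp: pins_def g_def)
  then show "\<forall>e\<in>F. l e = 0" using ind unfolding indep_rows_def g_def by blast
qed

text \<open>The rows of edges inside \<open>S\<close> live on the columns of \<open>S\<close>, and
  unpinning leaves only \<open>2 * card S - 3\<close> of these.\<close>

lemma indep_rows_sparse:
  assumes V: "finite V" "simple_graph V E" and x: "alg_independent_on (V \<times> UNIV) x"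
    and ind: "indep_rows E (V \<times> UNIV) (eval_matrix x rigidity_matrix)"
    and S: "S \<subseteq> V" "card S \<ge> 2" and F: "F \<subseteq> E" "\<forall>e\<in>F. e \<subseteq> S"
  shows "card F \<le> 2 * card S - 3"
proof -
  have finE: "finite E" using simple_graph_finite V by blast
  have finS: "finite S" using S V finite_subset by blast
  obtain S' where "S' \<subseteq> S" "card S' = 2" using S by (meson obtain_subset_with_card_n)
  then obtain a b where ab: "a \<in> S" "b \<in> S" "a \<noteq> b" by (auto simp: card_2_iff)
  have sF: "simple_graph S F" unfolding simple_graph_def
  proof
    fix e assume e: "e \<in> F"
    then obtain u v where "e = {u, v}" "u \<noteq> v" using F V(2) by (metis simple_graphE subsetD)
    then show "\<exists>i j. e = {i, j} \<and> i \<noteq> j \<and> i \<in> S \<and> j \<in> S" using F e by blast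
  qed
  have "indep_rows F (V \<times> UNIV) (eval_matrix x rigidity_matrix)"
    using indep_rows_subset[OF finE F(1) ind] .
  then have "indep_rows F (S \<times> UNIV) (eval_matrix x rigidity_matrix)"
    unfolding indep_rows_def
  proof (intro allI impI)
    fix l assume ind': "\<forall>l. (\<forall>c\<in>V \<times> UNIV. (\<Sum>e\<in>F. l e * peval x (rigidity_matrix e c)) = 0) \<longrightarrow> (\<forall>e\<in>F. l e = 0)"
      and l: "\<forall>c\<in>S \<times> UNIV. (\<Sum>e\<in>F. l e * peval x (rigidity_matrix e c)) = 0"
    have "\<forall>c\<in>V \<times> UNIV. (\<Sum>e\<in>F. l e * peval x (rigidity_matrix e c)) = 0"
    proof
      fix c assume "c \<in> V \<times> (UNIV :: 2 set)"
      show "(\<Sum>e\<in>F. l e * peval x (rigidity_matrix e c)) = 0"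
      proof (cases "c \<in> S \<times> UNIV")
        case False
        then have "rigidity_matrix e c = PConst 0" if "e \<in> F" for e
          using that F(2) by (cases c) (auto intro!: rigidity_matrix_outside)
        then show ?thesis by simp
      qed (use l in blast)
    qed
    then show "\<forall>e\<in>F. l e = 0" using ind' by blast
  qed
  then have "indep_rows F (S \<times> UNIV - pins a b) (eval_matrix x rigidity_matrix)"
    using indep_rows_unpin[OF finS sF ab] alg_independent_distinct_coord[OF x] ab S by blast
  then have "card F \<le> card (S \<times> (UNIV :: 2 set) - pins a b)"
    using finS finE F finite_subset by (intro indep_rows_card_le) auto
  then show ?thesis using card_coords_minus_pins[OF finS ab] by simp
qed

section \<open>Flexing frameworks of deficient rank\<close>

lemma contraction_fixpoint:
  fixes T :: "('c \<Rightarrow> real) \<Rightarrow> 'c \<Rightarrow> real"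
  assumes "\<delta> \<ge> 0"
    and maps: "\<And>w c. (\<forall>c. \<bar>w c\<bar> \<le> \<delta>) \<Longrightarrow> \<bar>T w c\<bar> \<le> \<delta>"
    and contr: "\<And>w w' d c. (\<forall>c. \<bar>w c\<bar> \<le> \<delta>) \<Longrightarrow> (\<forall>c. \<bar>w' c\<bar> \<le> \<delta>) \<Longrightarrow> (\<forall>c. \<bar>w c - w' c\<bar> \<le> d) \<Longrightarrow>
       \<bar>T w c - T w' c\<bar> \<le> d / 2"
  shows "\<exists>w. (\<forall>c. \<bar>w c\<bar> \<le> \<delta>) \<and> T w = w"
proof -
  \<comment> \<open>Banach iteration from 0 in the sup norm over coordinates. Limits are taken
    coordinatewise, but all estimates are uniform in \<open>c\<close>, so the contraction property
    can be applied to the limit.\<close>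
  define W where "W k = (T ^^ k) (\<lambda>_. 0)" for k
  have W_Suc: "W (Suc k) = T (W k)" for k by (simp add: W_def)
  have bd: "\<bar>W k c\<bar> \<le> \<delta>" for k c
    by (induction k arbitrary: c) (use assms(1) maps in \<open>auto simp: W_Suc, simp add: W_def\<close>)
  have step: "\<bar>W (Suc k) c - W k c\<bar> \<le> \<delta> * (1/2) ^ k" for k c
  proof (induction k arbitrary: c)
    case 0
    then show ?case using bd[of "Suc 0" c] by (simp add: W_def)
  next
    case (Suc k)
    have "\<bar>T (W (Suc k)) c - T (W k) c\<bar> \<le> (\<delta> * (1/2) ^ k) / 2"
      using bd Suc by (intro contr) auto
    then show ?case by (simp add: W_Suc[of "Suc k"] W_Suc[of k])
  qed
  \<comment> \<open>The last factor is the partial geometric sum that closes the induction; it is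
    dropped right afterwards.\<close>
  have far: "\<bar>W (k + j) c - W k c\<bar> \<le> 2 * \<delta> * (1/2) ^ k * (1 - (1/2) ^ j)" for k j c
  proof (induction j)
    case (Suc j)
    have "\<bar>W (k + Suc j) c - W k c\<bar> \<le> \<bar>W (k + j) c - W k c\<bar> + \<bar>W (Suc (k + j)) c - W (k + j) c\<bar>" by simp
    also have "\<dots> \<le> 2 * \<delta> * (1/2) ^ k * (1 - (1/2) ^ j) + \<delta> * (1/2) ^ (k + j)"
      using Suc step[of "k + j" c] by linarith
    also have "\<dots> = 2 * \<delta> * (1/2) ^ k * (1 - (1/2) ^ Suc j)" by (simp add: power_add algebra_simps)
    finally show ?case .
  qed simp
  have far: "\<bar>W (k + j) c - W k c\<bar> \<le> 2 * \<delta> * (1/2) ^ k" for k j c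
  proof -
    have "2 * \<delta> * (1/2) ^ k * (1 - (1/2) ^ j) \<le> 2 * \<delta> * (1/2) ^ k * 1"
      using assms(1) by (intro mult_left_mono) auto
    then show ?thesis using far[of k j c] by linarith
  qed
  have lim0: "(\<lambda>k. 2 * \<delta> * (1/2) ^ k) \<longlonglongrightarrow> 0"
    by (intro tendsto_mult_right_zero LIMSEQ_power_zero) auto
  have "\<exists>L. (\<lambda>k. W k c) \<longlonglongrightarrow> L" for c
  proof -
    have "Cauchy (\<lambda>k. W k c)"
    proof (rule metric_CauchyI)
      fix e :: real assume "e > 0"
      then obtain N where N: "\<bar>2 * \<delta> * (1/2) ^ N\<bar> < e / 2"
        using LIMSEQ_D[OF lim0, of "e / 2"] by auto
      have "dist (W m c) (W n c) < e" if "m \<ge> N" "n \<ge> N" for m n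
        using far[of N "m - N" c] far[of N "n - N" c] that N by (simp add: dist_real_def)
      then show "\<exists>M. \<forall>m\<ge>M. \<forall>n\<ge>M. dist (W m c) (W n c) < e" by blast
    qed
    then show ?thesis using Cauchy_convergent convergent_def by blast
  qed
  then obtain w where w: "\<And>c. (\<lambda>k. W k c) \<longlonglongrightarrow> w c" by metis
  have wb: "\<bar>w c\<bar> \<le> \<delta>" for c
    by (rule LIMSEQ_le_const2[OF tendsto_rabs[OF w]]) (use bd in auto)
  have near: "\<bar>w c - W k c\<bar> \<le> 2 * \<delta> * (1/2) ^ k" for k c
  proof (rule LIMSEQ_le_const2[OF tendsto_rabs[OF tendsto_diff[OF w tendsto_const]]])
    have "\<bar>W n c - W k c\<bar> \<le> 2 * \<delta> * (1/2) ^ k" if "n \<ge> k" for n using far[of k "n - k" c] that by simp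
    then show "\<exists>N. \<forall>n\<ge>N. \<bar>W n c - W k c\<bar> \<le> 2 * \<delta> * (1/2) ^ k" by blast
  qed
  have "T w c = w c" for c
  proof -
    have "\<bar>T w c - w c\<bar> \<le> 2 * (2 * \<delta> * (1/2) ^ k)" for k
    proof -
      have "\<bar>T w c - T (W k) c\<bar> \<le> (2 * \<delta> * (1/2) ^ k) / 2"
        using wb bd near by (intro contr) auto
      moreover have "\<bar>w c - T (W k) c\<bar> \<le> 2 * \<delta> * (1/2) ^ Suc k" using near[of c "Suc k"] by (simp add: W_Suc)
      ultimately show ?thesis using assms(1) by simp
    qed
    then have "\<bar>T w c - w c\<bar> \<le> 0"
      by (intro LIMSEQ_le_const[OF tendsto_mult_right_zero[OF lim0, of 2]]) auto
    then show ?thesis by simp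
  qed
  then show ?thesis using wb by blast
qed

text \<open>Serves to turn approximate equality of distances into equality, for want of a vertexwise
  isometry.\<close>

lemma finite_real_gap:
  fixes D :: "real set"
  assumes "finite D"
  shows "\<exists>\<eta>>0. \<forall>s\<in>D. \<forall>t\<in>D. \<bar>s - t\<bar> < \<eta> \<longrightarrow> s = t"
proof -
  \<comment> \<open>The element 1 keeps the minimum defined when no two elements differ.\<close>
  let ?G = "insert 1 ((\<lambda>(s, t). \<bar>s - t\<bar>) ` {z \<in> D \<times> D. fst z \<noteq> snd z})"
  have fin: "finite ?G" using assms by simp
  have "Min ?G > 0" using fin by (subst Min_gr_iff) auto
  moreover have "s = t" if "s \<in> D" "t \<in> D" "\<bar>s - t\<bar> < Min ?G" for s t
  proof (rule ccontr)
    assume "s \<noteq> t"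
    then have "\<bar>s - t\<bar> \<in> ?G" using that by force
    then have "Min ?G \<le> \<bar>s - t\<bar>" by (rule Min_le[OF fin])
    then show False using that(3) by linarith
  qed
  ultimately show ?thesis by blast
qed

text \<open>The framework is flexed by solving the fixed point equation \<open>w = \<tau> K(p + w / 2)\<close>, where \<open>K\<close>
  is a polynomial vector in the kernel of the pinned rigidity matrix: then \<open>w\<close> is an
  infinitesimal motion of \<open>p + w / 2\<close>, so \<open>p\<close> and \<open>p + w\<close> have the same edge lengths.\<close>

lemma small_flex:
  fixes K :: "'c \<Rightarrow> 'c pexpr"
  assumes "finite C" "\<delta> > 0"
  shows "\<exists>w \<tau>. \<tau> > 0 \<and> (\<forall>c. \<bar>w c\<bar> \<le> \<delta>) \<and>
     (\<forall>c. w c = (if c \<in> C then \<tau> * peval (\<lambda>c. x0 c + w c / 2) (K c) else 0))"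
proof -
  have "\<exists>L\<ge>0. \<forall>c\<in>C. \<forall>x y d. (\<forall>v. \<bar>x v - x0 v\<bar> \<le> 1) \<longrightarrow> (\<forall>v. \<bar>y v - x0 v\<bar> \<le> 1) \<longrightarrow> (\<forall>v. \<bar>x v - y v\<bar> \<le> d) \<longrightarrow>
     \<bar>peval x (K c)\<bar> \<le> L \<and> \<bar>peval x (K c) - peval y (K c)\<bar> \<le> L * d"
    using assms(1)
  proof (induction C rule: finite_induct)
    case (insert c C)
    then obtain L where L: "L \<ge> 0" "\<And>c x y d. c \<in> C \<Longrightarrow> (\<forall>v. \<bar>x v - x0 v\<bar> \<le> 1) \<Longrightarrow> (\<forall>v. \<bar>y v - x0 v\<bar> \<le> 1) \<Longrightarrow> (\<forall>v. \<bar>x v - y v\<bar> \<le> d) \<Longrightarrow>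
     \<bar>peval x (K c)\<bar> \<le> L \<and> \<bar>peval x (K c) - peval y (K c)\<bar> \<le> L * d" by blast
    obtain M where M: "M \<ge> 0" "\<And>x y d. (\<forall>v. \<bar>x v - x0 v\<bar> \<le> 1) \<Longrightarrow> (\<forall>v. \<bar>y v - x0 v\<bar> \<le> 1) \<Longrightarrow> (\<forall>v. \<bar>x v - y v\<bar> \<le> d) \<Longrightarrow>
     \<bar>peval x (K c)\<bar> \<le> M \<and> \<bar>peval x (K c) - peval y (K c)\<bar> \<le> M * d" using peval_Lipschitz[of x0 "K c"] by blast
    show ?case
    proof (intro exI[of _ "L + M"] conjI ballI allI impI)
      show "0 \<le> L + M" using L M by simp
      fix c' x y d assume c': "c' \<in> insert c C" and a: "\<forall>v. \<bar>x v - x0 v\<bar> \<le> 1" "\<forall>v. \<bar>y v - x0 v\<bar> \<le> 1" "\<forall>v. \<bar>x v - y v\<bar> \<le> d"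
      have "d \<ge> 0" using a(3) by (meson abs_ge_zero order_trans)
      then have "0 \<le> L * d" "0 \<le> M * d" using L(1) M(1) by auto
      then show "\<bar>peval x (K c')\<bar> \<le> L + M" "\<bar>peval x (K c') - peval y (K c')\<bar> \<le> (L + M) * d"
        using L(2)[OF _ a, of c'] M(2)[OF a] c' L(1) M(1) unfolding distrib_right by fastforce+
    qed
  qed auto
  then obtain L where L: "L \<ge> 0" "\<And>c x y d. c \<in> C \<Longrightarrow> (\<forall>v. \<bar>x v - x0 v\<bar> \<le> 1) \<Longrightarrow> (\<forall>v. \<bar>y v - x0 v\<bar> \<le> 1) \<Longrightarrow> (\<forall>v. \<bar>x v - y v\<bar> \<le> d) \<Longrightarrow>
     \<bar>peval x (K c)\<bar> \<le> L \<and> \<bar>peval x (K c) - peval y (K c)\<bar> \<le> L * d" by blast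
  define \<delta>' where "\<delta>' = min \<delta> 1"
  have \<delta>': "0 < \<delta>'" "\<delta>' \<le> 1" "\<delta>' \<le> \<delta>" using assms by (auto simp: \<delta>'_def)
  \<comment> \<open>From \<open>\<tau> * L \<le> \<delta>'\<close> the box is mapped into itself;
    from \<open>\<tau> * L \<le> 1\<close> and the halving in \<open>w / 2\<close> comes the
    contraction factor 1/2.\<close>
  define \<tau> where "\<tau> = \<delta>' / (L + 1)"
  have "\<tau> * L = \<delta>' * (L / (L + 1))" by (simp add: \<tau>_def)
  also have "\<dots> \<le> \<delta>' * 1" using L(1) \<delta>' by (intro mult_left_mono) auto
  finally have "\<tau> * L \<le> \<delta>'" by simp
  moreover have "\<tau> > 0" using L(1) \<delta>' by (simp add: \<tau>_def)
  ultimately have \<tau>: "\<tau> > 0" "\<tau> * L \<le> \<delta>'" "\<tau> * L \<le> 1" using \<delta>' by auto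
  define T where "T w c = (if c \<in> C then \<tau> * peval (\<lambda>c. x0 c + w c / 2) (K c) else 0)" for w c
  have "\<exists>w. (\<forall>c. \<bar>w c\<bar> \<le> \<delta>') \<and> T w = w"
  proof (rule contraction_fixpoint)
    show "0 \<le> \<delta>'" using \<delta>' by simp
  next
    fix w :: "'c \<Rightarrow> real" and c assume w: "\<forall>c. \<bar>w c\<bar> \<le> \<delta>'"
    have w1: "\<forall>v. \<bar>(x0 v + w v / 2) - x0 v\<bar> \<le> 1"
    proof
      fix v show "\<bar>(x0 v + w v / 2) - x0 v\<bar> \<le> 1" using w[rule_format, of v] \<delta>' by simp
    qed
    show "\<bar>T w c\<bar> \<le> \<delta>'"
    proof (cases "c \<in> C")
      case True
      have "\<bar>peval (\<lambda>c. x0 c + w c / 2) (K c)\<bar> \<le> L" using L(2)[OF True w1 w1, of 0] by simp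
      then have "\<tau> * \<bar>peval (\<lambda>c. x0 c + w c / 2) (K c)\<bar> \<le> \<tau> * L" using \<tau> by (intro mult_left_mono) auto
      then have "\<tau> * \<bar>peval (\<lambda>c. x0 c + w c / 2) (K c)\<bar> \<le> \<delta>'" using \<tau>(2) by (rule order_trans)
      then show ?thesis using True \<tau>(1) by (simp add: T_def abs_mult)
    qed (use \<delta>' in \<open>simp add: T_def\<close>)
  next
    fix w w' :: "'c \<Rightarrow> real" and d c assume w: "\<forall>c. \<bar>w c\<bar> \<le> \<delta>'" "\<forall>c. \<bar>w' c\<bar> \<le> \<delta>'" "\<forall>c. \<bar>w c - w' c\<bar> \<le> d"
    have d: "d \<ge> 0" using w(3) by (meson abs_ge_zero order_trans)
    have w1: "\<forall>v. \<bar>(x0 v + w v / 2) - x0 v\<bar> \<le> 1" "\<forall>v. \<bar>(x0 v + w' v / 2) - x0 v\<bar> \<le> 1"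
      "\<forall>v. \<bar>(x0 v + w v / 2) - (x0 v + w' v / 2)\<bar> \<le> d / 2"
    proof safe
      fix v
      show "\<bar>(x0 v + w v / 2) - x0 v\<bar> \<le> 1" using w(1)[rule_format, of v] \<delta>' by simp
      show "\<bar>(x0 v + w' v / 2) - x0 v\<bar> \<le> 1" using w(2)[rule_format, of v] \<delta>' by simp
      have "(x0 v + w v / 2) - (x0 v + w' v / 2) = (w v - w' v) / 2" by (simp add: field_simps)
      then show "\<bar>(x0 v + w v / 2) - (x0 v + w' v / 2)\<bar> \<le> d / 2" using w(3)[rule_format, of v] by linarith
    qed
    show "\<bar>T w c - T w' c\<bar> \<le> d / 2"
    proof (cases "c \<in> C")
      case True
      have "\<bar>T w c - T w' c\<bar> = \<tau> * \<bar>peval (\<lambda>c. x0 c + w c / 2) (K c) - peval (\<lambda>c. x0 c + w' c / 2) (K c)\<bar>"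
        using True \<tau> by (simp add: T_def abs_mult right_diff_distrib[symmetric])
      also have "\<dots> \<le> \<tau> * (L * (d / 2))" using L(2)[OF True w1] \<tau> by (intro mult_left_mono) auto
      also have "\<dots> = (\<tau> * L) * (d / 2)" by simp
      also have "\<dots> \<le> 1 * (d / 2)" using \<tau> d by (intro mult_right_mono) auto
      finally show ?thesis by simp
    qed (use d in \<open>simp add: T_def\<close>)
  qed
  then obtain w where w: "\<forall>c. \<bar>w c\<bar> \<le> \<delta>'" "T w = w" by blast
  have "w c = (if c \<in> C then \<tau> * peval (\<lambda>c. x0 c + w c / 2) (K c) else 0)" for c
    using fun_cong[OF w(2), of c] by (simp add: T_def)
  moreover have "\<bar>w c\<bar> \<le> \<delta>" for c using w(1)[rule_format, of c] \<delta>' by linarith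
  ultimately show ?thesis using \<tau>(1) by blast
qed

text \<open>Row \<open>e\<close> is a combination of the rows in \<open>F\<close>, so it annihilates
  whatever they annihilate.\<close>

lemma dependent_row_kernel:
  assumes "finite F" "e \<notin> F" "indep_rows F C M" "\<not> indep_rows (insert e F) C M"
    and "\<And>f. f \<in> F \<Longrightarrow> (\<Sum>c\<in>C. M f c * k c) = 0"
  shows "(\<Sum>c\<in>C. M e c * k c) = 0"
proof -
  obtain l where l: "\<And>c. c \<in> C \<Longrightarrow> (\<Sum>r\<in>insert e F. l r * M r c) = 0" "\<exists>r\<in>insert e F. l r \<noteq> 0"
    using assms(4) unfolding indep_rows_def by blast
  have eq: "l e * M e c = - (\<Sum>r\<in>F. l r * M r c)" if "c \<in> C" for c
    using l(1)[OF that] assms(1,2) by (simp add: eq_neg_iff_add_eq_0)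
  have "l e \<noteq> 0"
  proof
    assume "l e = 0"
    then have "(\<Sum>r\<in>F. l r * M r c) = 0" if "c \<in> C" for c using eq[OF that] by simp
    then have "\<forall>r\<in>F. l r = 0" using indep_rowsD[OF assms(3)] by blast
    then show False using l(2) \<open>l e = 0\<close> by auto
  qed
  have "l e * (\<Sum>c\<in>C. M e c * k c) = (\<Sum>c\<in>C. - (\<Sum>r\<in>F. l r * M r c) * k c)"
    using eq by (simp add: sum_distrib_left mult.assoc[symmetric])
  also have "\<dots> = - (\<Sum>c\<in>C. \<Sum>r\<in>F. l r * (M r c * k c))"
    by (simp add: sum_distrib_right mult.assoc sum_negf)
  also have "\<dots> = - (\<Sum>r\<in>F. l r * (\<Sum>c\<in>C. M r c * k c))"
    by (subst sum.swap) (simp add: sum_distrib_left)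
  also have "\<dots> = 0" using assms(5) by simp
  finally show ?thesis using \<open>l e \<noteq> 0\<close> by simp
qed

text \<open>The edge \<open>ab\<close> forces the last coordinate of \<open>b\<close> to rest, and
  every other vertex is then fixed by its two directions to \<open>a\<close> and
  \<open>b\<close>.\<close>

lemma pinned_motion_zero:
  assumes "\<And>u v. u \<in> V \<Longrightarrow> v \<in> V \<Longrightarrow> edge_form m w u v = 0"
    and ab: "a \<in> V" "b \<in> V" "m (a, 2) \<noteq> m (b, 2)"
    and pinned: "w (a, 1) = 0" "w (a, 2) = 0" "w (b, 1) = 0"
    and nc: "\<And>u. u \<in> V - {a, b} \<Longrightarrow> peval m (collinearity a b u) \<noteq> 0"
    and "u \<in> V"
  shows "w (u, i) = 0"
proof -
  have b: "w (b, 2) = 0" using assms(1)[OF ab(1,2)] ab(3) pinned by (simp add: edge_form_def)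
  have "w (u, 1) = 0 \<and> w (u, 2) = 0"
  proof (cases "u \<in> {a, b}")
    case False
    then have "peval m (collinearity a b u) \<noteq> 0" using nc \<open>u \<in> V\<close> by auto
    then have "(m (u, 1) - m (a, 1)) * (m (u, 2) - m (b, 2)) - (m (u, 2) - m (a, 2)) * (m (u, 1) - m (b, 1)) \<noteq> 0"
      by (simp add: collinearity_def algebra_simps)
    moreover have "(m (u, 1) - m (a, 1)) * w (u, 1) + (m (u, 2) - m (a, 2)) * w (u, 2) = 0"
      using assms(1)[OF \<open>u \<in> V\<close> ab(1)] unfolding edge_form_def pinned by simp
    moreover have "(m (u, 1) - m (b, 1)) * w (u, 1) + (m (u, 2) - m (b, 2)) * w (u, 2) = 0"
      using assms(1)[OF \<open>u \<in> V\<close> ab(2)] unfolding edge_form_def pinned b by simp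
    ultimately show ?thesis using plane_orthogonal_zero by metis
  qed (use b pinned in auto)
  then show ?thesis using exhaust_2[of i] by auto
qed

text \<open>Rigidity would make the constructed displacement \<open>w\<close> preserve all pairwise
  distances; the pins then force \<open>w = 0\<close>, although its entry at the unpinned coordinate
  \<open>c0\<close> is a nonzero multiple of \<open>K c0\<close>.\<close>

lemma flexible_if_rank_deficient:
  assumes V: "finite V" "simple_graph V E" "card V \<ge> 2" and p: "generic V p"
    and F: "F \<subseteq> E" "indep_rows F (V \<times> UNIV) (eval_matrix (coords p) rigidity_matrix)"
    and max: "\<And>e. e \<in> E - F \<Longrightarrow> \<not> indep_rows (insert e F) (V \<times> UNIV) (eval_matrix (coords p) rigidity_matrix)"
    and small: "card F < 2 * card V - 3"
  shows "\<not> rigid_framework V E p"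
proof
  assume "rigid_framework V E p"
  then obtain \<epsilon> where "\<epsilon> > 0" and rig: "\<forall>q. inj_on q V \<and> (\<Sum>u\<in>V. (norm (p u - q u))\<^sup>2) \<le> \<epsilon> \<and>
        (\<forall>u v. {u, v} \<in> E \<longrightarrow> dist (q u) (q v) = dist (p u) (p v)) \<longrightarrow>
        (\<exists>f :: real^2 \<Rightarrow> real^2. (\<forall>x y. dist (f x) (f y) = dist x y) \<and> f ` (p ` V) = q ` V)"
    unfolding rigid_framework_def by (elim exE conjE) (rule that)
  let ?x = "coords p"
  let ?R = "\<lambda>x. eval_matrix x rigidity_matrix"
  have x: "alg_independent_on (V \<times> UNIV) ?x" using p by (simp add: generic_iff_alg_independent_on)
  obtain S where "S \<subseteq> V" "card S = 2" using V(3) by (meson obtain_subset_with_card_n)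
  then obtain a b where ab: "a \<in> V" "b \<in> V" "a \<noteq> b" by (auto simp: card_2_iff)
  have finE: "finite E" using simple_graph_finite V by blast
  have finF: "finite F" using finE F finite_subset by blast
  have sF: "simple_graph V F" using V(2) F(1) unfolding simple_graph_def by blast
  define C where "C = V \<times> UNIV - pins a b"
  have finC: "finite C" using V by (simp add: C_def)
  have indC: "indep_rows F C (?R ?x)"
    unfolding C_def using indep_rows_unpin[OF V(1) sF ab alg_independent_distinct_coord[OF x ab] F(2)] .
  obtain K where K: "\<And>x r. r \<in> F \<Longrightarrow> (\<Sum>c\<in>C. peval x (rigidity_matrix r c) * peval x (K c)) = 0"
    and "\<exists>c\<in>C. peval ?x (K c) \<noteq> 0"
    using polynomial_kernel_vector[OF finF finC _ indC] card_coords_minus_pins[OF V(1) ab] small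
    unfolding C_def by auto
  then obtain c0 where c0: "c0 \<in> C" "peval ?x (K c0) \<noteq> 0" by blast
  obtain D where D: "peval ?x D \<noteq> 0" "\<And>x. peval x D \<noteq> 0 \<Longrightarrow> indep_rows F (V \<times> UNIV) (?R x)"
    using indep_rows_certificate[OF finF F(2), of "V \<times> UNIV"] pvars_rigidity_matrix[OF sF] by blast
  \<comment> \<open>The rank cannot be larger elsewhere than at a generic point: independence at
    \<open>y\<close> would be witnessed by a polynomial that is nonzero at \<open>p\<close> as
    well.\<close>
  have dep: "\<not> indep_rows (insert e F) (V \<times> UNIV) (?R y)" if "e \<in> E - F" for e y
  proof
    assume "indep_rows (insert e F) (V \<times> UNIV) (?R y)"
    from indep_rows_certificate[OF _ this, of "V \<times> UNIV"] pvars_rigidity_matrix[OF V(2)] finF F(1) that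
    obtain D' where D': "pvars D' \<subseteq> V \<times> UNIV" "peval y D' \<noteq> 0"
      "\<And>x. peval x D' \<noteq> 0 \<Longrightarrow> indep_rows (insert e F) (V \<times> UNIV) (?R x)" by blast
    have "peval ?x D' \<noteq> 0" using alg_independent_onD[OF x D'(1,2)] .
    then show False using D'(3) max that by blast
  qed
  \<comment> \<open>What must survive near \<open>p\<close>: independence of \<open>F\<close>, the
    nonzero kernel entry, distinct second coordinates (which make \<open>q\<close> injective and the
    pins effective), and noncollinearity with \<open>a\<close> and \<open>b\<close>.\<close>
  let ?conds = "{D, K c0} \<union> (\<lambda>(u, v). PSub (PVar (u, 2)) (PVar (v, 2))) ` {z \<in> V \<times> V. fst z \<noteq> snd z}
     \<union> collinearity a b ` (V - {a, b})"
  have "\<exists>\<delta>>0. \<forall>y. (\<forall>v. \<bar>y v - ?x v\<bar> \<le> \<delta>) \<longrightarrow> (\<forall>e\<in>?conds. peval y e \<noteq> 0)"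
  proof (rule pevals_nonzero_near)
    show "finite ?conds" using V by simp
    fix e assume "e \<in> ?conds"
    then consider "e = D" | "e = K c0" | u v where "u \<in> V" "v \<in> V" "u \<noteq> v" "e = PSub (PVar (u, 2)) (PVar (v, 2))"
      | u where "u \<in> V - {a, b}" "e = collinearity a b u" by auto
    then show "peval ?x e \<noteq> 0"
    proof cases
      case 3
      then show ?thesis using alg_independent_distinct_coord[OF x, of u v 2] by simp
    next
      case 4
      then show ?thesis using alg_independent_not_collinear[OF x, of a b u] ab by auto
    qed (use D c0 in auto)
  qed
  then obtain \<delta>1 where \<delta>1: "\<delta>1 > 0" "\<And>y e. (\<forall>v. \<bar>y v - ?x v\<bar> \<le> \<delta>1) \<Longrightarrow> e \<in> ?conds \<Longrightarrow> peval y e \<noteq> 0" by blast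
  define Ds where "Ds = (\<lambda>(u, v). dist (p u) (p v)) ` (V \<times> V)"
  obtain \<eta> where \<eta>: "\<eta> > 0" "\<forall>s\<in>Ds. \<forall>t\<in>Ds. \<bar>s - t\<bar> < \<eta> \<longrightarrow> s = t"
    using finite_real_gap[of Ds] V by (auto simp: Ds_def)
  \<comment> \<open>A vertex moves by at most \<open>2 * \<delta>\<close>, so a distance changes by
    at most \<open>4 * \<delta>\<close>, which is below \<eta>. As \<open>\<delta> \<le> 1\<close>,
    the squared displacement is at most \<open>4 * \<delta>\<close>, hence at most
    \<open>\<epsilon> / card V\<close>.\<close>
  define \<delta> where "\<delta> = min \<delta>1 (min (\<eta> / 8) (min 1 (\<epsilon> / (4 * card V))))"
  have \<delta>: "\<delta> > 0" "\<delta> \<le> \<delta>1" "\<delta> \<le> \<eta> / 8" "\<delta> \<le> 1" "\<delta> \<le> \<epsilon> / (4 * card V)"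
    using \<delta>1 \<eta> \<open>\<epsilon> > 0\<close> V(3) by (auto simp: \<delta>_def)
  obtain w \<tau> where "\<tau> > 0" and wb: "\<And>c. \<bar>w c\<bar> \<le> \<delta>"
    and w: "\<And>c. w c = (if c \<in> C then \<tau> * peval (\<lambda>c. ?x c + w c / 2) (K c) else 0)"
    using small_flex[OF finC \<delta>(1), of ?x K] by blast
  define m where "m = (\<lambda>c. ?x c + w c / 2)"
  define q :: "'a \<Rightarrow> real^2" where "q u = (\<chi> i. p u $ i + w (u, i))" for u
  have "\<bar>m v - ?x v\<bar> \<le> \<delta>1" for v using wb[of v] \<delta> by (simp add: m_def)
  then have m: "peval m e \<noteq> 0" if "e \<in> ?conds" for e using \<delta>1(2)[of m e] that by blast
  have mot: "edge_form m w u v = 0" if uv: "{u, v} \<in> E" for u v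
  proof -
    let ?k = "\<lambda>c. if c \<in> C then peval m (K c) else 0"
    have Ck: "(\<Sum>c\<in>V \<times> UNIV. peval m (rigidity_matrix f c) * ?k c) = (\<Sum>c\<in>C. peval m (rigidity_matrix f c) * peval m (K c))" for f
      using V by (intro sum.mono_neutral_cong_right) (auto simp: C_def)
    have k: "(\<Sum>c\<in>V \<times> UNIV. peval m (rigidity_matrix f c) * ?k c) = 0" if "f \<in> F" for f
      unfolding Ck using K that by blast
    have indm: "indep_rows F (V \<times> UNIV) (?R m)" using D(2) m by blast
    have "(\<Sum>c\<in>V \<times> UNIV. peval m (rigidity_matrix {u, v} c) * ?k c) = 0"
    proof (cases "{u, v} \<in> F")
      case False
      show ?thesis
        using dependent_row_kernel[OF finF False indm _ k] dep[of "{u, v}" m] False uv by blast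
    qed (rule k)
    then have "edge_form m ?k u v = 0"
      using rigidity_matrix_apply[OF V(1) simple_graph_endpoints[OF V(2) uv]] by simp
    moreover have "w = (\<lambda>c. \<tau> * ?k c)" using w unfolding m_def by (auto simp: fun_eq_iff)
    then have "edge_form m w u v = \<tau> * edge_form m ?k u v"
      by (subst \<open>w = _\<close>) (simp only: edge_form_def, simp add: algebra_simps)
    ultimately show ?thesis by simp
  qed
  have form: "edge_form m w u v = ((dist (q u) (q v))\<^sup>2 - (dist (p u) (p v))\<^sup>2) / 2" for u v
    by (rule edge_form_midpoint) (simp_all add: m_def q_def field_simps)
  have pq: "norm (p u - q u) \<le> 2 * \<delta>" for u
  proof -
    have "norm (p u - q u) \<le> (\<Sum>i\<in>UNIV. \<bar>(p u - q u) $ i\<bar>)" by (rule norm_le_l1_cart)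
    also have "\<dots> = \<bar>w (u, 1)\<bar> + \<bar>w (u, 2)\<bar>" by (simp add: q_def sum_2)
    finally show ?thesis using wb[of "(u, 1)"] wb[of "(u, 2)"] by linarith
  qed
  have "inj_on q V"
  proof (rule inj_onI, rule ccontr)
    fix u v assume uv: "u \<in> V" "v \<in> V" "q u = q v" "u \<noteq> v"
    have "\<bar>?x c + w c - ?x c\<bar> \<le> \<delta>1" for c using wb[of c] \<delta> by simp
    moreover have "PSub (PVar (u, 2)) (PVar (v, 2)) \<in> ?conds" using uv by force
    ultimately have "peval (\<lambda>c. ?x c + w c) (PSub (PVar (u, 2)) (PVar (v, 2))) \<noteq> 0"
      using \<delta>1(2)[of "\<lambda>c. ?x c + w c"] by blast
    then have "q u $ 2 \<noteq> q v $ 2" by (simp add: q_def)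
    then show False using uv by simp
  qed
  moreover have "(\<Sum>u\<in>V. (norm (p u - q u))\<^sup>2) \<le> \<epsilon>"
  proof -
    have "(norm (p u - q u))\<^sup>2 \<le> \<epsilon> / card V" for u
    proof -
      have "(norm (p u - q u))\<^sup>2 \<le> (2 * \<delta>)\<^sup>2" using pq by (intro power_mono) auto
      also have "\<dots> = 4 * (\<delta> * \<delta>)" by (simp add: power2_eq_square)
      also have "\<dots> \<le> 4 * (1 * \<delta>)" using \<delta> by (intro mult_left_mono mult_right_mono) auto
      also have "\<dots> \<le> 4 * (\<epsilon> / (4 * card V))" using \<delta> by simp
      also have "\<dots> = \<epsilon> / card V" by simp
      finally show ?thesis .
    qed
    then have "(\<Sum>u\<in>V. (norm (p u - q u))\<^sup>2) \<le> (\<Sum>u\<in>V. \<epsilon> / card V)" by (intro sum_mono)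
    also have "\<dots> = \<epsilon>" using V(3) by simp
    finally show ?thesis .
  qed
  moreover have "dist (q u) (q v) = dist (p u) (p v)" if "{u, v} \<in> E" for u v
    using form[of u v] mot[OF that] by simp
  ultimately obtain f :: "real^2 \<Rightarrow> real^2" where f: "\<And>x y. dist (f x) (f y) = dist x y" "f ` (p ` V) = q ` V"
    using rig[rule_format, of q] by blast
  \<comment> \<open>The isometry may permute the points, but it shows that every distance in
    \<open>q\<close> occurs among those in \<open>p\<close>. Being within \<eta> of the original
    distance, it equals it.\<close>
  have same: "dist (q u) (q v) = dist (p u) (p v)" if uv: "u \<in> V" "v \<in> V" for u v
  proof -
    have "q u \<in> f ` (p ` V)" "q v \<in> f ` (p ` V)" unfolding f(2) using uv by auto
    then obtain u' v' where "u' \<in> V" "v' \<in> V" "q u = f (p u')" "q v = f (p v')" by blast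
    then have "dist (q u) (q v) \<in> Ds" using f(1) by (auto simp: Ds_def)
    moreover have "dist (p u) (p v) \<in> Ds" using uv by (auto simp: Ds_def)
    moreover have "\<bar>dist (q u) (q v) - dist (p u) (p v)\<bar> \<le> dist (q u) (p u) + dist (q v) (p v)"
      by metric
    then have "\<bar>dist (q u) (q v) - dist (p u) (p v)\<bar> < \<eta>"
      using pq[of u] pq[of v] \<delta> \<eta>(1) by (simp add: dist_norm norm_minus_commute)
    ultimately show ?thesis using \<eta>(2) by blast
  qed
  obtain u0 i0 where c0': "c0 = (u0, i0)" by (cases c0)
  have "w c0 = 0" unfolding c0'
  proof (rule pinned_motion_zero[where V = V and m = m and a = a and b = b])
    show "edge_form m w u v = 0" if "u \<in> V" "v \<in> V" for u v using form[of u v] same[OF that] by simp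
    have "PSub (PVar (a, 2)) (PVar (b, 2)) \<in> ?conds" using ab by force
    from m[OF this] show "m (a, 2) \<noteq> m (b, 2)" by simp
    show "w (a, 1) = 0" "w (a, 2) = 0" "w (b, 1) = 0"
      using w[of "(a, 1)"] w[of "(a, 2)"] w[of "(b, 1)"] by (simp_all add: C_def pins_def)
    show "peval m (collinearity a b u) \<noteq> 0" if "u \<in> V - {a, b}" for u using m that by blast
    show "u0 \<in> V" using c0 c0' by (simp add: C_def)
  qed (use ab in auto)
  moreover have "w c0 = \<tau> * peval m (K c0)" using w[of c0] c0 by (simp add: m_def)
  moreover have "peval m (K c0) \<noteq> 0" using m by blast
  ultimately show False using \<open>\<tau> > 0\<close> by simp
qed

lemma generically_rigid_contains_laman:
  assumes V: "finite V" "simple_graph V E" "card V \<ge> 2" and rigid: "generically_rigid_2 V E"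
  shows "\<exists>F\<subseteq>E. laman V F"
proof -
  obtain p where p: "generic V p" using generic_exists[OF V(1)] by blast
  then have x: "alg_independent_on (V \<times> UNIV) (coords p)" by (simp add: generic_iff_alg_independent_on)
  have "inj_on p V"
    by (rule inj_onI) (metis alg_independent_distinct_coord[OF x] coords_apply)
  then have rp: "rigid_framework V E p" using rigid p unfolding generically_rigid_2_def by blast
  let ?I = "\<lambda>F. F \<subseteq> E \<and> indep_rows F (V \<times> UNIV) (eval_matrix (coords p) rigidity_matrix)"
  have finE: "finite E" using simple_graph_finite V by blast
  have empty: "?I {}" by (simp add: indep_rows_def)
  have bound: "\<forall>F. ?I F \<longrightarrow> card F < Suc (card E)"
    using finE by (auto simp: less_Suc_eq_le intro: card_mono)
  \<comment> \<open>A largest independent set of rows, so that adding any further edge creates a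
    dependency.\<close>
  obtain F where F: "?I F" and max: "\<And>G. ?I G \<Longrightarrow> card G \<le> card F"
    using Lattices_Big.ex_has_greatest_nat[of ?I "{}" card, OF empty bound] by blast
  have finF: "finite F" using F finE finite_subset by blast
  have sF: "simple_graph V F" using V(2) F unfolding simple_graph_def by blast
  have sparse: "card G \<le> 2 * card S - 3" if "S \<subseteq> V" "G \<subseteq> F" "\<forall>e\<in>G. e \<subseteq> S" "card S \<ge> 2" for S G
    using indep_rows_sparse[OF V(1) sF x] F that by blast
  have "\<not> card F < 2 * card V - 3"
  proof
    assume small: "card F < 2 * card V - 3"
    have "\<not> rigid_framework V E p"
    proof (rule flexible_if_rank_deficient[OF V p])
      fix e assume e: "e \<in> E - F"
      show "\<not> indep_rows (insert e F) (V \<times> UNIV) (eval_matrix (coords p) rigidity_matrix)"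
        using max[of "insert e F"] e F finF by auto
    qed (use F small in auto)
    then show False using rp by blast
  qed
  moreover have "card F \<le> 2 * card V - 3"
  proof (rule sparse)
    show "\<forall>e\<in>F. e \<subseteq> V" using sF unfolding simple_graph_def by auto
  qed (use V(3) in auto)
  ultimately have "laman V F" unfolding laman_def using sparse V(1) by auto
  then show ?thesis using F by blast
qed

section \<open>Laman graphs are Henneberg\<close>

definition edges_in :: "'a set set \<Rightarrow> 'a set \<Rightarrow> 'a set set" where
  "edges_in E S = {e \<in> E. e \<subseteq> S}"

lemma edges_in_Int: "edges_in E S \<inter> edges_in E T = edges_in E (S \<inter> T)"
  by (auto simp: edges_in_def)

lemma edges_in_small:
  assumes "simple_graph V E" "finite S" "card S \<le> 1"
  shows "edges_in E S = {}"
proof (rule ccontr)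
  assume "edges_in E S \<noteq> {}"
  then obtain e where "e \<in> E" "e \<subseteq> S" by (auto simp: edges_in_def)
  moreover from this obtain a b where "e = {a, b}" "a \<noteq> b" using assms(1) by (metis simple_graphE)
  ultimately show False using card_mono[OF assms(2), of e] assms(3) by simp
qed

lemma lamanD:
  assumes "laman V E" "S \<subseteq> V" "F \<subseteq> E" "\<And>e. e \<in> F \<Longrightarrow> e \<subseteq> S" "card S \<ge> 2"
  shows "card F \<le> 2 * card S - 3"
  using assms(1)[unfolded laman_def, THEN conjunct2, THEN conjunct2, rule_format, of S F] assms(2-) by simp

lemma simple_graph_edge_subset: "simple_graph V E \<Longrightarrow> e \<in> E \<Longrightarrow> e \<subseteq> V"
  by (auto simp: simple_graph_def)

text \<open>The additive form avoids truncated subtraction in the counting arguments.\<close>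

lemma laman_sparse:
  assumes "laman V E" "S \<subseteq> V" "card S \<ge> 2"
  shows "card (edges_in E S) + 3 \<le> 2 * card S"
proof -
  have "card (edges_in E S) \<le> 2 * card S - 3"
    using assms by (intro lamanD[OF assms(1)]) (auto simp: edges_in_def)
  then show ?thesis using assms(3) by linarith
qed

lemma simple_graph_degree_sum:
  assumes "finite V" "simple_graph V E"
  shows "(\<Sum>v\<in>V. card {e \<in> E. v \<in> e}) = 2 * card E"
proof -
  have fin: "finite E" using simple_graph_finite assms by blast
  have "(\<Sum>v\<in>V. card {e \<in> E. v \<in> e}) = (\<Sum>v\<in>V. \<Sum>e\<in>E. if v \<in> e then 1 else 0)"
    using fin by (simp add: sum.If_cases Int_def)
  also have "\<dots> = (\<Sum>e\<in>E. \<Sum>v\<in>V. if v \<in> e then 1 else 0)" by (rule sum.swap)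
  also have "\<dots> = (\<Sum>e\<in>E. 2)"
  proof (rule sum.cong)
    fix e assume "e \<in> E"
    then obtain a b where "e = {a, b}" "a \<noteq> b" "a \<in> V" "b \<in> V" by (rule simple_graphE[OF assms(2)])
    then have "V \<inter> {v. v \<in> e} = {a, b}" by auto
    then show "(\<Sum>v\<in>V. if v \<in> e then 1 else 0) = (2 :: nat)"
      using assms \<open>a \<noteq> b\<close> by (simp add: sum.If_cases)
  qed simp
  finally show ?thesis by simp
qed

lemma laman_subgraph:
  assumes "laman V E" "S \<subseteq> V" "F \<subseteq> E" "card F = 2 * card S - 3"
  shows "laman S F"
  unfolding laman_def
proof (intro conjI allI impI)
  have "finite V" using assms(1) by (simp add: laman_def)
  then show "finite S" using assms(2) by (rule rev_finite_subset)
  fix S' F' assume "S' \<subseteq> S \<and> F' \<subseteq> F \<and> (\<forall>e\<in>F'. e \<subseteq> S') \<and> 2 \<le> card S'"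
  then show "card F' \<le> 2 * card S' - 3" using assms by (intro lamanD[OF assms(1)]) auto
qed (rule assms)

text \<open>If every pair of neighbours of a vertex of degree three lay in a set spanning the maximal number of edges, then
  uncrossing these three sets would give such a set containing all three neighbours, and adding
  the vertex to it would violate sparsity.\<close>

lemma laman_degree_three_pair:
  assumes L: "laman V E" and G: "simple_graph V E" and v: "v \<in> V"
    and N: "{e \<in> E. v \<in> e} = {{v, a}, {v, b}, {v, c}}" "distinct [a, b, c]" "{a, b, c} \<subseteq> V - {v}"
  shows "\<exists>i j. {i, j} \<subseteq> {a, b, c} \<and> i \<noteq> j \<and>
    (\<forall>S\<subseteq>V - {v}. i \<in> S \<longrightarrow> j \<in> S \<longrightarrow> card (edges_in E S) + 3 < 2 * card S)"
proof (rule ccontr)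
  assume *: "\<not> ?thesis"
  define tight where "tight S \<longleftrightarrow> S \<subseteq> V - {v} \<and> card (edges_in E S) + 3 \<ge> 2 * card S" for S
  have fin: "finite V" "finite E" using L G simple_graph_finite unfolding laman_def by auto
  have finS: "finite S" if "S \<subseteq> V - {v}" for S using that fin finite_subset by blast
  have finE: "finite (edges_in E S)" for S using fin by (simp add: edges_in_def)
  \<comment> \<open>Adding \<open>v\<close> would bring three new edges for one new vertex, while
    the sparsity bound grows only by two.\<close>
  have no: "\<not> {a, b, c} \<subseteq> S" if "tight S" for S
  proof
    assume abc: "{a, b, c} \<subseteq> S"
    have S: "S \<subseteq> V - {v}" "v \<notin> S" using that by (auto simp: tight_def)
    have "edges_in E S \<union> {{v, a}, {v, b}, {v, c}} \<subseteq> edges_in E (insert v S)"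
      using abc N(1) by (auto simp: edges_in_def)
    then have "card (edges_in E S \<union> {{v, a}, {v, b}, {v, c}}) \<le> card (edges_in E (insert v S))"
      by (intro card_mono finE)
    moreover have "card (edges_in E S \<union> {{v, a}, {v, b}, {v, c}}) = card (edges_in E S) + card {{v, a}, {v, b}, {v, c}}"
      using S(2) finE by (intro card_Un_disjoint) (auto simp: edges_in_def)
    moreover have "card {{v, a}, {v, b}, {v, c}} = 3"
      using N(2) by (auto simp: card_insert_if doubleton_eq_iff)
    moreover have "card S \<ge> 3" using card_mono[OF finS[OF S(1)] abc] N(2) by (simp add: card_insert_if)
    moreover have "card (insert v S) = card S + 1" using S finS by simp
    moreover have "card (edges_in E (insert v S)) + 3 \<le> 2 * card (insert v S)"
      using \<open>card S \<ge> 3\<close> S v \<open>card (insert v S) = card S + 1\<close> by (intro laman_sparse[OF L]) auto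
    ultimately show False using that by (simp add: tight_def)
  qed
  have tight_Un: "tight (S \<union> T)" if "tight S" "tight T" "card (S \<inter> T) \<ge> 2" for S T
  proof -
    have st: "S \<subseteq> V - {v}" "T \<subseteq> V - {v}" using that by (auto simp: tight_def)
    have "card (edges_in E S) + card (edges_in E T) =
        card (edges_in E S \<union> edges_in E T) + card (edges_in E (S \<inter> T))"
      using card_Un_Int[OF finE finE] by (simp add: edges_in_Int)
    moreover have "card (edges_in E S \<union> edges_in E T) \<le> card (edges_in E (S \<union> T))"
      by (intro card_mono finE) (auto simp: edges_in_def)
    moreover have "card (edges_in E (S \<inter> T)) + 3 \<le> 2 * card (S \<inter> T)"
      using st that by (intro laman_sparse[OF L]) auto
    moreover have "card S + card T = card (S \<union> T) + card (S \<inter> T)"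
      using card_Un_Int finS st by blast
    ultimately show ?thesis using that unfolding tight_def by auto
  qed
  have ex: "\<exists>S. tight S \<and> i \<in> S \<and> j \<in> S" if "{i, j} \<subseteq> {a, b, c}" "i \<noteq> j" for i j
    using * that unfolding tight_def by (meson linorder_not_less)
  obtain S1 S2 S3 where S: "tight S1" "a \<in> S1" "b \<in> S1" "tight S2" "b \<in> S2" "c \<in> S2" "tight S3" "a \<in> S3" "c \<in> S3"
    using ex[of a b] ex[of b c] ex[of a c] N(2) by auto
  have f: "finite S1" "finite S2" "finite S3" using S finS by (auto simp: tight_def)
  \<comment> \<open>The union of any two of these sets contains \<open>a\<close>, \<open>b\<close>
    and \<open>c\<close>, hence is not tight, so uncrossing cannot apply.\<close>
  have "card (S1 \<inter> S2) \<le> 1" "card (S1 \<inter> S3) \<le> 1" "card (S2 \<inter> S3) \<le> 1"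
    using no[of "S1 \<union> S2"] no[of "S1 \<union> S3"] no[of "S2 \<union> S3"] S
      tight_Un[of S1 S2] tight_Un[of S1 S3] tight_Un[of S2 S3] by force+
  then have disj: "edges_in E S1 \<inter> edges_in E S2 = {}" "edges_in E S1 \<inter> edges_in E S3 = {}"
      "edges_in E S2 \<inter> edges_in E S3 = {}"
    and I: "S1 \<inter> S2 = {b}" "S1 \<inter> S3 = {a}" "S2 \<inter> S3 = {c}"
    using f S unfolding edges_in_Int by (auto intro!: edges_in_small[OF G] dest: card_le_Suc0_iff_eq[THEN iffD1, rotated])
  \<comment> \<open>The sizes add up to \<open>card ?S + 3\<close> and the edge sets are disjoint,
    so at least \<open>2 * (card ?S + 3) - 9 = 2 * card ?S - 3\<close> edges lie in
    \<open>?S\<close>.\<close>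
  let ?S = "S1 \<union> S2 \<union> S3"
  have "card (edges_in E S1 \<union> edges_in E S2 \<union> edges_in E S3) \<le> card (edges_in E ?S)"
    by (intro card_mono finE) (auto simp: edges_in_def)
  moreover have "card (edges_in E S1 \<union> edges_in E S2 \<union> edges_in E S3) =
      card (edges_in E S1) + card (edges_in E S2) + card (edges_in E S3)"
    using disj finE by (simp add: card_Un_disjoint Int_Un_distrib2)
  moreover have "card S1 + card S2 = card (S1 \<union> S2) + 1" using card_Un_Int[OF f(1,2)] I by simp
  moreover have "(S1 \<union> S2) \<inter> S3 = {a, c}" using I by blast
  then have "card (S1 \<union> S2) + card S3 = card ?S + 2"
    using card_Un_Int[of "S1 \<union> S2" S3] f N(2) by simp
  ultimately have "tight ?S" using S unfolding tight_def by auto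
  then show False using no S by blast
qed

lemma laman_imp_henneberg:
  assumes "laman V E" "simple_graph V E" "card V \<ge> 2"
  shows "henneberg V E"
  using assms
proof (induction "card V" arbitrary: V E rule: less_induct)
  case less
  note L = less.prems(1) and G = less.prems(2)
  have fin: "finite V" "finite E" using L G simple_graph_finite unfolding laman_def by auto
  have cE: "card E = 2 * card V - 3" using L unfolding laman_def by blast
  show ?case
  proof (cases "card V = 2")
    case True
    then obtain a b where V: "V = {a, b}" "a \<noteq> b" by (auto simp: card_2_iff)
    have "E \<subseteq> {{a, b}}" using G V by (auto elim!: simple_graphE)
    moreover have "E \<noteq> {}" using cE True by auto
    ultimately have "E = {{a, b}}" by auto
    then show ?thesis using V henneberg.K2 by auto
  next
    case False
    then have n3: "card V \<ge> 3" using less.prems by simp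
    \<comment> \<open>The degrees sum to \<open>4 * card V - 6\<close>, so not all of them are at
      least 4.\<close>
    have "\<exists>v\<in>V. card {e \<in> E. v \<in> e} \<le> 3"
    proof (rule ccontr)
      assume "\<not> ?thesis"
      then have "(\<Sum>v\<in>V. 4) \<le> (\<Sum>v\<in>V. card {e \<in> E. v \<in> e})" by (intro sum_mono) auto
      then show False using simple_graph_degree_sum[OF fin(1) G] cE n3 by simp
    qed
    then obtain v where v: "v \<in> V" and deg: "card {e \<in> E. v \<in> e} \<le> 3" by blast
    define V0 where "V0 = V - {v}"
    define E0 where "E0 = edges_in E V0"
    have V0: "card V0 = card V - 1" "v \<notin> V0" "insert v V0 = V" "finite V0" using v fin by (auto simp: V0_def)
    have split: "E = E0 \<union> {e \<in> E. v \<in> e}" "E0 \<inter> {e \<in> E. v \<in> e} = {}"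
      using simple_graph_edge_subset[OF G] unfolding E0_def edges_in_def V0_def by auto
    have cE0: "card E = card E0 + card {e \<in> E. v \<in> e}"
      using split fin by (metis (no_types, lifting) card_Un_disjoint finite_Un)
    have "card E0 + 3 \<le> 2 * card V0" unfolding E0_def
      using V0 n3 by (intro laman_sparse[OF L]) (auto simp: V0_def)
    then have deg2: "card {e \<in> E. v \<in> e} \<ge> 2" using cE0 cE V0 n3 by linarith
    define N where "N = {u. {v, u} \<in> E}"
    have NV: "N \<subseteq> V0"
    proof
      fix u assume "u \<in> N"
      then have "{v, u} \<in> E" by (simp add: N_def)
      from simple_graph_endpoints[OF G this] show "u \<in> V0" by (simp add: V0_def)
    qed
    have "{e \<in> E. v \<in> e} = (\<lambda>u. {v, u}) ` N"
    proof safe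
      fix e assume e: "e \<in> E" "v \<in> e"
      from G e(1) obtain x y where xy: "e = {x, y}" by (metis simple_graphE)
      then have "e = {v, x} \<or> e = {v, y}" using e by auto
      then show "e \<in> (\<lambda>u. {v, u}) ` N" using e by (auto simp: N_def)
    qed (auto simp: N_def)
    moreover have "inj_on (\<lambda>u. {v, u}) N" by (auto simp: inj_on_def doubleton_eq_iff)
    ultimately have im: "{e \<in> E. v \<in> e} = (\<lambda>u. {v, u}) ` N" and cN: "card N = card {e \<in> E. v \<in> e}"
      by (simp_all add: card_image)
    have G0: "simple_graph V0 E0" unfolding simple_graph_def
    proof
      fix e assume e: "e \<in> E0"
      then have "e \<in> E" by (simp add: E0_def edges_in_def)
      then obtain x y where "e = {x, y}" "x \<noteq> y" using simple_graphE[OF G, of e] by metis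
      then show "\<exists>i j. e = {i, j} \<and> i \<noteq> j \<and> i \<in> V0 \<and> j \<in> V0" using e by (auto simp: E0_def edges_in_def)
    qed
    consider "card N = 2" | "card N = 3" using cN deg deg2 by linarith
    then show ?thesis
    proof cases
      case 1
      then obtain a b where ab: "N = {a, b}" "a \<noteq> b" by (auto simp: card_2_iff)
      have "laman V0 E0"
        using cE0 cE V0 1 cN n3 split
        by (intro laman_subgraph[OF L]) (auto simp: V0_def E0_def edges_in_def)
      then have "henneberg V0 E0" using less.hyps[of V0 E0] G0 V0 n3 by auto
      then have "henneberg (insert v V0) (E0 \<union> {{v, a}, {v, b}})"
        using ab NV V0 by (intro henneberg.move1) auto
      then show ?thesis using V0(3) split(1) im ab by simp
    next
      case 2
      then obtain a b c where abc: "N = {a, b, c}" "distinct [a, b, c]" by (auto simp: card_3_iff)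
      obtain i j where ij: "{i, j} \<subseteq> N" "i \<noteq> j"
        and nt: "\<And>S. S \<subseteq> V0 \<Longrightarrow> i \<in> S \<Longrightarrow> j \<in> S \<Longrightarrow> card (edges_in E S) + 3 < 2 * card S"
        using laman_degree_three_pair[OF L G v _ abc(2)] im abc(1) NV unfolding V0_def by auto
      obtain k where k: "N = {i, j, k}" "k \<noteq> i" "k \<noteq> j" using ij abc by auto
      define E1 where "E1 = insert {i, j} E0"
      \<comment> \<open>If \<open>ij\<close> were an edge, the set \<open>{i, j}\<close> would
        itself span the maximal number, one, against the choice of the pair.\<close>
      have ijE: "{i, j} \<notin> E"
      proof
        assume "{i, j} \<in> E"
        then have "{{i, j}} \<subseteq> edges_in E {i, j}" by (auto simp: edges_in_def)
        then have "card {{i, j}} \<le> card (edges_in E {i, j})"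
          using fin by (intro card_mono) (auto simp: edges_in_def)
        then show False using nt[of "{i, j}"] ij NV by auto
      qed
      have finE0: "finite E0" using fin by (simp add: E0_def edges_in_def)
      have ijE0: "{i, j} \<notin> E0" using ijE by (simp add: E0_def edges_in_def)
      have "laman V0 E1" unfolding laman_def
      proof (intro conjI allI impI)
        show "finite V0" by (rule V0)
        show "card E1 = 2 * card V0 - 3" using ijE0 finE0 cE0 cN 2 cE V0 n3 by (simp add: E1_def)
        fix S F assume SF: "S \<subseteq> V0 \<and> F \<subseteq> E1 \<and> (\<forall>e\<in>F. e \<subseteq> S) \<and> 2 \<le> card S"
        show "card F \<le> 2 * card S - 3"
        proof (cases "{i, j} \<in> F")
          case True
          then have "F - {{i, j}} \<subseteq> edges_in E S" using SF by (auto simp: E1_def E0_def edges_in_def)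
          then have "card (F - {{i, j}}) \<le> card (edges_in E S)"
            using fin by (intro card_mono) (auto simp: edges_in_def)
          moreover have "card (edges_in E S) + 3 < 2 * card S" using nt SF True by auto
          moreover have "finite E1" using finE0 by (simp add: E1_def)
          then have "finite F" using SF by (blast intro: finite_subset)
          ultimately show ?thesis using True by (simp add: card_Diff_singleton)
        next
          case False
          then have "F \<subseteq> E" using SF by (auto simp: E1_def E0_def edges_in_def)
          then show ?thesis using SF by (intro lamanD[OF L]) (auto simp: V0_def)
        qed
      qed
      moreover have "simple_graph V0 E1" using G0 ij NV unfolding simple_graph_def E1_def by blast
      ultimately have "henneberg V0 E1" using less.hyps[of V0 E1] V0 n3 by auto
      then have "henneberg (insert v V0) (E1 - {{i, j}} \<union> {{v, i}, {v, j}, {v, k}})"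
        using ij k NV V0 by (intro henneberg.move2) (auto simp: E1_def)
      moreover have "E1 - {{i, j}} = E0" using ijE0 by (auto simp: E1_def)
      ultimately show ?thesis using V0(3) split(1) im k by simp
    qed
  qed
qed

section \<open>Multigraph trees\<close>

definition mg_loopless :: "'w set \<Rightarrow> 'e set \<Rightarrow> ('e \<Rightarrow> 'w set) \<Rightarrow> bool" where
  "mg_loopless W Ed ends \<longleftrightarrow> finite W \<and> finite Ed \<and> (\<forall>e\<in>Ed. \<exists>u\<in>W. \<exists>w\<in>W. u \<noteq> w \<and> ends e = {u, w})"

abbreviation mg_conn :: "'e set \<Rightarrow> ('e \<Rightarrow> 'w set) \<Rightarrow> 'w \<Rightarrow> 'w \<Rightarrow> bool" where
  "mg_conn Ed ends \<equiv> (mg_adj Ed ends)\<^sup>*\<^sup>*"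

lemma mg_adj_sym: "mg_adj Ed ends u w \<Longrightarrow> mg_adj Ed ends w u"
  by (auto simp: mg_adj_def insert_commute)

lemma mg_conn_sym: "mg_conn Ed ends u w \<Longrightarrow> mg_conn Ed ends w u"
proof (induction rule: rtranclp_induct)
  case (step y z)
  then show ?case using mg_adj_sym[of Ed ends y z] by (meson converse_rtranclp_into_rtranclp)
qed simp

lemma mg_conn_mono: "mg_conn Ed ends u w \<Longrightarrow> Ed \<subseteq> Ed' \<Longrightarrow> mg_conn Ed' ends u w"
  by (erule rtranclp_mono[THEN predicate2D, rotated]) (unfold mg_adj_def, blast)

text \<open>Repeated traversals of \<open>e\<close> can be shortcut, so at most one, in one of the
  two directions, is needed.\<close>

lemma mg_conn_insert_cases:
  assumes "mg_conn (insert e Ed) ends x y" "ends e = {u, w}"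
  shows "mg_conn Ed ends x y \<or> (mg_conn Ed ends x u \<and> mg_conn Ed ends w y) \<or>
    (mg_conn Ed ends x w \<and> mg_conn Ed ends u y)"
  using assms(1)
proof (induction rule: rtranclp_induct)
  case (step y z)
  from step.hyps(2) have "mg_adj Ed ends y z \<or> {y, z} = {u, w}" using assms(2) by (auto simp: mg_adj_def)
  then show ?case
  proof
    assume "mg_adj Ed ends y z"
    then show ?thesis using step.IH by (meson rtranclp.rtrancl_into_rtrancl)
  next
    assume "{y, z} = {u, w}"
    then have "y = u \<and> z = w \<or> y = w \<and> z = u" by (auto simp: doubleton_eq_iff)
    then show ?thesis using step.IH by auto
  qed
qed simp

lemma mg_conn_simple_path:
  assumes "mg_conn Ed ends u w" "u \<in> W" "mg_loopless W Ed ends"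
  shows "\<exists>vs es. length vs = Suc (length es) \<and> vs ! 0 = u \<and> vs ! length es = w \<and> distinct vs \<and>
     set vs \<subseteq> W \<and> set es \<subseteq> Ed \<and> (\<forall>i<length es. ends (es ! i) = {vs ! i, vs ! Suc i})"
  using assms(1)
proof (induction rule: rtranclp_induct)
  case base
  show ?case using assms(2) by (intro exI[of _ "[u]"] exI[of _ "[]"]) auto
next
  case (step y z)
  then obtain vs es where p: "length vs = Suc (length es)" "vs ! 0 = u" "vs ! length es = y" "distinct vs"
    "set vs \<subseteq> W" "set es \<subseteq> Ed" "\<forall>i<length es. ends (es ! i) = {vs ! i, vs ! Suc i}" by blast
  obtain e where e: "e \<in> Ed" "ends e = {y, z}" using step.hyps(2) by (auto simp: mg_adj_def)
  show ?case
  proof (cases "z \<in> set vs")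
    case True
    \<comment> \<open>When \<open>z\<close> was visited before, the path is cut back to that
      visit.\<close>
    then obtain k where k: "k < length vs" "vs ! k = z" by (auto simp: in_set_conv_nth)
    have "set (take (Suc k) vs) \<subseteq> W" "set (take k es) \<subseteq> Ed"
      using p(5,6) set_take_subset by (meson subset_trans)+
    then show ?thesis using p k
      by (intro exI[of _ "take (Suc k) vs"] exI[of _ "take k es"]) auto
  next
    case False
    have "ends e \<subseteq> W" using e(1) assms(3) unfolding mg_loopless_def by fastforce
    then have "z \<in> W" using e(2) by simp
    then show ?thesis using p e False
      by (intro exI[of _ "vs @ [z]"] exI[of _ "es @ [e]"]) (auto simp: nth_append less_Suc_eq)
  qed
qed

lemma mg_conn_closing_edge_cycle:
  assumes "mg_conn Ed ends u w" "e \<notin> Ed" "ends e = {u, w}" "mg_loopless W (insert e Ed) ends"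
  shows "\<exists>vs es. mg_cycle W (insert e Ed) ends vs es"
proof -
  have "u \<in> W" and ok: "mg_loopless W Ed ends" using assms(3,4) by (auto simp: mg_loopless_def)
  from mg_conn_simple_path[OF assms(1) this] obtain vs es where
    p: "length vs = Suc (length es)" "vs ! 0 = u" "vs ! length es = w" "distinct vs"
    "set vs \<subseteq> W" "set es \<subseteq> Ed" "\<And>i. i < length es \<Longrightarrow> ends (es ! i) = {vs ! i, vs ! Suc i}" by blast
  \<comment> \<open>A repeated edge would have the same end pair at two positions, impossible on
    distinct vertices.\<close>
  have "distinct es" unfolding distinct_conv_nth
  proof (intro allI impI notI)
    fix i j assume ij: "i < length es" "j < length es" "i \<noteq> j" "es ! i = es ! j"
    then have "{vs ! i, vs ! Suc i} = {vs ! j, vs ! Suc j}" using p(7) by metis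
    then have "i = j \<or> (i = Suc j \<and> Suc i = j)"
      using ij p(1,4) by (auto simp: doubleton_eq_iff nth_eq_iff_index_eq)
    then show False using ij by auto
  qed
  then have "distinct (es @ [e])" using p(6) assms(2) by auto
  moreover have "ends ((es @ [e]) ! i) = {vs ! i, vs ! ((i + 1) mod length vs)}" if "i < length (es @ [e])" for i
  proof (cases "i = length es")
    case True
    then show ?thesis using p assms(3) by (auto simp: nth_append)
  next
    case False
    then show ?thesis using that p by (auto simp: nth_append)
  qed
  ultimately have "mg_cycle W (insert e Ed) ends vs (es @ [e])"
    using p unfolding mg_cycle_def by auto
  then show ?thesis by blast
qed

lemma mg_cycle_mono:
  assumes "mg_cycle W Ed ends vs es" "W \<subseteq> W'" "Ed \<subseteq> Ed'"
  shows "mg_cycle W' Ed' ends vs es"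
  using assms unfolding mg_cycle_def by auto

text \<open>\<open>R\<close> has one vertex per component. A new edge either merges two components,
  and one representative is dropped, or closes a cycle, and the equality is no longer
  claimed.\<close>

lemma mg_component_representatives:
  assumes "finite Ed" "mg_loopless W Ed ends"
  shows "\<exists>R\<subseteq>W. (\<forall>w\<in>W. \<exists>r\<in>R. mg_conn Ed ends r w) \<and> (\<forall>r\<in>R. \<forall>r'\<in>R. mg_conn Ed ends r r' \<longrightarrow> r = r') \<and>
     card W \<le> card R + card Ed \<and> ((\<nexists>vs es. mg_cycle W Ed ends vs es) \<longrightarrow> card W = card R + card Ed)"
  using assms
proof (induction Ed rule: finite_induct)
  case empty
  have "\<not> mg_adj {} ends u w" for u w by (simp add: mg_adj_def)
  then have "mg_conn {} ends u w \<Longrightarrow> u = w" for u w by (meson converse_rtranclpE)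
  then show ?case by (intro exI[of _ W]) auto
next
  case (insert e Ed)
  have ok: "mg_loopless W Ed ends" "finite W" using insert.prems by (auto simp: mg_loopless_def)
  obtain R where R: "R \<subseteq> W" "\<And>w. w \<in> W \<Longrightarrow> \<exists>r\<in>R. mg_conn Ed ends r w"
    "\<And>r r'. r \<in> R \<Longrightarrow> r' \<in> R \<Longrightarrow> mg_conn Ed ends r r' \<Longrightarrow> r = r'" "card W \<le> card R + card Ed"
    "(\<nexists>vs es. mg_cycle W Ed ends vs es) \<longrightarrow> card W = card R + card Ed"
    using insert.IH[OF ok(1)] by blast
  have finR: "finite R" using R(1) ok(2) finite_subset by blast
  obtain u w where uw: "u \<in> W" "w \<in> W" "ends e = {u, w}" using insert.prems unfolding mg_loopless_def by blast
  have up: "mg_conn (insert e Ed) ends x y" if "mg_conn Ed ends x y" for x y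
    using mg_conn_mono[OF that] by blast
  show ?case
  proof (cases "mg_conn Ed ends u w")
    case True
    have down: "mg_conn Ed ends x y" if "mg_conn (insert e Ed) ends x y" for x y
      using mg_conn_insert_cases[OF that uw(3)] True mg_conn_sym[OF True] by (meson rtranclp_trans)
    have "\<exists>vs es. mg_cycle W (insert e Ed) ends vs es"
      using mg_conn_closing_edge_cycle[OF True insert.hyps(2) uw(3) insert.prems] .
    moreover have "card W \<le> card R + card (insert e Ed)" using R(4) insert.hyps by simp
    ultimately show ?thesis using R(1-3) up down by (intro exI[of _ R] conjI) blast+
  next
    case False
    obtain ru rw where r: "ru \<in> R" "mg_conn Ed ends ru u" "rw \<in> R" "mg_conn Ed ends rw w"
      using R(2) uw by blast
    have "ru \<noteq> rw" using r False mg_conn_sym by (meson rtranclp_trans)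
    have ru_w: "mg_conn (insert e Ed) ends ru w"
    proof -
      have "mg_adj (insert e Ed) ends u w" using uw(3) by (auto simp: mg_adj_def)
      then show ?thesis using up[OF r(2)] by (meson rtranclp.rtrancl_into_rtrancl)
    qed
    have "\<exists>r\<in>R - {rw}. mg_conn (insert e Ed) ends r x" if x: "x \<in> W" for x
    proof -
      obtain s where s: "s \<in> R" "mg_conn Ed ends s x" using R(2)[OF x] by blast
      show ?thesis
      proof (cases "s = rw")
        case True
        have "mg_conn (insert e Ed) ends w x"
          using mg_conn_sym[OF up[OF r(4)]] up[OF s(2)] True by (meson rtranclp_trans)
        then have "mg_conn (insert e Ed) ends ru x" using ru_w by (meson rtranclp_trans)
        then show ?thesis using r(1) \<open>ru \<noteq> rw\<close> by blast
      qed (use s up in blast)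
    qed
    moreover have "s = s'" if s: "s \<in> R - {rw}" "s' \<in> R - {rw}" "mg_conn (insert e Ed) ends s s'" for s s'
    proof -
      have no: "\<not> mg_conn Ed ends t w" if "t \<in> R - {rw}" for t
        using R(3)[of t rw] that r mg_conn_sym[OF r(4)] by (metis DiffE insertI1 rtranclp_trans)
      then have "\<not> mg_conn Ed ends w s'" using mg_conn_sym s(2) by metis
      then show ?thesis using mg_conn_insert_cases[OF s(3) uw(3)] no[OF s(1)] R(3) s by blast
    qed
    moreover have "card R = Suc (card (R - {rw}))" using card.remove[OF finR r(3)] .
    then have "card (R - {rw}) + card (insert e Ed) = card R + card Ed" using insert.hyps by simp
    moreover have "\<nexists>vs es. mg_cycle W Ed ends vs es" if "\<nexists>vs es. mg_cycle W (insert e Ed) ends vs es"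
      using that mg_cycle_mono[of W Ed ends _ _ W "insert e Ed"] by blast
    ultimately show ?thesis using R(1,4,5) by (intro exI[of _ "R - {rw}"]) auto
  qed
qed

lemma mg_forest_card:
  assumes "mg_loopless W Ed ends" "\<nexists>vs es. mg_cycle W Ed ends vs es" "W \<noteq> {}"
  shows "card Ed + 1 \<le> card W"
proof -
  have fin: "finite W" "finite Ed" using assms by (auto simp: mg_loopless_def)
  obtain R where R: "R \<subseteq> W" "\<forall>w\<in>W. \<exists>r\<in>R. mg_conn Ed ends r w" "card W = card R + card Ed"
    using mg_component_representatives[OF fin(2) assms(1)] assms(2) by blast
  then have "R \<noteq> {}" using assms(3) by blast
  then have "card R \<ge> 1" using R(1) fin by (metis One_nat_def Suc_leI card_gt_0_iff finite_subset)
  then show ?thesis using R by simp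
qed

lemma mg_connected_card:
  assumes "mg_loopless W Ed ends" "mg_connected W Ed ends"
  shows "card W \<le> card Ed + 1"
proof -
  have fin: "finite W" "finite Ed" using assms by (auto simp: mg_loopless_def)
  obtain R where R: "R \<subseteq> W" "\<And>r r'. r \<in> R \<Longrightarrow> r' \<in> R \<Longrightarrow> mg_conn Ed ends r r' \<Longrightarrow> r = r'" "card W \<le> card R + card Ed"
    using mg_component_representatives[OF fin(2) assms(1)] by blast
  have "\<And>r r'. r \<in> R \<Longrightarrow> r' \<in> R \<Longrightarrow> r = r'" using R(1,2) assms(2) unfolding mg_connected_def by blast
  then have "card R \<le> 1" using card_le_Suc0_iff_eq[of R] R(1) fin finite_subset[of R W] by auto
  then show ?thesis using R by simp
qed

text \<open>Reduces tree proofs to connectedness and a count, so cycles need not be inspected when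
  trees are modified.\<close>

lemma mg_tree_iff:
  assumes ok: "mg_loopless W Ed ends"
  shows "mg_tree W Ed ends \<longleftrightarrow> mg_connected W Ed ends \<and> card Ed + 1 = card W"
proof
  assume t: "mg_tree W Ed ends"
  then have c: "mg_connected W Ed ends" "W \<noteq> {}" by (auto simp: mg_tree_def mg_connected_def)
  have "card Ed + 1 \<le> card W" using mg_forest_card[OF ok _ c(2)] t by (simp add: mg_tree_def)
  then show "mg_connected W Ed ends \<and> card Ed + 1 = card W" using mg_connected_card[OF ok c(1)] c by simp
next
  assume c: "mg_connected W Ed ends \<and> card Ed + 1 = card W"
  have fin: "finite W" "finite Ed" using ok by (auto simp: mg_loopless_def)
  have "\<not> mg_cycle W Ed ends vs es" for vs es
  proof
    assume cyc: "mg_cycle W Ed ends vs es"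
    then obtain k where k: "length vs = Suc k" "length es = Suc k" by (auto simp: mg_cycle_def gr0_conv_Suc Suc_le_eq)
    \<comment> \<open>The closing edge of the cycle: the remaining edges still connect its ends, so
      deleting it keeps the graph connected with too few edges.\<close>
    define e0 where "e0 = es ! k"
    let ?E = "Ed - {e0}"
    have d: "distinct es" "set es \<subseteq> Ed" and ends: "\<And>i. i < Suc k \<Longrightarrow> ends (es ! i) = {vs ! i, vs ! ((i + 1) mod Suc k)}"
      using cyc k unfolding mg_cycle_def by auto
    have e0: "e0 \<in> Ed" using d k by (auto simp: e0_def)
    have path: "mg_conn ?E ends (vs ! 0) (vs ! i)" if "i \<le> k" for i
      using that
    proof (induction i)
      case (Suc i)
      then have "es ! i \<noteq> e0" using d(1) k by (simp add: e0_def nth_eq_iff_index_eq)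
      then have "es ! i \<in> ?E" using d(2) k Suc by auto
      moreover have "ends (es ! i) = {vs ! i, vs ! Suc i}" using ends[of i] Suc by simp
      ultimately have "mg_adj ?E ends (vs ! i) (vs ! Suc i)" by (auto simp: mg_adj_def)
      then show ?case using Suc by (meson Suc_leD rtranclp.rtrancl_into_rtrancl)
    qed simp
    have ends0: "ends e0 = {vs ! 0, vs ! k}" using ends[of k] by (auto simp: e0_def)
    have eq: "insert e0 ?E = Ed" using e0 by auto
    have "mg_conn ?E ends u w" if "mg_conn Ed ends u w" for u w
      using mg_conn_insert_cases[of e0 ?E ends u w, OF _ ends0] that path[of k] mg_conn_sym[OF path[of k]]
      unfolding eq by (meson le_refl rtranclp_trans)
    then have "mg_connected W ?E ends" using c unfolding mg_connected_def by blast
    moreover have "mg_loopless W ?E ends" using ok by (auto simp: mg_loopless_def)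
    ultimately have "card W \<le> card ?E + 1" using mg_connected_card by blast
    moreover have "card Ed = Suc (card ?E)" using card.remove[OF fin(2) e0] .
    ultimately show False using c by simp
  qed
  moreover have "\<forall>e\<in>Ed. ends e \<subseteq> W" using ok unfolding mg_loopless_def by fastforce
  ultimately show "mg_tree W Ed ends" using c fin unfolding mg_tree_def by blast
qed

section \<open>Least common ancestors in binary trees\<close>

abbreviation leaves :: "btree \<Rightarrow> nat set" where
  "leaves T \<equiv> set (leaf_list T)"

text \<open>Recursive counterpart of \<open>clade_of\<close>, descending while \<open>S\<close>
  stays on one side. The value at a leaf is a mere default, as leaves are not clades here; two
  distinct leaves of the tree never lead to it.\<close>

fun lca :: "btree \<Rightarrow> nat set \<Rightarrow> nat set" where
  "lca (Leaf i) S = {i}"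
| "lca (Node l r) S = (if S \<subseteq> leaves l then lca l S else if S \<subseteq> leaves r then lca r S else leaves l \<union> leaves r)"

lemma leaf_list_nonempty [simp]: "leaf_list T \<noteq> []"
  by (induction T) auto

lemma finite_clades: "finite (clades T)"
  by (induction T) auto

lemma clades_subset_leaves: "C \<in> clades T \<Longrightarrow> C \<subseteq> leaves T"
  by (induction T) auto

lemma clades_nonempty: "C \<in> clades T \<Longrightarrow> C \<noteq> {}"
  by (induction T) auto

text \<open>Distinct leaves make the clades of different internal vertices different: those in the
  two subtrees are disjoint and nonempty, and the root clade strictly contains them.\<close>

lemma card_clades:
  assumes "distinct (leaf_list T)"
  shows "card (clades T) + 1 = card (leaves T)"
  using assms
proof (induction T)
  case (Node l r)
  have d: "leaves l \<inter> leaves r = {}" using Node.prems by simp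
  have "clades l \<inter> clades r = {}"
  proof (rule equals0I)
    fix C assume C: "C \<in> clades l \<inter> clades r"
    then have "C \<subseteq> leaves l \<inter> leaves r" using clades_subset_leaves by auto
    then show False using d clades_nonempty[of C l] C by simp
  qed
  moreover have "leaves l \<union> leaves r \<notin> clades l \<union> clades r"
  proof
    assume "leaves l \<union> leaves r \<in> clades l \<union> clades r"
    then have "leaves r \<subseteq> leaves l \<or> leaves l \<subseteq> leaves r" using clades_subset_leaves by blast
    then have "leaves l = {} \<or> leaves r = {}" by (metis d inf.absorb1 inf.absorb2)
    then show False by simp
  qed
  ultimately have "card (clades (Node l r)) = Suc (card (clades l) + card (clades r))"
    by (simp add: card_Un_disjoint finite_clades)
  moreover have "card (leaves (Node l r)) = card (leaves l) + card (leaves r)"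
    using d by (simp add: card_Un_disjoint)
  ultimately show ?case using Node by simp
qed simp

lemma lca_least_clade:
  assumes "distinct (leaf_list T)" "a \<in> leaves T" "b \<in> leaves T" "a \<noteq> b"
  shows "lca T {a, b} \<in> clades T \<and> {a, b} \<subseteq> lca T {a, b} \<and> (\<forall>C\<in>clades T. {a, b} \<subseteq> C \<longrightarrow> lca T {a, b} \<subseteq> C)"
  using assms
proof (induction T)
  case (Node l r)
  have d: "leaves l \<inter> leaves r = {}" "distinct (leaf_list l)" "distinct (leaf_list r)" using Node.prems by auto
  note cl = clades_subset_leaves[of _ l] clades_subset_leaves[of _ r]
  consider "{a, b} \<subseteq> leaves l" | "{a, b} \<subseteq> leaves r" "\<not> {a, b} \<subseteq> leaves l"
    | "\<not> {a, b} \<subseteq> leaves l" "\<not> {a, b} \<subseteq> leaves r" by blast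
  then show ?case
  proof cases
    case 1
    then have IH: "lca l {a, b} \<in> clades l" "{a, b} \<subseteq> lca l {a, b}" "\<And>C. C \<in> clades l \<Longrightarrow> {a, b} \<subseteq> C \<Longrightarrow> lca l {a, b} \<subseteq> C"
      using Node.IH(1) d Node.prems(4) by auto
    have eq: "lca (Node l r) {a, b} = lca l {a, b}" using 1 by simp
    have "\<not> {a, b} \<subseteq> C" if "C \<in> clades r" for C using 1 d(1) cl(2)[OF that] by blast
    then show ?thesis unfolding eq using IH cl(1)[OF IH(1)] by auto
  next
    case 2
    then have IH: "lca r {a, b} \<in> clades r" "{a, b} \<subseteq> lca r {a, b}" "\<And>C. C \<in> clades r \<Longrightarrow> {a, b} \<subseteq> C \<Longrightarrow> lca r {a, b} \<subseteq> C"
      using Node.IH(2) d Node.prems(4) by auto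
    have eq: "lca (Node l r) {a, b} = lca r {a, b}" using 2 by (simp del: insert_subset)
    have "\<not> {a, b} \<subseteq> C" if "C \<in> clades l" for C using 2 d(1) cl(1)[OF that] by blast
    then show ?thesis unfolding eq using IH cl(2)[OF IH(1)] by auto
  next
    case 3
    then have eq: "lca (Node l r) {a, b} = leaves l \<union> leaves r" by (simp del: insert_subset)
    have "\<not> {a, b} \<subseteq> C" if "C \<in> clades l \<union> clades r" for C using 3 cl that by blast
    then show ?thesis unfolding eq using Node.prems by auto
  qed
qed auto

lemma clade_of_eq_lca:
  assumes "distinct (leaf_list T)" "a \<in> leaves T" "b \<in> leaves T" "a \<noteq> b"
  shows "clade_of T {a, b} = lca T {a, b}"
  unfolding clade_of_def using lca_least_clade[OF assms] by (intro the_equality) blast+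

lemma clade_of_in_clades:
  assumes "binary_tree_on T V" "a \<in> V" "b \<in> V" "a \<noteq> b"
  shows "clade_of T {a, b} \<in> clades T"
  using lca_least_clade[of T a b] clade_of_eq_lca[of T a b] assms unfolding binary_tree_on_def by metis

definition lcas :: "btree \<Rightarrow> nat set \<Rightarrow> nat set set" where
  "lcas T S = (\<lambda>(i, j). lca T {i, j}) ` {z \<in> S \<times> S. fst z \<noteq> snd z}"

lemma finite_lcas: "finite S \<Longrightarrow> finite (lcas T S)"
  by (simp add: lcas_def)

lemma lcasI: "i \<in> S \<Longrightarrow> j \<in> S \<Longrightarrow> i \<noteq> j \<Longrightarrow> lca T {i, j} \<in> lcas T S"
  by (force simp: lcas_def)

lemma lcasE:
  assumes "C \<in> lcas T S"
  obtains i j where "i \<in> S" "j \<in> S" "i \<noteq> j" "C = lca T {i, j}"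
  using assms by (auto simp: lcas_def)

text \<open>The root contributes a clade only when \<open>S\<close> meets both subtrees; then the
  two bounds add up with exactly this one extra clade. Otherwise one subtree accounts for
  everything.\<close>

lemma card_lcas:
  assumes "distinct (leaf_list T)" "S \<subseteq> leaves T" "S \<noteq> {}"
  shows "card (lcas T S) + 1 \<le> card S"
  using assms
proof (induction T arbitrary: S)
  case (Leaf i)
  then have "S = {i}" by auto
  then show ?case by (auto simp: lcas_def)
next
  case (Node l r)
  have d: "leaves l \<inter> leaves r = {}" "distinct (leaf_list l)" "distinct (leaf_list r)" using Node.prems by auto
  define A B where "A = S \<inter> leaves l" and "B = S \<inter> leaves r"
  have S: "S = A \<union> B" "A \<inter> B = {}" "A \<subseteq> leaves l" "B \<subseteq> leaves r" "finite A" "finite B"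
    using Node.prems d by (auto simp: A_def B_def)
  have l: "lca (Node l r) {i, j} = lca l {i, j}" if "i \<in> A" "j \<in> A" for i j using that S by auto
  have r: "lca (Node l r) {i, j} = lca r {i, j}" if "i \<in> B" "j \<in> B" for i j using that S d(1) by auto
  show ?case
  proof (cases "A = {} \<or> B = {}")
    case True
    then show ?thesis
    proof
      assume "A = {}"
      then have "S = B" using S(1) by simp
      moreover from this have "lcas (Node l r) S = lcas r S"
        unfolding lcas_def by (intro image_cong) (auto simp del: lca.simps simp: r)
      ultimately show ?thesis using Node.IH(2)[of S] d S(4) Node.prems(3) by simp
    next
      assume "B = {}"
      then have "S = A" using S(1) by simp
      moreover from this have "lcas (Node l r) S = lcas l S"
        unfolding lcas_def by (intro image_cong) (auto simp del: lca.simps simp: l)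
      ultimately show ?thesis using Node.IH(1)[of S] d S(3) Node.prems(3) by simp
    qed
  next
    case False
    have "lcas (Node l r) S \<subseteq> insert (leaves l \<union> leaves r) (lcas l A \<union> lcas r B)"
    proof
      fix C assume "C \<in> lcas (Node l r) S"
      then obtain i j where ij: "i \<in> S" "j \<in> S" "i \<noteq> j" "C = lca (Node l r) {i, j}" by (rule lcasE)
      show "C \<in> insert (leaves l \<union> leaves r) (lcas l A \<union> lcas r B)"
      proof (cases "(i \<in> A \<and> j \<in> A) \<or> (i \<in> B \<and> j \<in> B)")
        case True
        then show ?thesis using l r ij(3,4) lcasI by fastforce
      next
        case False
        then have "\<not> {i, j} \<subseteq> leaves l" "\<not> {i, j} \<subseteq> leaves r" using ij by (auto simp: A_def B_def)
        then show ?thesis using ij(4) by (simp del: insert_subset)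
      qed
    qed
    then have "card (lcas (Node l r) S) \<le> card (insert (leaves l \<union> leaves r) (lcas l A \<union> lcas r B))"
      using finite_lcas S by (intro card_mono) auto
    also have "\<dots> \<le> Suc (card (lcas l A \<union> lcas r B))" by (rule card_insert_le_m1) auto
    also have "\<dots> \<le> Suc (card (lcas l A) + card (lcas r B))" using card_Un_le by simp
    finally have "card (lcas (Node l r) S) \<le> Suc (card (lcas l A) + card (lcas r B))" .
    moreover have "card S = card A + card B" using S by (simp add: card_Un_disjoint)
    ultimately show ?thesis using Node.IH(1)[of A] Node.IH(2)[of B] d S False by auto
  qed
qed

section \<open>Size and sparsity of the restricted clade graph\<close>

lemma clade_graph_loopless:
  assumes "simple_graph V E" "binary_tree_on T1 V" "binary_tree_on T2 V"
  shows "mg_loopless (clade_graph_vertices T1 T2) E (clade_graph_ends T1 T2)"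
proof -
  have T: "distinct (leaf_list T1)" "leaves T1 = V" "distinct (leaf_list T2)" "leaves T2 = V"
    using assms by (auto simp: binary_tree_on_def)
  have "finite V" using T(2) by (metis List.finite_set)
  moreover have "\<exists>u\<in>clade_graph_vertices T1 T2. \<exists>w\<in>clade_graph_vertices T1 T2. u \<noteq> w \<and> clade_graph_ends T1 T2 e = {u, w}"
    if eE: "e \<in> E" for e
  proof -
    obtain a b where e: "e = {a, b}" "a \<noteq> b" "a \<in> V" "b \<in> V" by (rule simple_graphE[OF assms(1) eE])
    have "clade_of T1 e \<in> clades T1" "clade_of T2 e \<in> clades T2"
      using clade_of_in_clades assms(2,3) e by auto
    then show ?thesis unfolding clade_graph_vertices_def clade_graph_ends_def by blast
  qed
  ultimately show ?thesis
    using simple_graph_finite[OF assms(1)] by (simp add: mg_loopless_def clade_graph_vertices_def finite_clades)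
qed

lemma card_clade_graph_vertices:
  assumes "binary_tree_on T1 V" "binary_tree_on T2 V"
  shows "card (clade_graph_vertices T1 T2) + 2 = 2 * card V"
proof -
  have "card (clade_graph_vertices T1 T2) = card (clades T1) + card (clades T2)"
    unfolding clade_graph_vertices_def
    by (subst card_Un_disjoint) (auto simp: finite_clades card_image)
  moreover have "card (clades T1) + 1 = card V" "card (clades T2) + 1 = card V"
    using card_clades[of T1] card_clades[of T2] assms by (auto simp: binary_tree_on_def)
  ultimately show ?thesis by simp
qed

lemma clade_tree_imp_laman:
  assumes G: "simple_graph V E" and T: "binary_tree_on T1 V" "binary_tree_on T2 V"
    and tree: "restricted_clade_graph_is_tree E T1 T2"
  shows "laman V E"
  unfolding laman_def
proof (intro conjI allI impI)
  have T': "distinct (leaf_list T1)" "leaves T1 = V" "distinct (leaf_list T2)" "leaves T2 = V"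
    using T by (auto simp: binary_tree_on_def)
  show finV: "finite V" using T'(2) by (metis List.finite_set)
  let ?W = "clade_graph_vertices T1 T2" and ?ends = "clade_graph_ends T1 T2"
  note ok = clade_graph_loopless[OF G T]
  have "card E + 1 = card ?W" using tree mg_tree_iff[OF ok] unfolding restricted_clade_graph_is_tree_def by blast
  then show "card E = 2 * card V - 3" using card_clade_graph_vertices[OF T] by linarith
  fix S F assume SF: "S \<subseteq> V \<and> F \<subseteq> E \<and> (\<forall>e\<in>F. e \<subseteq> S) \<and> 2 \<le> card S"
  show "card F \<le> 2 * card S - 3"
  proof (cases "F = {}")
    case False
    define W where "W = Inl ` lcas T1 S \<union> Inr ` lcas T2 S"
    have finS: "finite S" using SF finV finite_subset by blast
    have ends: "\<exists>u\<in>W. \<exists>w\<in>W. u \<noteq> w \<and> ?ends e = {u, w}" if "e \<in> F" for e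
    proof -
      have "e \<in> E" using that SF by blast
      then obtain a b where e: "e = {a, b}" "a \<noteq> b" "a \<in> V" "b \<in> V" by (rule simple_graphE[OF G])
      have ab: "a \<in> S" "b \<in> S" using that SF e by auto
      have "clade_of T1 e \<in> lcas T1 S" "clade_of T2 e \<in> lcas T2 S"
        using clade_of_eq_lca[of T1 a b] clade_of_eq_lca[of T2 a b] e T' ab by (auto intro: lcasI)
      then show ?thesis unfolding W_def clade_graph_ends_def by blast
    qed
    have "finite F" using SF ok finite_subset by (auto simp: mg_loopless_def)
    then have okW: "mg_loopless W F ?ends" using ends finS finite_lcas by (simp add: mg_loopless_def W_def)
    have "W \<noteq> {}" using ends False by blast
    have "lca T {i, j} \<in> clades T" if "distinct (leaf_list T)" "leaves T = V" "i \<in> S" "j \<in> S" "i \<noteq> j" for T i j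
      using lca_least_clade[of T i j] that SF by blast
    then have WW: "W \<subseteq> ?W" using T' unfolding W_def clade_graph_vertices_def by (auto elim!: lcasE)
    have "\<nexists>vs es. mg_cycle ?W E ?ends vs es"
      using tree by (simp add: restricted_clade_graph_is_tree_def mg_tree_def)
    then have "\<nexists>vs es. mg_cycle W F ?ends vs es" using mg_cycle_mono[OF _ WW, of F ?ends _ _ E] SF by blast
    from mg_forest_card[OF okW this \<open>W \<noteq> {}\<close>] have "card F + 1 \<le> card W" .
    also have "card W = card (lcas T1 S) + card (lcas T2 S)"
      unfolding W_def using finite_lcas[OF finS] by (subst card_Un_disjoint) (auto simp: card_image)
    finally show ?thesis
      using card_lcas[OF T'(1), of S] card_lcas[OF T'(3), of S] T' SF finS by fastforce
  qed simp
qed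

section \<open>Attaching a leaf\<close>

fun attach :: "nat \<Rightarrow> nat \<Rightarrow> btree \<Rightarrow> btree" where
  "attach x v (Leaf i) = (if i = x then Node (Leaf x) (Leaf v) else Leaf i)"
| "attach x v (Node l r) = Node (attach x v l) (attach x v r)"

text \<open>The effect of \<open>attach\<close> on an old clade: \<open>v\<close> joins it exactly
  when its neighbour \<open>x\<close> is there.\<close>

definition attach_clade :: "nat \<Rightarrow> nat \<Rightarrow> nat set \<Rightarrow> nat set" where
  "attach_clade x v C = (if x \<in> C then insert v C else C)"

lemma leaves_attach: "leaves (attach x v T) = attach_clade x v (leaves T)"
  by (induction T) (auto simp: attach_clade_def)

lemma attach_id: "x \<notin> leaves T \<Longrightarrow> attach x v T = T"
  by (induction T) auto

lemma distinct_attach: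
  assumes "distinct (leaf_list T)" "v \<notin> leaves T"
  shows "distinct (leaf_list (attach x v T))"
  using assms by (induction T) (auto simp: leaves_attach attach_clade_def)

lemma clades_attach:
  assumes "distinct (leaf_list T)" "x \<in> leaves T"
  shows "clades (attach x v T) = insert {x, v} (attach_clade x v ` clades T)"
  using assms
proof (induction T)
  case (Node l r)
  have id: "attach_clade x v ` clades T = clades T" if "x \<notin> leaves T" for T
    using clades_subset_leaves[of _ T] that by (force simp: attach_clade_def image_iff)
  have top: "attach_clade x v (leaves l) \<union> attach_clade x v (leaves r) = attach_clade x v (leaves l \<union> leaves r)"
    by (auto simp: attach_clade_def)
  show ?case
  proof (cases "x \<in> leaves l")
    case True
    then have "x \<notin> leaves r" using Node.prems by auto
    moreover from this have "attach_clade x v (leaves r) = leaves r" by (simp add: attach_clade_def)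
    ultimately show ?thesis
      using Node True id[of r] by (simp add: leaves_attach attach_id image_Un insert_commute top[symmetric])
  next
    case False
    then have "x \<in> leaves r" "attach_clade x v (leaves l) = leaves l"
      using Node.prems by (auto simp: attach_clade_def)
    then show ?thesis
      using Node False id[of l] by (simp add: leaves_attach attach_id image_Un insert_commute top[symmetric])
  qed
qed auto

lemma lca_attach_old:
  assumes "{a, b} \<subseteq> leaves T" "v \<notin> leaves T" "a \<noteq> b"
  shows "lca (attach x v T) {a, b} = attach_clade x v (lca T {a, b})"
  using assms
proof (induction T)
  case (Node l r)
  have "a \<noteq> v" "b \<noteq> v" using Node.prems by auto
  then have "{a, b} \<subseteq> leaves (attach x v T) \<longleftrightarrow> {a, b} \<subseteq> leaves T" for T
    by (auto simp: leaves_attach attach_clade_def)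
  moreover have "attach_clade x v (leaves l) \<union> attach_clade x v (leaves r) = attach_clade x v (leaves l \<union> leaves r)"
    by (auto simp: attach_clade_def)
  ultimately show ?case using Node by (auto simp: leaves_attach)
qed auto

text \<open>Seen from any leaf other than \<open>x\<close>, the new leaf \<open>v\<close> sits where
  \<open>x\<close> does.\<close>

lemma lca_attach_new:
  assumes "x \<in> leaves T" "b \<in> leaves T" "v \<notin> leaves T" "b \<noteq> x" "distinct (leaf_list T)"
  shows "lca (attach x v T) {v, b} = attach_clade x v (lca T {x, b})"
  using assms
proof (induction T)
  case (Node l r)
  have "b \<noteq> v" using Node.prems by auto
  then have "{v, b} \<subseteq> leaves (attach x v T) \<longleftrightarrow> {x, b} \<subseteq> leaves T" if "v \<notin> leaves T" for T
    using that by (auto simp: leaves_attach attach_clade_def)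
  moreover have "attach_clade x v (leaves l) \<union> attach_clade x v (leaves r) = attach_clade x v (leaves l \<union> leaves r)"
    by (auto simp: attach_clade_def)
  ultimately show ?case using Node by (auto simp: leaves_attach)
qed auto

lemma lca_attach_cherry:
  assumes "x \<in> leaves T" "v \<notin> leaves T" "distinct (leaf_list T)"
  shows "lca (attach x v T) {v, x} = {x, v}"
  using assms
proof (induction T)
  case (Node l r)
  have "{v, x} \<subseteq> leaves (attach x v T) \<longleftrightarrow> x \<in> leaves T" if "v \<notin> leaves T" for T
    using that by (auto simp: leaves_attach attach_clade_def)
  then show ?case using Node by auto
qed auto

lemma binary_tree_on_attach:
  assumes "binary_tree_on T V" "v \<notin> V" "x \<in> V"
  shows "binary_tree_on (attach x v T) (insert v V)"
  using assms distinct_attach[of T v x] by (auto simp: binary_tree_on_def leaves_attach attach_clade_def)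

text \<open>Places the old clade graph inside the new one; besides its image there are only the two
  cherry clades.\<close>

fun attach_vertex :: "nat \<Rightarrow> nat \<Rightarrow> nat \<Rightarrow> nat set + nat set \<Rightarrow> nat set + nat set" where
  "attach_vertex x y v (Inl C) = Inl (attach_clade x v C)"
| "attach_vertex x y v (Inr C) = Inr (attach_clade y v C)"

context
  fixes T1 T2 :: btree and V :: "nat set" and x y v :: nat
  assumes T1: "binary_tree_on T1 V" and T2: "binary_tree_on T2 V"
    and xy: "x \<in> V" "y \<in> V" "x \<noteq> y" and v: "v \<notin> V"
begin

lemma clade_graph_vertices_attach:
  "clade_graph_vertices (attach x v T1) (attach y v T2) =
     attach_vertex x y v ` clade_graph_vertices T1 T2 \<union> {Inl {x, v}, Inr {y, v}}"
  using T1 T2 xy by (simp add: clade_graph_vertices_def clades_attach binary_tree_on_def image_Un image_image Un_ac insert_commute)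

lemma clade_graph_ends_attach:
  assumes "a \<in> V" "b \<in> V" "a \<noteq> b"
  shows "clade_graph_ends (attach x v T1) (attach y v T2) {a, b} = attach_vertex x y v ` clade_graph_ends T1 T2 {a, b}"
  using assms T1 T2 xy v binary_tree_on_attach[OF T1 v xy(1)] binary_tree_on_attach[OF T2 v xy(2)]
  by (simp add: clade_graph_ends_def clade_of_eq_lca binary_tree_on_def lca_attach_old)

text \<open>In the second tree \<open>v\<close> sits beside \<open>y\<close>, so this edge hangs the
  new clade \<open>{x, v}\<close> onto an old vertex. This is where distinct attaching leaves
  matter.\<close>

lemma clade_graph_ends_attach_x:
  "clade_graph_ends (attach x v T1) (attach y v T2) {v, x} =
     {Inl {x, v}, attach_vertex x y v (Inr (clade_of T2 {x, y}))}"
proof -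
  have "v \<noteq> x" using xy v by auto
  then show ?thesis
    using T1 T2 xy v binary_tree_on_attach[OF T1 v xy(1)] binary_tree_on_attach[OF T2 v xy(2)]
    by (simp add: clade_graph_ends_def clade_of_eq_lca binary_tree_on_def lca_attach_cherry lca_attach_new insert_commute)
qed

lemma clade_graph_ends_attach_y:
  "clade_graph_ends (attach x v T1) (attach y v T2) {v, y} =
     {attach_vertex x y v (Inl (clade_of T1 {x, y})), Inr {y, v}}"
proof -
  have "v \<noteq> y" using xy v by auto
  then show ?thesis
    using T1 T2 xy v binary_tree_on_attach[OF T1 v xy(1)] binary_tree_on_attach[OF T2 v xy(2)]
    by (simp add: clade_graph_ends_def clade_of_eq_lca binary_tree_on_def lca_attach_cherry lca_attach_new insert_commute)
qed

text \<open>Both ends are old vertices, which makes this edge the one able to replace a deleted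
  edge.\<close>

lemma clade_graph_ends_attach_z:
  assumes "z \<in> V" "z \<noteq> x" "z \<noteq> y"
  shows "clade_graph_ends (attach x v T1) (attach y v T2) {v, z} =
     {attach_vertex x y v (Inl (clade_of T1 {x, z})), attach_vertex x y v (Inr (clade_of T2 {y, z}))}"
proof -
  have "v \<noteq> z" using assms v by auto
  then show ?thesis
    using assms T1 T2 xy v binary_tree_on_attach[OF T1 v xy(1)] binary_tree_on_attach[OF T2 v xy(2)]
    by (simp add: clade_graph_ends_def clade_of_eq_lca binary_tree_on_def lca_attach_new)
qed

lemma clade_of_in_clade_graph_vertices:
  assumes "a \<in> V" "b \<in> V" "a \<noteq> b"
  shows "Inl (clade_of T1 {a, b}) \<in> clade_graph_vertices T1 T2" "Inr (clade_of T2 {a, b}) \<in> clade_graph_vertices T1 T2"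
  using clade_of_in_clades[OF T1 assms] clade_of_in_clades[OF T2 assms] by (auto simp: clade_graph_vertices_def)

lemma mg_conn_attach:
  assumes G: "simple_graph V E0" and sub: "E0 \<subseteq> E'" and c: "mg_conn E0 (clade_graph_ends T1 T2) s t"
  shows "mg_conn E' (clade_graph_ends (attach x v T1) (attach y v T2)) (attach_vertex x y v s) (attach_vertex x y v t)"
  using c
proof (induction rule: rtranclp_induct)
  case (step t t')
  then obtain e where e: "e \<in> E0" "clade_graph_ends T1 T2 e = {t, t'}" by (auto simp: mg_adj_def)
  obtain a b where "e = {a, b}" "a \<noteq> b" "a \<in> V" "b \<in> V" by (rule simple_graphE[OF G e(1)])
  then have "clade_graph_ends (attach x v T1) (attach y v T2) e = {attach_vertex x y v t, attach_vertex x y v t'}"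
    using clade_graph_ends_attach[of a b] e(2) by simp
  then have "mg_adj E' (clade_graph_ends (attach x v T1) (attach y v T2)) (attach_vertex x y v t) (attach_vertex x y v t')"
    using e(1) sub by (auto simp: mg_adj_def)
  then show ?case using step.IH by (meson rtranclp.rtrancl_into_rtrancl)
qed simp

text \<open>The edges \<open>vx\<close> and \<open>vy\<close> hang the cherry clades onto old
  vertices, so only connectivity among old vertices is left to assume; the edge count does the
  rest.\<close>

lemma clade_tree_attach:
  assumes G: "simple_graph (insert v V) E'" and E': "{{v, x}, {v, y}} \<subseteq> E'" and card: "card E' + 1 = 2 * card V"
    and hub: "\<And>s. s \<in> clade_graph_vertices T1 T2 \<Longrightarrow>
      mg_conn E' (clade_graph_ends (attach x v T1) (attach y v T2)) (attach_vertex x y v base) (attach_vertex x y v s)"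
  shows "restricted_clade_graph_is_tree E' (attach x v T1) (attach y v T2)"
proof -
  let ?W = "clade_graph_vertices (attach x v T1) (attach y v T2)"
  let ?ends = "clade_graph_ends (attach x v T1) (attach y v T2)"
  let ?base = "attach_vertex x y v base"
  note B = binary_tree_on_attach[OF T1 v xy(1)] binary_tree_on_attach[OF T2 v xy(2)]
  have ok: "mg_loopless ?W E' ?ends" by (rule clade_graph_loopless[OF G B])
  have "mg_adj E' ?ends (attach_vertex x y v (Inr (clade_of T2 {x, y}))) (Inl {x, v})"
    "mg_adj E' ?ends (attach_vertex x y v (Inl (clade_of T1 {x, y}))) (Inr {y, v})"
    using clade_graph_ends_attach_x clade_graph_ends_attach_y E' unfolding mg_adj_def by (auto simp: insert_commute)
  then have "mg_conn E' ?ends ?base (Inl {x, v})" "mg_conn E' ?ends ?base (Inr {y, v})"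
    using hub[OF clade_of_in_clade_graph_vertices(2)[OF xy]] hub[OF clade_of_in_clade_graph_vertices(1)[OF xy]]
    by (meson rtranclp.rtrancl_into_rtrancl)+
  then have all: "mg_conn E' ?ends ?base s" if "s \<in> ?W" for s
    using that hub unfolding clade_graph_vertices_attach by blast
  have "mg_connected ?W E' ?ends" unfolding mg_connected_def
  proof (intro conjI ballI)
    show "?W \<noteq> {}" unfolding clade_graph_vertices_attach by simp
    fix s t assume "s \<in> ?W" "t \<in> ?W"
    then show "mg_conn E' ?ends s t" using all mg_conn_sym by (meson rtranclp_trans)
  qed
  moreover have "finite V" using T1 by (metis List.finite_set binary_tree_on_def)
  then have "card E' + 1 = card ?W" using card_clade_graph_vertices[OF B] card v by simp
  ultimately show ?thesis using mg_tree_iff[OF ok] unfolding restricted_clade_graph_is_tree_def by blast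
qed

end

section \<open>Henneberg moves on pairs of trees\<close>

lemma henneberg_imp_clade_trees:
  fixes V :: "nat set"
  assumes "henneberg V E"
  shows "\<exists>T1 T2. binary_tree_on T1 V \<and> binary_tree_on T2 V \<and> restricted_clade_graph_is_tree E T1 T2"
  using assms
proof (induction rule: henneberg.induct)
  case (K2 a b)
  let ?T = "Node (Leaf a) (Leaf b)"
  have B: "binary_tree_on ?T {a, b}" using K2 by (auto simp: binary_tree_on_def)
  have G: "simple_graph {a, b} {{a, b}}" using K2 by (auto simp: simple_graph_def)
  have W: "clade_graph_vertices ?T ?T = {Inl {a, b}, Inr {a, b}}" by (auto simp: clade_graph_vertices_def)
  have "clade_graph_ends ?T ?T {a, b} = {Inl {a, b}, Inr {a, b}}"
    using K2 by (simp add: clade_graph_ends_def clade_of_eq_lca insert_commute)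
  then have "mg_adj {{a, b}} (clade_graph_ends ?T ?T) (Inl {a, b}) (Inr {a, b})" by (simp add: mg_adj_def)
  then have c: "mg_conn {{a, b}} (clade_graph_ends ?T ?T) (Inl {a, b}) (Inr {a, b})" by (rule r_into_rtranclp)
  have "mg_connected (clade_graph_vertices ?T ?T) {{a, b}} (clade_graph_ends ?T ?T)"
    unfolding W mg_connected_def using c mg_conn_sym[OF c] by simp
  then have "restricted_clade_graph_is_tree {{a, b}} ?T ?T"
    unfolding restricted_clade_graph_is_tree_def mg_tree_iff[OF clade_graph_loopless[OF G B B]] by (simp add: W)
  then show ?case using B by blast
next
  case (move1 V E v a b)
  then obtain T1 T2 where T: "binary_tree_on T1 V" "binary_tree_on T2 V" "restricted_clade_graph_is_tree E T1 T2" by blast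
  let ?E = "E \<union> {{v, a}, {v, b}}"
  note G = henneberg_graph[OF move1(1)] henneberg_graph[OF henneberg.move1[OF move1(1-5)]]
  have tree: "mg_connected (clade_graph_vertices T1 T2) E (clade_graph_ends T1 T2)" "card E + 1 = card (clade_graph_vertices T1 T2)"
    using T(3) mg_tree_iff[OF clade_graph_loopless[of V E T1 T2]] G T unfolding restricted_clade_graph_is_tree_def by auto
  have fresh: "e \<subseteq> V" if "e \<in> E" for e using simple_graph_edge_subset[of V E e] G that by blast
  have "finite E" using simple_graph_finite G by blast
  moreover have "{v, a} \<notin> E" "{v, b} \<notin> E" using fresh move1(2) by blast+
  moreover have "{v, a} \<noteq> {v, b}" using move1 by (auto simp: doubleton_eq_iff)
  ultimately have "card ?E = card E + 2" by simp
  then have card: "card ?E + 1 = 2 * card V" using tree(2) card_clade_graph_vertices[OF T(1,2)] by simp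
  have "restricted_clade_graph_is_tree ?E (attach a v T1) (attach b v T2)"
  proof (rule clade_tree_attach[OF T(1,2) move1(3,4,5,2) _ _ card, where base = "Inl (clade_of T1 {a, b})"])
    fix s assume s: "s \<in> clade_graph_vertices T1 T2"
    have "mg_conn E (clade_graph_ends T1 T2) (Inl (clade_of T1 {a, b})) s"
      using tree(1) s clade_of_in_clade_graph_vertices(1)[OF T(1,2) move1(3,4,5,2), of a b] move1 unfolding mg_connected_def by blast
    then show "mg_conn ?E (clade_graph_ends (attach a v T1) (attach b v T2))
      (attach_vertex a b v (Inl (clade_of T1 {a, b}))) (attach_vertex a b v s)"
      using G by (intro mg_conn_attach[OF T(1,2) move1(3,4,5,2)]) auto
  qed (use G in auto)
  then show ?case
    using binary_tree_on_attach[OF T(1) move1(2,3)] binary_tree_on_attach[OF T(2) move1(2,4)] by blast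
next
  case (move2 V E i j k v)
  then obtain T1 T2 where T: "binary_tree_on T1 V" "binary_tree_on T2 V" "restricted_clade_graph_is_tree E T1 T2" by blast
  define E0 where "E0 = E - {{i, j}}"
  define E' where "E' = E0 \<union> {{v, i}, {v, j}, {v, k}}"
  note G = henneberg_graph[OF move2(1)] henneberg_graph[OF henneberg.move2[OF move2(1-7)]]
  have G': "simple_graph (insert v V) E'" using G by (simp add: E'_def E0_def)
  have ij: "i \<in> V" "j \<in> V" using simple_graph_endpoints[of V E i j] G move2 by auto
  note d = move2(3,5,6)
  let ?W = "clade_graph_vertices T1 T2" and ?ends = "clade_graph_ends T1 T2"
  have tree: "mg_connected ?W E ?ends" "card E + 1 = card ?W"
    using T(3) mg_tree_iff[OF clade_graph_loopless[of V E T1 T2]] G T unfolding restricted_clade_graph_is_tree_def by auto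
  have fresh: "e \<subseteq> V" if "e \<in> E" for e using simple_graph_edge_subset[of V E e] G that by blast
  have fin: "finite E" using simple_graph_finite G by blast
  have "{v, u} \<notin> E0" for u using fresh move2(7) unfolding E0_def by blast
  moreover have "finite E0" using fin by (simp add: E0_def)
  moreover have "{v, i} \<noteq> {v, j}" "{v, i} \<noteq> {v, k}" "{v, j} \<noteq> {v, k}" using d by (auto simp: doubleton_eq_iff)
  ultimately have "card E' = card E0 + 3" by (simp add: E'_def)
  moreover have "card E = Suc (card E0)" using card.remove[OF fin move2(2)] unfolding E0_def .
  ultimately have card: "card E' + 1 = 2 * card V" using tree(2) card_clade_graph_vertices[OF T(1,2)] by simp
  have G0: "simple_graph V E0" using G unfolding E0_def simple_graph_def by blast
  define u0 where "u0 = (Inl (clade_of T1 {i, j}) :: nat set + nat set)"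
  define w0 where "w0 = (Inr (clade_of T2 {i, j}) :: nat set + nat set)"
  have ends0: "?ends {i, j} = {u0, w0}" by (simp add: clade_graph_ends_def u0_def w0_def)
  have eq: "insert {i, j} E0 = E" using move2(2) by (auto simp: E0_def)
  \<comment> \<open>Without \<open>ij\<close>, every vertex still reaches one of the two ends of
    that edge.\<close>
  have split: "mg_conn E0 ?ends u0 s \<or> mg_conn E0 ?ends w0 s" if "s \<in> ?W" for s
  proof -
    have "u0 \<in> ?W" unfolding u0_def
      using clade_of_in_clades[OF T(1) ij d(1)] by (simp add: clade_graph_vertices_def)
    then have "mg_conn (insert {i, j} E0) ?ends u0 s" unfolding eq using tree(1) that by (simp add: mg_connected_def)
    from mg_conn_insert_cases[OF this ends0] show ?thesis by blast
  qed
  \<comment> \<open>\<open>v\<close> is attached at \<open>x\<close> in the first tree and at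
    \<open>y\<close> in the second, and \<open>vz\<close> reconnects the two pieces if its ends lie
    on opposite sides, which is what \<open>link\<close> says.\<close>
  have reattach: ?case
    if xyz: "{x, y, z} = {i, j, k}" "x \<noteq> y" "z \<noteq> x" "z \<noteq> y"
      and link: "mg_conn E0 ?ends u0 (Inl (clade_of T1 {x, z})) \<and> mg_conn E0 ?ends w0 (Inr (clade_of T2 {y, z})) \<or>
        mg_conn E0 ?ends w0 (Inl (clade_of T1 {x, z})) \<and> mg_conn E0 ?ends u0 (Inr (clade_of T2 {y, z}))" for x y z
  proof -
    have "{x, y, z} \<subseteq> V" unfolding xyz(1) using ij move2(4) by simp
    then have V: "x \<in> V" "y \<in> V" "z \<in> V" by auto
    have edges: "E' = E0 \<union> {{v, x}, {v, y}, {v, z}}"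
    proof -
      have "{{v, x}, {v, y}, {v, z}} = (\<lambda>u. {v, u}) ` {x, y, z}" by simp
      then show ?thesis unfolding xyz(1) E'_def by simp
    qed
    let ?\<Phi> = "attach_vertex x y v" and ?ends' = "clade_graph_ends (attach x v T1) (attach y v T2)"
    note ctx = T(1,2) V(1,2) xyz(2) move2(7)
    have lift: "mg_conn E' ?ends' (?\<Phi> s) (?\<Phi> t)" if "mg_conn E0 ?ends s t" for s t
      by (rule mg_conn_attach[OF ctx G0 _ that]) (auto simp: E'_def)
    have "?ends' {v, z} = {?\<Phi> (Inl (clade_of T1 {x, z})), ?\<Phi> (Inr (clade_of T2 {y, z}))}"
      using clade_graph_ends_attach_z[OF ctx V(3) xyz(3,4)] .
    then have "mg_adj E' ?ends' (?\<Phi> (Inl (clade_of T1 {x, z}))) (?\<Phi> (Inr (clade_of T2 {y, z})))"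
      using edges unfolding mg_adj_def by blast
    then have st: "mg_conn E' ?ends' (?\<Phi> (Inl (clade_of T1 {x, z}))) (?\<Phi> (Inr (clade_of T2 {y, z})))" by blast
    have uw: "mg_conn E' ?ends' (?\<Phi> u0) (?\<Phi> w0)"
      using link
    proof
      assume l: "mg_conn E0 ?ends u0 (Inl (clade_of T1 {x, z})) \<and> mg_conn E0 ?ends w0 (Inr (clade_of T2 {y, z}))"
      show ?thesis
        using rtranclp_trans[OF rtranclp_trans[OF lift[OF conjunct1[OF l]] st] mg_conn_sym[OF lift[OF conjunct2[OF l]]]] .
    next
      assume l: "mg_conn E0 ?ends w0 (Inl (clade_of T1 {x, z})) \<and> mg_conn E0 ?ends u0 (Inr (clade_of T2 {y, z}))"
      show ?thesis
        using rtranclp_trans[OF rtranclp_trans[OF lift[OF conjunct2[OF l]] mg_conn_sym[OF st]] mg_conn_sym[OF lift[OF conjunct1[OF l]]]] .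
    qed
    have "restricted_clade_graph_is_tree E' (attach x v T1) (attach y v T2)"
    proof (rule clade_tree_attach[OF ctx G' _ card, where base = u0])
      show "{{v, x}, {v, y}} \<subseteq> E'" using edges by blast
      fix s assume "s \<in> ?W"
      then show "mg_conn E' ?ends' (?\<Phi> u0) (?\<Phi> s)" using split[of s] lift uw by (meson rtranclp_trans)
    qed
    then show ?thesis
      using binary_tree_on_attach[OF T(1) move2(7) V(1)] binary_tree_on_attach[OF T(2) move2(7) V(2)]
      unfolding E'_def E0_def by blast
  qed
  have in_W: "Inl (clade_of T1 {a, b}) \<in> ?W" "Inr (clade_of T2 {a, b}) \<in> ?W" if "a \<in> V" "b \<in> V" "a \<noteq> b" for a b
    using clade_of_in_clade_graph_vertices[OF T(1,2) ij d(1) move2(7)] that by blast+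
  have self: "mg_conn E0 ?ends u0 (Inl (clade_of T1 {i, j}))" "mg_conn E0 ?ends w0 (Inr (clade_of T2 {i, j}))"
    by (simp_all add: u0_def w0_def)
  \<comment> \<open>If \<open>c_T1(ik)\<close> is on the side of \<open>u0\<close>, take
    \<open>z = i\<close>: the other end is then \<open>w0\<close> itself. Otherwise
    \<open>z = k\<close> works when \<open>c_T2(jk)\<close> is on the side of \<open>u0\<close>, and
    \<open>z = j\<close>, with first end \<open>u0\<close> itself, when it is on the side of
    \<open>w0\<close>.\<close>
  show ?case
  proof (cases "mg_conn E0 ?ends u0 (Inl (clade_of T1 {i, k}))")
    case True
    then show ?thesis using self d by (intro reattach[of k j i]) (auto simp: insert_commute)
  next
    case F1: False
    then have w1: "mg_conn E0 ?ends w0 (Inl (clade_of T1 {i, k}))"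
      using split[OF in_W(1)[of i k]] ij move2 by auto
    show ?thesis
    proof (cases "mg_conn E0 ?ends u0 (Inr (clade_of T2 {j, k}))")
      case True
      then show ?thesis using w1 d by (intro reattach[of i j k]) auto
    next
      case False
      then have "mg_conn E0 ?ends w0 (Inr (clade_of T2 {j, k}))"
        using split[OF in_W(2)[of j k]] ij move2 by auto
      then show ?thesis using self d by (intro reattach[of i k j]) (auto simp: insert_commute)
    qed
  qed
qed

section \<open>The equivalence\<close>

lemma generically_rigid_2_mono:
  assumes "generically_rigid_2 V F" "F \<subseteq> E"
  shows "generically_rigid_2 V E"
proof -
  have "rigid_framework V E p" if "rigid_framework V F p" for p
    using that assms(2) unfolding rigid_framework_def by (meson subsetD)
  then show ?thesis using assms(1) unfolding generically_rigid_2_def by blast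
qed

text \<open>The hypothesis \<open>laman\<close> is supplied later through the clade trees. It fixes
  the edge count: if \<open>E - {e}\<close> were still rigid, it would contain a Laman graph on the
  same vertices with fewer edges than the Laman graph \<open>E\<close>. Conversely, a minimally
  rigid graph has no edge outside its rigid Laman subgraph.\<close>

lemma henneberg_iff_generically_minimally_rigid:
  assumes V: "finite V" "card V \<ge> 2" and G: "simple_graph V E" and laman: "henneberg V E \<Longrightarrow> laman V E"
  shows "henneberg V E \<longleftrightarrow> generically_minimally_rigid_2 V E"
proof
  assume h: "henneberg V E"
  have "\<not> generically_rigid_2 V (E - {e})" if "e \<in> E" for e
  proof
    assume r: "generically_rigid_2 V (E - {e})"
    have G': "simple_graph V (E - {e})" using G unfolding simple_graph_def by blast
    obtain F where F: "F \<subseteq> E - {e}" "laman V F"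
      using generically_rigid_contains_laman[OF V(1) G' V(2) r] by blast
    have "finite E" using simple_graph_finite[OF G V(1)] .
    moreover have "F \<subset> E" using F(1) that by blast
    ultimately have "card F < card E" by (rule psubset_card_mono)
    then show False using F(2) laman[OF h] by (simp add: laman_def)
  qed
  then show "generically_minimally_rigid_2 V E"
    using henneberg_imp_generically_rigid[OF h] unfolding generically_minimally_rigid_2_def by blast
next
  assume m: "generically_minimally_rigid_2 V E"
  then obtain F where F: "F \<subseteq> E" "laman V F"
    using generically_rigid_contains_laman[OF V(1) G V(2)] unfolding generically_minimally_rigid_2_def by blast
  have "simple_graph V F" using G F(1) unfolding simple_graph_def by blast
  then have h: "henneberg V F" using laman_imp_henneberg[OF F(2)] V(2) by blast
  have "e \<in> F" if "e \<in> E" for e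
  proof (rule ccontr)
    assume "e \<notin> F"
    then have "generically_rigid_2 V (E - {e})"
      using F(1) by (intro generically_rigid_2_mono[OF henneberg_imp_generically_rigid[OF h]]) blast
    then show False using m that unfolding generically_minimally_rigid_2_def by blast
  qed
  then have "E = F" using F(1) by blast
  then show "henneberg V E" using h by simp
qed

theorem theorem4p7:
  fixes n :: nat and E :: "nat set set"
  assumes "n \<ge> 2" and "simple_graph {1..n} E"
  shows "(laman {1..n} E \<longleftrightarrow> henneberg {1..n} E)
       \<and> (henneberg {1..n} E \<longleftrightarrow>
            (\<exists>T1 T2. binary_tree_on T1 {1..n} \<and> binary_tree_on T2 {1..n} \<and>
                     restricted_clade_graph_is_tree E T1 T2))
       \<and> ((\<exists>T1 T2. binary_tree_on T1 {1..n} \<and> binary_tree_on T2 {1..n} \<and>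
                     restricted_clade_graph_is_tree E T1 T2)
            \<longleftrightarrow> generically_minimally_rigid_2 {1..n} E)"
proof -
  let ?trees = "\<exists>T1 T2. binary_tree_on T1 {1..n} \<and> binary_tree_on T2 {1..n} \<and>
                     restricted_clade_graph_is_tree E T1 T2"
  have card: "card {1..n} \<ge> 2" using assms(1) by simp
  have "laman {1..n} E \<Longrightarrow> henneberg {1..n} E" using laman_imp_henneberg assms(2) card by blast
  moreover have "henneberg {1..n} E \<Longrightarrow> ?trees" by (rule henneberg_imp_clade_trees)
  moreover have "?trees \<Longrightarrow> laman {1..n} E" using clade_tree_imp_laman[OF assms(2)] by blast
  moreover have "henneberg {1..n} E \<longleftrightarrow> generically_minimally_rigid_2 {1..n} E"
    using calculation by (intro henneberg_iff_generically_minimally_rigid finite_atLeastAtMost card assms(2)) blast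
  ultimately show ?thesis by blast
qed

end
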